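(* For every finitely generated subgroup $H=\langle h_1,\dots,h_k\rangle$ of $\widetilde{G}$ that is not abelian and every $\varepsilon>0$ there exists a symmetric non-degenerate probability measure $\mu$ on $H$ with non-trivial Poisson boundary such that $$\int_H|g|^{1-\varepsilon}\,d\mu(g)<\infty,$$ where $|g|$ is the word length of $g$.
   Context: $PSL_2(\mathbb{R})$ acts on $\mathbb{R}\cup\{\infty\}$ by $x\mapsto\frac{ax+b}{cx+d}$. $\widetilde{G}$ (the piecewise $PSL_2(\mathbb{Z})$ group) is the group of all homeomorphisms of $\mathbb{R}\cup\{\infty\}$ that fix $\infty$ and are piecewise in $PSL_2(\mathbb{Z})$ with finitely many pieces. The word length on $H$ is taken with respect to a finite generating set. A measure $\mu$ on $H$ is symmetric if $\mu(g)=\mu(g^{-1})$ for all $g$, and non-degenerate if its support generates $H$. Poisson boundary: for a probability measure $\mu$ on a countable group $H$, consider the random walk $x_0=e$, $x_{n+1}=y_nx_n$ with i.i.d. increments $y_n$ of law $\mu$, and let $P$ be the associated Markov measure on the trajectory space $H^{\mathbb{N}}$. Two trajectories $(x_i)$ and $(x'_i)$ are equivalent if there exist $i_0\in\mathbb{N}$ and $k\in\mathbb{Z}$ such that $x_i=x'_{i+k}$ for all $i>i_0$. The Poisson boundary of $(H,\mu)$ is the quotient of $(H^{\mathbb{N}},P)$ by the measurable hull of this equivalence relation; it is non-trivial if it is not a single point up to null sets. When $\operatorname{supp}(\mu)$ generates $H$ as a semigroup, non-triviality is equivalent to the existence of a non-constant bounded function $f$ on $H$ with $f(g)=\sum_{h\in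 H}f(hg)\mu(h)$ for all $g\in H$. *)

theory Defs
  imports "HOL-Probability.Probability" "HOL-Algebra.Generated_Groups"
begin

section \<open>The piecewise projective group\<close>

text \<open>The projective line over the reals is the one-point compactification of the line;
  its points are \<open>Some x\<close> (real) and \<open>None\<close> (infinity).\<close>

abbreviation proj_line :: "real option topology" where
  "proj_line \<equiv> Alexandroff_compactification euclideanreal"

fun proj_moebius :: "real \<Rightarrow> real \<Rightarrow> real \<Rightarrow> real \<Rightarrow> real option \<Rightarrow> real option" where
  "proj_moebius a b c d (Some x) = (if c * x + d = 0 then None else Some (moebius a b c d x))"
| "proj_moebius a b c d None = (if c = 0 then None else Some (a / c))"

text \<open>The action on the projective line is faithful, so elements of \<open>PSL\<^sub>2(\<int>)\<close> are identified
  with the transformations they induce.\<close>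

definition PSL2Z :: "(real option \<Rightarrow> real option) set" where
  "PSL2Z = {proj_moebius (of_int a) (of_int b) (of_int c) (of_int d) | a b c d :: int.
              a * d - b * c = 1}"

text \<open>The pieces are connected subsets (arcs) of the projective line. No restriction is put on
  the points where two pieces meet, and single points are allowed as pieces; for a homeomorphism
  the latter makes no difference.\<close>

definition piecewise_PSL2Z :: "(real option \<Rightarrow> real option) \<Rightarrow> bool" where
  "piecewise_PSL2Z f \<longleftrightarrow>
     (\<exists>\<P>. finite \<P> \<and> \<Union>\<P> = topspace proj_line \<and>
          (\<forall>p\<in>\<P>. connectedin proj_line p \<and> (\<exists>m\<in>PSL2Z. \<forall>x\<in>p. f x = m x)))"

definition Gtilde :: "(real option \<Rightarrow> real option) monoid" where
  "Gtilde = \<lparr>carrier = {f. homeomorphic_map proj_line proj_line f \<and> f None = None \<and>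
                             piecewise_PSL2Z f},
              mult = (\<circ>), one = id\<rparr>"

section \<open>Word length and measures on a group\<close>

definition word_length :: "('a, 'b) monoid_scheme \<Rightarrow> 'a set \<Rightarrow> 'a \<Rightarrow> nat" where
  "word_length G S g =
     (LEAST n. \<exists>ws. length ws = n \<and> set ws \<subseteq> S \<union> (\<lambda>s. inv\<^bsub>G\<^esub> s) ` S \<and>
                    foldr (\<lambda>x y. x \<otimes>\<^bsub>G\<^esub> y) ws \<one>\<^bsub>G\<^esub> = g)"

text \<open>Measures on a (countable) group are defined on all its subsets.\<close>

definition prob_measure_on :: "('a, 'b) monoid_scheme \<Rightarrow> 'a measure \<Rightarrow> bool" where
  "prob_measure_on G \<mu> \<longleftrightarrow> prob_space \<mu> \<and> sets \<mu> = Pow (carrier G)"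

definition symmetric_measure :: "('a, 'b) monoid_scheme \<Rightarrow> 'a measure \<Rightarrow> bool" where
  "symmetric_measure G \<mu> \<longleftrightarrow> (\<forall>g\<in>carrier G. measure \<mu> {g} = measure \<mu> {inv\<^bsub>G\<^esub> g})"

definition nondegenerate_measure :: "('a, 'b) monoid_scheme \<Rightarrow> 'a measure \<Rightarrow> bool" where
  "nondegenerate_measure G \<mu> \<longleftrightarrow> generate G {g \<in> carrier G. measure \<mu> {g} \<noteq> 0} = carrier G"

section \<open>The Poisson boundary\<close>

primrec walk :: "('a, 'b) monoid_scheme \<Rightarrow> (nat \<Rightarrow> 'a) \<Rightarrow> nat \<Rightarrow> 'a" where
  "walk G y 0 = \<one>\<^bsub>G\<^esub>"
| "walk G y (Suc n) = y n \<otimes>\<^bsub>G\<^esub> walk G y n"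

definition markov_measure :: "('a, 'b) monoid_scheme \<Rightarrow> 'a measure \<Rightarrow> (nat \<Rightarrow> 'a) measure" where
  "markov_measure G \<mu> =
     distr (Pi\<^sub>M UNIV (\<lambda>_::nat. \<mu>)) (Pi\<^sub>M UNIV (\<lambda>_::nat. count_space (carrier G))) (walk G)"

definition trajectory_rel :: "('a, 'b) monoid_scheme \<Rightarrow> ((nat \<Rightarrow> 'a) \<times> (nat \<Rightarrow> 'a)) set" where
  "trajectory_rel G =
     {(x, x'). x \<in> UNIV \<rightarrow> carrier G \<and> x' \<in> UNIV \<rightarrow> carrier G \<and>
        (\<exists>(i0::nat) (k::int). \<forall>i>i0. int i + k \<ge> 0 \<and> x i = x' (nat (int i + k)))}"

text \<open>Rokhlin's notion of a measurable partition, given as an equivalence relation: the partition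
  is determined by countably many measurable sets.\<close>

definition measurable_equiv :: "'a measure \<Rightarrow> ('a \<times> 'a) set \<Rightarrow> bool" where
  "measurable_equiv M E \<longleftrightarrow>
     (\<exists>A :: nat \<Rightarrow> 'a set. range A \<subseteq> sets M \<and>
        E = {(x, y) \<in> space M \<times> space M. \<forall>n. x \<in> A n \<longleftrightarrow> y \<in> A n})"

text \<open>The measurable hull of \<open>R\<close> is the smallest measurable equivalence relation containing \<open>R\<close>,
  where smallest is understood up to a null set; so it is unique up to a null set.\<close>

definition measurable_hull :: "'a measure \<Rightarrow> ('a \<times> 'a) set \<Rightarrow> ('a \<times> 'a) set \<Rightarrow> bool" where
  "measurable_hull M R E \<longleftrightarrow>
     measurable_equiv M E \<and> R \<subseteq> E \<and>
     (\<forall>E'. measurable_equiv M E' \<and> R \<subseteq> E' \<longrightarrow>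
        (\<exists>N\<in>null_sets M. \<forall>x\<in>space M - N. \<forall>y\<in>space M - N. (x, y) \<in> E \<longrightarrow> (x, y) \<in> E'))"

definition quotient_measure :: "'a measure \<Rightarrow> ('a \<times> 'a) set \<Rightarrow> 'a set measure" where
  "quotient_measure M E =
     measure_of (space M // E) {B. B \<subseteq> space M // E \<and> \<Union>B \<in> sets M} (\<lambda>B. emeasure M (\<Union>B))"

definition is_poisson_boundary ::
    "('a, 'b) monoid_scheme \<Rightarrow> 'a measure \<Rightarrow> (nat \<Rightarrow> 'a) set measure \<Rightarrow> bool" where
  "is_poisson_boundary G \<mu> B \<longleftrightarrow>
     (\<exists>E. measurable_hull (markov_measure G \<mu>) (trajectory_rel G) E \<and>
          B = quotient_measure (markov_measure G \<mu>) E)"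

text \<open>As the hull is unique up to a null set, so is the Poisson boundary, and any version of it
  can be used to decide whether it is trivial.\<close>

definition nontrivial_poisson_boundary :: "('a, 'b) monoid_scheme \<Rightarrow> 'a measure \<Rightarrow> bool" where
  "nontrivial_poisson_boundary G \<mu> \<longleftrightarrow>
     (\<exists>B. is_poisson_boundary G \<mu> B \<and> \<not> (\<exists>p\<in>space B. AE q in B. q = p))"

end

theory Submission
  imports Defs
begin

text \<open>The boundary is detected by jumps. For a homeomorphism \<open>g\<close> in the group and a real point
  \<open>a\<close>, the jump of \<open>g\<close> at \<open>a\<close> is the quotient of the two one-sided germs of \<open>g\<close> at \<open>a\<close>, an
  element of \<open>PSL\<^sub>2(\<int>)\<close>. Passing from \<open>g\<close> to \<open>y \<circ> g\<close> changes it only if \<open>y\<close> jumps at the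
  point \<open>g a\<close>, and \<open>y\<close> jumps at finitely many points. So, if the orbit of \<open>a\<close> is transient
  for the walk and a step has finitely many jumps on average, the jump at \<open>a\<close> along the walk
  is almost surely eventually constant. Now take an element \<open>k\<close> which fixes \<open>a\<close>, is trivial
  on the left of \<open>a\<close> and not trivial on the right. A walk that starts with the step \<open>k\<close> has
  its limit multiplied by the right germ of \<open>k\<close>, so some event that the limit has a given
  value is neither null nor of full measure. Such an event does not depend on a shift of
  time, hence the Poisson boundary is not a point (lemma \<open>nontrivial_poisson_boundary\<close>).

  Transience comes from an energy estimate (lemma \<open>green_bounded\<close>). Let \<open>U\<close> be the Green
  function of the first \<open>N\<close> steps with pole \<open>a\<close>; its Dirichlet energy is at most \<open>2 U(a)\<close>.
  Suppose that sets \<open>L 0 = {a}\<close> and \<open>L (n+1) = p n (L n) \<union> q n (L n)\<close> double in size, and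
  that \<open>p n\<close> and \<open>q n\<close> have measure at least \<open>m n\<close>. By Cauchy-Schwarz the averages of \<open>U\<close>
  over \<open>L n\<close> and \<open>L (n+1)\<close> differ by at most \<open>sqrt (2 U(a)) sqrt (1 / (2^n m n))\<close>, while
  these averages tend to zero since \<open>U\<close> has total mass \<open>N\<close>. If the series of the numbers
  \<open>sqrt (1 / (2^n m n))\<close> converges to \<open>c\<close>, then \<open>U(a) \<le> 2 c\<^sup>2\<close> for every \<open>N\<close>.

  The moment condition is compatible with this when \<open>p n\<close> and \<open>q n\<close> are taken from a finite
  set and the powers \<open>r ^ (2^n)\<close> of one element \<open>r\<close>: these have word length \<open>O(2^n)\<close>, so
  with weights \<open>m n\<close> proportional to \<open>2 powr (- n \<sigma>)\<close>, where \<open>1 - \<epsilon> < \<sigma> < 1\<close>, both the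
  moment of order \<open>1 - \<epsilon>\<close> and the series above are finite (locale \<open>dyadic_steps\<close>).

  It remains to find \<open>a\<close>, \<open>k\<close>, \<open>r\<close> and the levels (lemma \<open>dynamics_core\<close>). Look at the part
  of the line moved by \<open>H\<close> around a point where two elements do not commute, and at its left
  end: a common fixed point of \<open>H\<close>, or minus infinity. The germs of \<open>H\<close> at this end form a
  cyclic group, because the entries of the matrices are integers. So a commutator \<open>k\<close> is
  trivial near the end, and the infimum of its moved points is the point \<open>a\<close>. Let \<open>s\<close>
  generate the germs and contract towards the end. If \<open>s\<close> has a fixed point \<open>c\<close> in the
  component, then \<open>s\<close> and a conjugate of it have equal germs at the end but differ at \<open>c\<close>,
  and two elements built from them play ping-pong (lemma \<open>ping_pong\<close>); the levels are the
  images of a point under the words in these two elements, and \<open>r\<close> is the identity.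
  Otherwise \<open>s\<close> contracts the whole component, \<open>r = s\<close>, and the levels are the points
  \<open>s^i a\<close> with \<open>i < 2^n\<close>. Then the number of jumps of \<open>r ^ (2^n)\<close> need not be bounded, and
  the jump of \<open>g\<close> at \<open>a\<close> is replaced by the eventual jump of \<open>s^(-m) g\<close> at \<open>a\<close> as \<open>m\<close> grows.
  Multiplying \<open>g\<close> by a power of \<open>s\<close> does not change it, and for the other elements the set
  of exceptional points is again finite, because every element agrees near the end with a
  power of \<open>s\<close> (lemma \<open>finite_bad_contraction\<close>).\<close>

section \<open>Measurable hulls\<close>

text \<open>The finite stages of closing up under complements and unions are countable, and so is
  their union.\<close>

lemma countable_algebra_hull:
  fixes \<Omega> :: "'a set"
  assumes "countable \<A>" "\<A> \<subseteq> Pow \<Omega>"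
  obtains \<C> where "countable \<C>" "\<A> \<subseteq> \<C>" "\<C> \<subseteq> sigma_sets \<Omega> \<A>" "{} \<in> \<C>"
    "\<And>A. A \<in> \<C> \<Longrightarrow> \<Omega> - A \<in> \<C>" "\<And>A B. A \<in> \<C> \<Longrightarrow> B \<in> \<C> \<Longrightarrow> A \<union> B \<in> \<C>"
proof
  define st where "st = (\<lambda>\<B>. \<B> \<union> (\<lambda>A. \<Omega> - A) ` \<B> \<union> (\<lambda>(A, B). A \<union> B) ` (\<B> \<times> \<B>))"
  define F where "F n = (st ^^ n) (insert {} \<A>)" for n :: nat
  have F_Suc: "F (Suc n) = st (F n)" for n by (simp add: F_def)
  have F0: "F 0 = insert {} \<A>" by (simp add: F_def)
  have mono: "F m \<subseteq> F n" if "m \<le> n" for m n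
    using lift_Suc_mono_le[of F, OF _ that] by (auto simp: F_Suc st_def)
  show "countable (\<Union>n. F n)"
  proof (intro countable_UN)
    fix n show "countable (F n)"
      by (induction n) (auto simp: F0 F_Suc st_def assms)
  qed auto
  show "\<A> \<subseteq> (\<Union>n. F n)" "{} \<in> (\<Union>n. F n)" using F0 by blast+
  have "F n \<subseteq> sigma_sets \<Omega> \<A>" for n
  proof (induction n)
    case 0
    then show ?case by (auto simp: F0 sigma_sets.Empty)
  next
    case (Suc n)
    then show ?case
      by (auto simp: F_Suc st_def intro!: sigma_sets.Compl sigma_sets_Un)
  qed
  then show "(\<Union>n. F n) \<subseteq> sigma_sets \<Omega> \<A>" by blast
  show "\<Omega> - A \<in> (\<Union>n. F n)" if "A \<in> (\<Union>n. F n)" for A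
  proof -
    from that obtain n where "A \<in> F n" by blast
    then have "\<Omega> - A \<in> F (Suc n)" by (auto simp: F_Suc st_def)
    then show ?thesis by blast
  qed
  show "A \<union> B \<in> (\<Union>n. F n)" if AB: "A \<in> (\<Union>n. F n)" "B \<in> (\<Union>n. F n)" for A B
  proof -
    from AB obtain m n where "A \<in> F m" "B \<in> F n" by blast
    then have "A \<in> F (max m n)" "B \<in> F (max m n)" using mono by (meson max.cobounded1 max.cobounded2 subsetD)+
    then have "A \<union> B \<in> F (Suc (max m n))" by (force simp: F_Suc st_def)
    then show ?thesis by blast
  qed
qed

lemma (in finite_measure) measure_sym_diff_triangle:
  assumes "A \<in> sets M" "B \<in> sets M" "C \<in> sets M"
  shows "measure M (sym_diff A C) \<le> measure M (sym_diff A B) + measure M (sym_diff B C)"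
proof -
  have "measure M (sym_diff A C) \<le> measure M (sym_diff A B \<union> sym_diff B C)"
    using assms by (intro finite_measure_mono) auto
  also have "\<dots> \<le> measure M (sym_diff A B) + measure M (sym_diff B C)"
    using assms by (intro measure_subadditive) auto
  finally show ?thesis .
qed

text \<open>The sets which can be approximated by members of an algebra form a \<open>\<sigma>\<close>-algebra: a
  countable union is approximated by a finite one, and a finite union by the union of
  approximations.\<close>

lemma (in finite_measure) approximation_by_algebra:
  assumes sets: "sets M = sigma_sets (space M) \<A>" and sub: "\<A> \<subseteq> \<C>" "\<C> \<subseteq> sets M" and empty: "{} \<in> \<C>"
    and compl: "\<And>A. A \<in> \<C> \<Longrightarrow> space M - A \<in> \<C>" and un: "\<And>A B. A \<in> \<C> \<Longrightarrow> B \<in> \<C> \<Longrightarrow> A \<union> B \<in> \<C>"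
    and A: "A \<in> sets M"
  shows "\<forall>e>0. \<exists>F\<in>\<C>. measure M (sym_diff A F) < e"
  using A unfolding sets
proof (induction rule: sigma_sets.induct)
  case (Basic a)
  then show ?case using sub by (auto intro!: bexI[of _ a])
next
  case Empty
  then show ?case using empty by (auto intro!: bexI[of _ "{}"])
next
  case (Compl a)
  show ?case
  proof (intro allI impI)
    fix e :: real assume "e > 0"
    then obtain F where F: "F \<in> \<C>" "measure M (sym_diff a F) < e" using Compl.IH by blast
    have "a \<subseteq> space M" using Compl.hyps sets sets.sets_into_space by blast
    moreover have "F \<subseteq> space M" using F(1) sub sets.sets_into_space by blast
    ultimately have "sym_diff (space M - a) (space M - F) = sym_diff a F" by blast
    then show "\<exists>F\<in>\<C>. measure M (sym_diff (space M - a) F) < e"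
      using F compl by (intro bexI[of _ "space M - F"]) auto
  qed
next
  case (Union a)
  have am: "a i \<in> sets M" for i using Union.hyps sets by simp
  show ?case
  proof (intro allI impI)
    fix e :: real assume e: "e > 0"
    have "(\<lambda>n. measure M (\<Union>i\<le>n. a i)) \<longlonglongrightarrow> measure M (\<Union>n. \<Union>i\<le>n. a i)"
      using am by (intro finite_Lim_measure_incseq incseq_SucI) (auto simp: atMost_Suc)
    moreover have "(\<Union>n. \<Union>i\<le>n. a i) = (\<Union>i. a i)" by auto
    ultimately have "(\<lambda>n. measure M (\<Union>i\<le>n. a i)) \<longlonglongrightarrow> measure M (\<Union>i. a i)" by simp
    then have "eventually (\<lambda>n. measure M (\<Union>i\<le>n. a i) > measure M (\<Union>i. a i) - e/2) sequentially"
      using e by (intro order_tendstoD(1)) auto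
    then obtain n where n: "measure M (\<Union>i\<le>n. a i) > measure M (\<Union>i. a i) - e/2"
      by (auto simp: eventually_sequentially)
    have approx: "\<exists>F\<in>\<C>. measure M (sym_diff (\<Union>i<k. a i) F) < d" if "d > 0" for k d
      using that
    proof (induction k arbitrary: d)
      case 0
      then show ?case using empty by (auto intro!: bexI[of _ "{}"])
    next
      case (Suc k)
      obtain F where F: "F \<in> \<C>" "measure M (sym_diff (\<Union>i<k. a i) F) < d/2"
        using Suc.IH[of "d/2"] Suc.prems by auto
      obtain G where G: "G \<in> \<C>" "measure M (sym_diff (a k) G) < d/2"
        using Union.IH[of k] Suc.prems by (meson half_gt_zero)
      have [measurable]: "F \<in> sets M" "G \<in> sets M" using F G sub by auto
      have "measure M (sym_diff (\<Union>i<Suc k. a i) (F \<union> G)) \<le> measure M (sym_diff (\<Union>i<k. a i) F \<union> sym_diff (a k) G)"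
        using am by (intro finite_measure_mono) (auto simp: lessThan_Suc)
      also have "\<dots> \<le> measure M (sym_diff (\<Union>i<k. a i) F) + measure M (sym_diff (a k) G)"
        using am by (intro measure_subadditive) auto
      also have "\<dots> < d" using F G by simp
      finally show ?case using un F G by blast
    qed
    obtain F where F: "F \<in> \<C>" "measure M (sym_diff (\<Union>i<Suc n. a i) F) < e/2"
      using approx[of "e/2" "Suc n"] e by auto
    have Fm: "F \<in> sets M" using F sub by auto
    have "measure M (sym_diff (\<Union>i. a i) (\<Union>i\<le>n. a i)) = measure M ((\<Union>i. a i) - (\<Union>i\<le>n. a i))"
      by (rule arg_cong[where f="measure M"]) auto
    also have "\<dots> = measure M (\<Union>i. a i) - measure M (\<Union>i\<le>n. a i)"
      using am by (intro finite_measure_Diff) auto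
    also have "\<dots> < e/2" using n by simp
    finally have "measure M (sym_diff (\<Union>i. a i) (\<Union>i\<le>n. a i)) < e/2" .
    moreover have "measure M (sym_diff (\<Union>i. a i) F) \<le> measure M (sym_diff (\<Union>i. a i) (\<Union>i\<le>n. a i)) + measure M (sym_diff (\<Union>i\<le>n. a i) F)"
      using am Fm by (intro measure_sym_diff_triangle) auto
    ultimately show "\<exists>F\<in>\<C>. measure M (sym_diff (\<Union> (range a)) F) < e"
      using F by (intro bexI[of _ F]) (auto simp: lessThan_Suc_atMost)
  qed
qed

text \<open>The pseudometric given by the measure of symmetric differences is separable, hence so is
  every subspace: for each point of the countable dense set and each radius, one member of
  the subspace in the ball is kept.\<close>

lemma (in finite_measure) countable_dense_subfamily:
  assumes C: "countable \<C>" "\<C> \<subseteq> sets M" "\<And>A e. A \<in> sets M \<Longrightarrow> e > 0 \<Longrightarrow> \<exists>F\<in>\<C>. measure M (sym_diff A F) < e"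
    and I: "\<I> \<subseteq> sets M" "\<I> \<noteq> {}"
  obtains D :: "nat \<Rightarrow> 'a set" where "range D \<subseteq> \<I>" "\<And>A e. A \<in> \<I> \<Longrightarrow> e > 0 \<Longrightarrow> \<exists>n. measure M (sym_diff A (D n)) < e"
proof -
  define P where "P = (\<lambda>(F, n::nat) A. A \<in> \<I> \<and> measure M (sym_diff A F) < 1 / real (Suc n))"
  define d where "d p = (if \<exists>A. P p A then SOME A. P p A else SOME A. A \<in> \<I>)" for p
  have dP: "P p (d p)" if "P p A" for p A using that unfolding d_def by (auto intro: someI)
  have dI: "d p \<in> \<I>" for p
  proof (cases "\<exists>A. P p A")
    case True
    then have "P p (d p)" using dP by blast
    then show ?thesis by (auto simp: P_def split: prod.splits)
  next
    case False
    then show ?thesis using I(2) some_in_eq by (auto simp: d_def)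
  qed
  have "countable (d ` (\<C> \<times> UNIV))" using C(1) by auto
  moreover have "\<C> \<noteq> {}" using C(3)[of "{}" 1] by auto
  ultimately have "range (from_nat_into (d ` (\<C> \<times> UNIV))) = d ` (\<C> \<times> UNIV)"
    by (intro range_from_nat_into) auto
  then obtain D :: "nat \<Rightarrow> 'a set" where D: "range D = d ` (\<C> \<times> UNIV)"
    by (rule that)
  show thesis
  proof (rule that[of D])
    show "range D \<subseteq> \<I>" using dI D by auto
    fix A and e :: real assume A: "A \<in> \<I>" and "e > 0"
    then obtain n where n: "1 / real (Suc n) < e / 2"
      using nat_approx_posE[of "e/2"] by auto
    obtain F where F: "F \<in> \<C>" "measure M (sym_diff A F) < 1 / real (Suc n)"
      using C(3)[of A "1 / real (Suc n)"] A I by auto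
    then have "P (F, n) A" using A by (simp add: P_def)
    then have "P (F, n) (d (F, n))" by (rule dP)
    then have d: "d (F, n) \<in> \<I>" "measure M (sym_diff (d (F, n)) F) < 1 / real (Suc n)" by (auto simp: P_def)
    have "measure M (sym_diff A (d (F, n))) \<le> measure M (sym_diff A F) + measure M (sym_diff F (d (F, n)))"
      using A I F C d by (intro measure_sym_diff_triangle) auto
    also have "\<dots> < e" using F d n by (simp add: Un_commute)
    finally have "measure M (sym_diff A (d (F, n))) < e" .
    moreover have "d (F, n) \<in> range D" unfolding D using F(1) by simp
    then obtain m where "d (F, n) = D m" by (elim rangeE)
    ultimately show "\<exists>n. measure M (sym_diff A (D n)) < e" by auto
  qed
qed

text \<open>The hull is cut out by countably many invariant sets that are dense among all invariant
  sets. It does not matter which ones are taken: an invariant set is the limit of members of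
  the dense family, and if the errors are summable, then almost every point lies in the set
  if and only if it lies in all but finitely many of the approximations.\<close>

lemma (in finite_measure) measurable_hull_exists:
  assumes C: "countable \<C>" "\<C> \<subseteq> sets M" "\<And>A e. A \<in> sets M \<Longrightarrow> e > 0 \<Longrightarrow> \<exists>F\<in>\<C>. measure M (sym_diff A F) < e"
    and R: "R \<subseteq> space M \<times> space M"
  shows "\<exists>E. measurable_hull M R E"
proof -
  define \<I> where "\<I> = {A \<in> sets M. \<forall>(x, y)\<in>R. x \<in> A \<longleftrightarrow> y \<in> A}"
  have I: "\<I> \<subseteq> sets M" "\<I> \<noteq> {}" by (auto simp: \<I>_def)
  obtain D :: "nat \<Rightarrow> 'a set" where D: "range D \<subseteq> \<I>" "\<And>A e. A \<in> \<I> \<Longrightarrow> e > 0 \<Longrightarrow> \<exists>n. measure M (sym_diff A (D n)) < e"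
    using countable_dense_subfamily[OF C I] by blast
  have Dm: "D n \<in> sets M" for n using D(1) I by blast
  define E where "E = {(x, y) \<in> space M \<times> space M. \<forall>n. x \<in> D n \<longleftrightarrow> y \<in> D n}"
  have "measurable_equiv M E" unfolding measurable_equiv_def E_def using D(1) I by blast
  moreover have "R \<subseteq> E" using R D(1) unfolding E_def \<I>_def by blast
  moreover have "\<exists>N\<in>null_sets M. \<forall>x\<in>space M - N. \<forall>y\<in>space M - N. (x, y) \<in> E \<longrightarrow> (x, y) \<in> E'"
    if E': "measurable_equiv M E'" "R \<subseteq> E'" for E'
  proof -
    obtain A :: "nat \<Rightarrow> 'a set" where A: "range A \<subseteq> sets M" "E' = {(x, y) \<in> space M \<times> space M. \<forall>n. x \<in> A n \<longleftrightarrow> y \<in> A n}"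
      using E'(1) unfolding measurable_equiv_def by blast
    have "A n \<in> \<I>" for n using A E'(2) unfolding \<I>_def by (auto simp: image_subset_iff)
    have null: "\<exists>N\<in>null_sets M. \<forall>x\<in>space M - N. \<forall>y\<in>space M - N. (x, y) \<in> E \<longrightarrow> (x \<in> B \<longleftrightarrow> y \<in> B)" if B: "B \<in> \<I>" for B
    proof -
      have "\<exists>n. measure M (sym_diff B (D n)) < (1/2) ^ k" for k :: nat
        using D(2)[OF B] by simp
      then obtain n where n: "measure M (sym_diff B (D (n k))) < (1/2) ^ k" for k :: nat
        by metis
      have Bm: "B \<in> sets M" using B I by blast
      have sm: "sym_diff B (D (n k)) \<in> sets M" for k using Bm Dm by auto
      \<comment> \<open>Almost every point is misjudged by finitely many of the approximations only.\<close>
      have "AE x in M. eventually (\<lambda>k. x \<in> space M - sym_diff B (D (n k))) sequentially"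
      proof (rule borel_cantelli_AE1[OF sm])
        show "summable (\<lambda>k. measure M (sym_diff B (D (n k))))"
          by (rule summable_comparison_test'[OF summable_geometric[of "1/2::real"], of 0])
            (use n less_imp_le in \<open>auto simp: measure_nonneg\<close>)
      qed (auto simp: emeasure_eq_measure less_top[symmetric])
      then obtain N where N: "{x \<in> space M. \<not> eventually (\<lambda>k. x \<in> space M - sym_diff B (D (n k))) sequentially} \<subseteq> N" "N \<in> null_sets M"
        unfolding eventually_ae_filter by (elim bexE)
      show ?thesis
      proof (intro bexI[OF _ N(2)] ballI impI)
        fix x y assume xy: "x \<in> space M - N" "y \<in> space M - N" "(x, y) \<in> E"
        have "eventually (\<lambda>k. x \<in> space M - sym_diff B (D (n k)) \<and> y \<in> space M - sym_diff B (D (n k))) sequentially"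
          using N(1) xy(1,2) by (intro eventually_conj) blast+
        then obtain k where "x \<in> space M - sym_diff B (D (n k))" "y \<in> space M - sym_diff B (D (n k))"
          by (metis (mono_tags, lifting) eventually_sequentially le_refl)
        moreover have "x \<in> D (n k) \<longleftrightarrow> y \<in> D (n k)" using xy(3) by (auto simp: E_def)
        ultimately show "x \<in> B \<longleftrightarrow> y \<in> B" by blast
      qed
    qed
    have "\<forall>n. \<exists>N\<in>null_sets M. \<forall>x\<in>space M - N. \<forall>y\<in>space M - N. (x, y) \<in> E \<longrightarrow> (x \<in> A n \<longleftrightarrow> y \<in> A n)"
      using null \<open>\<And>n. A n \<in> \<I>\<close> by blast
    then obtain N where N: "\<And>n. N n \<in> null_sets M" "\<And>n x y. x \<in> space M - N n \<Longrightarrow> y \<in> space M - N n \<Longrightarrow> (x, y) \<in> E \<Longrightarrow> x \<in> A n \<longleftrightarrow> y \<in> A n"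
      by metis
    have "(\<Union>n. N n) \<in> null_sets M" using N(1) by (intro null_sets_UN) auto
    then show ?thesis
      by (rule bexI[rotated]) (use N(2) A(2) in \<open>auto\<close>)
  qed
  ultimately show ?thesis unfolding measurable_hull_def by blast
qed

section \<open>Quotients by measurable equivalence relations\<close>

text \<open>The saturated measurable sets are closed under the operations of a \<open>\<sigma>\<close>-algebra because
  distinct classes are disjoint; therefore the quotient measure really is the image measure,
  and a null set of classes has a null union.\<close>

lemma quotient_measure_AE_const:
  assumes E: "equiv (space M) E" and p: "p \<in> space M // E" and ae: "AE q in quotient_measure M E. q = p"
  shows "\<exists>N\<in>null_sets M. space M - N \<subseteq> p"
proof -
  define \<Omega> where "\<Omega> = space M // E"
  define \<S> where "\<S> = {B. B \<subseteq> \<Omega> \<and> \<Union>B \<in> sets M}"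
  have S_Pow: "\<S> \<subseteq> Pow \<Omega>" by (auto simp: \<S>_def)
  have Q: "quotient_measure M E = measure_of \<Omega> \<S> (\<lambda>B. emeasure M (\<Union>B))"
    by (simp add: quotient_measure_def \<Omega>_def \<S>_def)
  have dis: "X \<inter> Y = {}" if "X \<in> \<Omega>" "Y \<in> \<Omega>" "X \<noteq> Y" for X Y
    using quotient_disj[OF E] that by (auto simp: \<Omega>_def)
  have sa: "sigma_algebra \<Omega> \<S>"
  proof (rule sigma_algebra_iff2[THEN iffD2], intro conjI ballI allI impI)
    show "\<S> \<subseteq> Pow \<Omega>" "{} \<in> \<S>" by (auto simp: \<S>_def)
    fix B assume B: "B \<in> \<S>"
    have "\<Union>(\<Omega> - B) = space M - \<Union>B"
    proof
      show "\<Union>(\<Omega> - B) \<subseteq> space M - \<Union>B"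
        using dis B Union_quotient[OF E] unfolding \<S>_def \<Omega>_def by blast
      show "space M - \<Union>B \<subseteq> \<Union>(\<Omega> - B)"
        using Union_quotient[OF E] unfolding \<Omega>_def by blast
    qed
    then show "\<Omega> - B \<in> \<S>" using B by (auto simp: \<S>_def)
  next
    fix A :: "nat \<Rightarrow> 'a set set" assume A: "range A \<subseteq> \<S>"
    then have "\<Union>(A i) \<in> sets M" for i by (auto simp: \<S>_def)
    moreover have "\<Union>(\<Union>i. A i) = (\<Union>i. \<Union>(A i))" by auto
    ultimately show "\<Union>(range A) \<in> \<S>" using A by (auto simp: \<S>_def)
  qed
  have sets: "sets (quotient_measure M E) = \<S>"
    unfolding Q using sa by (simp add: sigma_algebra.sets_measure_of_eq)
  have em: "emeasure (quotient_measure M E) B = emeasure M (\<Union>B)" if "B \<in> \<S>" for B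
  proof (rule emeasure_measure_of[OF Q])
    show "\<S> \<subseteq> Pow \<Omega>" by (rule S_Pow)
    show "positive (sets (quotient_measure M E)) (\<lambda>B. emeasure M (\<Union>B))" by (simp add: positive_def)
    show "countably_additive (sets (quotient_measure M E)) (\<lambda>B. emeasure M (\<Union>B))"
      unfolding sets
    proof (rule countably_additiveI)
      fix A :: "nat \<Rightarrow> 'a set set" assume A: "range A \<subseteq> \<S>" "disjoint_family A"
      have "disjoint_family (\<lambda>i. \<Union>(A i))"
        unfolding disjoint_family_on_def
      proof (intro ballI impI)
        fix m n :: nat assume mn: "m \<noteq> n"
        have "x \<notin> Y" if "X \<in> A m" "Y \<in> A n" "x \<in> X" for x X Y
        proof -
          have "X \<noteq> Y" using that mn A(2) by (auto simp: disjoint_family_on_def)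
          moreover have "X \<in> \<Omega>" "Y \<in> \<Omega>" using that A(1) by (auto simp: \<S>_def)
          ultimately show ?thesis using dis that by blast
        qed
        then show "\<Union>(A m) \<inter> \<Union>(A n) = {}" by blast
      qed
      moreover have "range (\<lambda>i. \<Union>(A i)) \<subseteq> sets M" using A(1) by (auto simp: \<S>_def)
      ultimately have "(\<Sum>i. emeasure M (\<Union>(A i))) = emeasure M (\<Union>i. \<Union>(A i))"
        by (intro suminf_emeasure) auto
      moreover have "\<Union>(\<Union>i. A i) = (\<Union>i. \<Union>(A i))" by auto
      ultimately show "(\<Sum>i. emeasure M (\<Union>(A i))) = emeasure M (\<Union>(\<Union>i. A i))" by simp
    qed
    show "B \<in> sets (quotient_measure M E)" using that sets by simp
  qed
  have sp: "space (quotient_measure M E) = \<Omega>" unfolding Q using S_Pow by (simp add: space_measure_of_conv)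
  obtain N where N: "{q \<in> \<Omega>. q \<noteq> p} \<subseteq> N" "emeasure (quotient_measure M E) N = 0" "N \<in> \<S>"
    using ae by (elim AE_E) (auto simp: sp sets)
  have "\<Union>N \<in> null_sets M" using N em by (auto simp: \<S>_def null_sets_def)
  moreover have "space M - \<Union>N \<subseteq> p"
    using N(1) Union_quotient[OF E] unfolding \<Omega>_def by blast
  ultimately show ?thesis by blast
qed

lemma equiv_measurable_equiv: "measurable_equiv M E \<Longrightarrow> equiv (space M) E"
  unfolding measurable_equiv_def equiv_def refl_on_def sym_def trans_def by fastforce

text \<open>An invariant event defines a measurable equivalence relation with two classes, which
  contains the hull up to a null set. If the quotient were a point, almost all points would
  be equivalent, and the event would be null or of full measure.\<close>

lemma (in prob_space) quotient_measure_hull_nontrivial: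
  assumes E: "measurable_hull M R E" and R: "R \<subseteq> space M \<times> space M"
    and A: "A \<in> events" "\<And>x y. (x, y) \<in> R \<Longrightarrow> x \<in> A \<longleftrightarrow> y \<in> A" "prob A > 0" "prob A < 1"
  shows "\<not> (\<exists>p\<in>space (quotient_measure M E). AE q in quotient_measure M E. q = p)"
proof (rule notI, elim bexE)
  note hull = E[unfolded measurable_hull_def]
  have eq: "equiv (space M) E" using hull[THEN conjunct1] by (rule equiv_measurable_equiv)
  fix p assume p': "p \<in> space (quotient_measure M E)" "AE q in quotient_measure M E. q = p"
  have "space (quotient_measure M E) = space M // E"
    unfolding quotient_measure_def by (rule space_measure_of) auto
  with p' have p: "p \<in> space M // E" by simp
  obtain N where N: "N \<in> null_sets M" "space M - N \<subseteq> p"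
    using quotient_measure_AE_const[OF eq p p'(2)] by (elim bexE)
  define E' where "E' = {(x, y) \<in> space M \<times> space M. x \<in> A \<longleftrightarrow> y \<in> A}"
  have "measurable_equiv M E'" unfolding measurable_equiv_def E'_def
    using A(1) by (intro exI[of _ "\<lambda>_. A"]) auto
  moreover have "R \<subseteq> E'"
  proof (rule subrelI)
    fix x y assume xy: "(x, y) \<in> R"
    with R have "x \<in> space M" "y \<in> space M" by auto
    with A(2)[OF xy] show "(x, y) \<in> E'" unfolding E'_def by simp
  qed
  ultimately have "\<exists>N\<in>null_sets M. \<forall>x\<in>space M - N. \<forall>y\<in>space M - N. (x, y) \<in> E \<longrightarrow> (x, y) \<in> E'"
    by (intro hull[THEN conjunct2, THEN conjunct2, THEN spec, THEN mp] conjI)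
  then obtain N' where N': "N' \<in> null_sets M" "\<forall>x\<in>space M - N'. \<forall>y\<in>space M - N'. (x, y) \<in> E \<longrightarrow> (x, y) \<in> E'"
    by (elim bexE)
  have null: "N \<union> N' \<in> null_sets M" using N(1) N'(1) by (rule null_sets.Un)
  have same: "x \<in> A \<longleftrightarrow> y \<in> A" if "x \<in> space M - (N \<union> N')" "y \<in> space M - (N \<union> N')" for x y
  proof -
    have "{x, y} \<subseteq> p" using that N(2) by auto
    then have "(x, y) \<in> E" by (rule in_quotient_imp_in_rel[OF eq p])
    then have "(x, y) \<in> E'" using that by (intro N'(2)[THEN bspec, THEN bspec, THEN mp]) auto
    then show ?thesis unfolding E'_def by simp
  qed
  show False
  proof (cases "\<exists>z\<in>space M - (N \<union> N'). z \<in> A")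
    case True
    then obtain z where z: "z \<in> space M - (N \<union> N')" "z \<in> A" by (elim bexE)
    have "AE x in M. x \<notin> N \<union> N'" using null by (rule AE_not_in)
    then have "AE x in M. x \<in> A" using AE_space
    proof eventually_elim
      case (elim x)
      then have "x \<in> space M - (N \<union> N')" by simp
      from same[OF this z(1)] z(2) show "x \<in> A" by simp
    qed
    then have "prob A = 1" using prob_eq_1[OF A(1)] by simp
    then show False using A(4) by simp
  next
    case False
    then have "A \<subseteq> N \<union> N'" using sets.sets_into_space[OF A(1)] by auto
    then have "A \<in> null_sets M" by (rule null_sets_subset[OF null A(1)])
    then show False using A(3) measure_eq_0_null_sets[of A M] by simp
  qed
qed

section \<open>Invariant events of trajectories\<close>

lemma sets_PiM_count_space_nat: "sets (PiM UNIV (\<lambda>_::nat. count_space C)) = sigma_sets (UNIV \<rightarrow> C) {{f \<in> UNIV \<rightarrow> C. f i \<in> B} | i B. B \<subseteq> C}"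
proof -
  have "sets (PiM UNIV (\<lambda>_::nat. count_space C)) = sigma_sets (PiE UNIV (\<lambda>_. C)) {{f \<in> PiE UNIV (\<lambda>_. C). f i \<in> B} | i B. i \<in> UNIV \<and> B \<in> Pow C}"
    using sets_PiM_single[of UNIV "\<lambda>_::nat. count_space C"] unfolding space_count_space sets_count_space .
  moreover have "PiE UNIV (\<lambda>_::nat. C) = UNIV \<rightarrow> C" by (simp add: PiE_def)
  ultimately show ?thesis unfolding Pow_iff by simp
qed

text \<open>Cylinders over single group elements suffice, since the group is countable.\<close>

lemma sets_PiM_count_space_nat_countable:
  fixes C :: "'a set"
  assumes "countable C"
  shows "\<exists>\<A>. countable \<A> \<and> \<A> \<subseteq> Pow (UNIV \<rightarrow> C) \<and>
    sets (PiM UNIV (\<lambda>_::nat. count_space C)) = sigma_sets (UNIV \<rightarrow> C) \<A>"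
proof (intro exI conjI)
  define cyl where "cyl i h = {x \<in> UNIV \<rightarrow> C. x i = h}" for i :: nat and h :: 'a
  define \<A> where "\<A> = (\<lambda>(i, h). cyl i h) ` (UNIV \<times> C)"
  show "countable \<A>" unfolding \<A>_def using assms by (intro countable_image countable_SIGMA) auto
  show "\<A> \<subseteq> Pow (UNIV \<rightarrow> C)" unfolding \<A>_def cyl_def by auto
  show "sets (PiM UNIV (\<lambda>_::nat. count_space C)) = sigma_sets (UNIV \<rightarrow> C) \<A>"
    unfolding sets_PiM_count_space_nat
  proof (rule sigma_sets_eqI)
    fix a assume "a \<in> {{f \<in> UNIV \<rightarrow> C. f (i::nat) \<in> B} | i B. B \<subseteq> C}"
    then obtain i :: nat and B where a: "a = {f \<in> UNIV \<rightarrow> C. f i \<in> B}" "B \<subseteq> C" by (elim CollectE exE conjE)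
    have eq: "a = \<Union>(cyl i ` B)" unfolding a(1) cyl_def by auto
    show "a \<in> sigma_sets (UNIV \<rightarrow> C) \<A>" unfolding eq
    proof (rule sigma_sets_UNION)
      show "countable (cyl i ` B)" using countable_subset[OF a(2) assms] by (rule countable_image)
      fix b assume "b \<in> cyl i ` B"
      then obtain h where "h \<in> B" "b = cyl i h" by (elim imageE)
      then have "b \<in> \<A>" using a(2) unfolding \<A>_def by (intro image_eqI[of _ _ "(i, h)"]) auto
      then show "b \<in> sigma_sets (UNIV \<rightarrow> C) \<A>" by (rule sigma_sets.Basic)
    qed
  next
    fix b assume "b \<in> \<A>"
    then obtain i h where *: "h \<in> C" "b = cyl i h" unfolding \<A>_def by auto
    then have "b = {f \<in> UNIV \<rightarrow> C. f i \<in> {h}} \<and> {h} \<subseteq> C" by (simp add: cyl_def)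
    then have "b \<in> {{f \<in> UNIV \<rightarrow> C. f (i::nat) \<in> B} | i B. B \<subseteq> C}"
      by (intro CollectI exI)
    then show "b \<in> sigma_sets (UNIV \<rightarrow> C) {{f \<in> UNIV \<rightarrow> C. f (i::nat) \<in> B} | i B. B \<subseteq> C}"
      by (rule sigma_sets.Basic)
  qed
qed

lemma (in finite_measure) measurable_hull_exists_countably_generated:
  assumes "countable \<A>" "\<A> \<subseteq> Pow (space M)" and sets: "sets M = sigma_sets (space M) \<A>"
    and R: "R \<subseteq> space M \<times> space M"
  shows "\<exists>E. measurable_hull M R E"
proof -
  obtain \<C> where C: "countable \<C>" "\<A> \<subseteq> \<C>" "\<C> \<subseteq> sigma_sets (space M) \<A>" "{} \<in> \<C>"
    "\<And>A. A \<in> \<C> \<Longrightarrow> space M - A \<in> \<C>" "\<And>A B. A \<in> \<C> \<Longrightarrow> B \<in> \<C> \<Longrightarrow> A \<union> B \<in> \<C>"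
    using countable_algebra_hull[OF assms(1,2)] by blast
  have Cs: "\<C> \<subseteq> sets M" using C(3) sets by simp
  have dense: "\<exists>F\<in>\<C>. measure M (sym_diff A F) < e" if "A \<in> sets M" "e > 0" for A e
    using approximation_by_algebra[OF sets C(2) Cs C(4,5,6) that(1)] that(2) by blast
  show ?thesis by (rule measurable_hull_exists[OF C(1) Cs dense R])
qed

lemma trajectory_rel_carrier:
  assumes "(x, y) \<in> trajectory_rel G"
  shows "x n \<in> carrier G" "y n \<in> carrier G"
proof -
  have *: "x \<in> UNIV \<rightarrow> carrier G \<and> y \<in> UNIV \<rightarrow> carrier G \<and>
      (\<exists>(i0::nat) (k::int). \<forall>i>i0. int i + k \<ge> 0 \<and> x i = y (nat (int i + k)))"
    using assms unfolding trajectory_rel_def mem_Collect_eq case_prod_conv .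
  show "x n \<in> carrier G" by (rule Pi_mem[OF conjunct1[OF *] UNIV_I])
  show "y n \<in> carrier G" by (rule Pi_mem[OF conjunct1[OF conjunct2[OF *]] UNIV_I])
qed

text \<open>Equivalent trajectories agree, from some time on, up to a shift of time.\<close>

lemma trajectory_rel_eventually_iff:
  assumes "(x, y) \<in> trajectory_rel G"
  shows "eventually (\<lambda>n. P (x n)) sequentially \<longleftrightarrow> eventually (\<lambda>n. P (y n)) sequentially"
proof -
  have "\<exists>(i0::nat) (k::int). \<forall>i>i0. int i + k \<ge> 0 \<and> x i = y (nat (int i + k))"
    using assms unfolding trajectory_rel_def mem_Collect_eq case_prod_conv by (elim conjE)
  then obtain i0 :: nat and k :: int where *: "\<forall>i>i0. int i + k \<ge> 0 \<and> x i = y (nat (int i + k))"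
    by (elim exE)
  have eq: "x i = y (nat (int i + k))" if "i > i0" for i
    by (rule *[THEN spec, THEN mp, OF that, THEN conjunct2])
  show ?thesis
  proof
    assume "eventually (\<lambda>n. P (x n)) sequentially"
    then obtain n0 where n0: "\<forall>n\<ge>n0. P (x n)" unfolding eventually_sequentially by (elim exE)
    have "P (y n)" if n: "n \<ge> nat (int (Suc i0 + n0) + \<bar>k\<bar>)" for n
    proof -
      define i where "i = nat (int n - k)"
      have i: "i > i0" "i \<ge> n0" "nat (int i + k) = n" using n unfolding i_def by linarith+
      show ?thesis using eq[OF i(1)] n0[rule_format, OF i(2)] unfolding i(3) by simp
    qed
    then show "eventually (\<lambda>n. P (y n)) sequentially" unfolding eventually_sequentially by (intro exI allI impI)
  next
    assume "eventually (\<lambda>n. P (y n)) sequentially"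
    then obtain n0 where n0: "\<forall>n\<ge>n0. P (y n)" unfolding eventually_sequentially by (elim exE)
    have "P (x n)" if n: "n \<ge> nat (int (Suc i0 + n0) + \<bar>k\<bar>)" for n
    proof -
      have i: "n > i0" "nat (int n + k) \<ge> n0" using n by linarith+
      show ?thesis using n0[rule_format, OF i(2)] unfolding eq[OF i(1)] .
    qed
    then show "eventually (\<lambda>n. P (x n)) sequentially" unfolding eventually_sequentially by (intro exI allI impI)
  qed
qed

lemma nontrivial_poisson_boundaryI:
  assumes "countable (carrier G)" and P: "prob_space (markov_measure G \<mu>)"
    and A: "A \<in> sets (markov_measure G \<mu>)" "\<And>x y. (x, y) \<in> trajectory_rel G \<Longrightarrow> x \<in> A \<longleftrightarrow> y \<in> A"
      "measure (markov_measure G \<mu>) A > 0" "measure (markov_measure G \<mu>) A < 1"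
  shows "nontrivial_poisson_boundary G \<mu>"
proof -
  define M where "M = markov_measure G \<mu>"
  interpret prob_space M unfolding M_def by (rule P)
  have sp: "space M = UNIV \<rightarrow> carrier G"
    unfolding M_def by (auto simp: markov_measure_def space_PiM PiE_def)
  have setsM: "sets M = sets (PiM UNIV (\<lambda>_::nat. count_space (carrier G)))"
    unfolding M_def markov_measure_def by (rule sets_distr)
  have sub: "trajectory_rel G \<subseteq> space M \<times> space M"
  proof (rule subrelI)
    fix x y assume "(x, y) \<in> trajectory_rel G"
    then have *: "x \<in> UNIV \<rightarrow> carrier G \<and> y \<in> UNIV \<rightarrow> carrier G \<and>
        (\<exists>(i0::nat) (k::int). \<forall>i>i0. int i + k \<ge> 0 \<and> x i = y (nat (int i + k)))"
      unfolding trajectory_rel_def mem_Collect_eq case_prod_conv .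
    show "(x, y) \<in> space M \<times> space M" unfolding sp using * by (elim conjE) (rule SigmaI)
  qed
  obtain \<A> where "countable \<A>" "\<A> \<subseteq> Pow (space M)" "sets M = sigma_sets (space M) \<A>"
    using sets_PiM_count_space_nat_countable[OF assms(1)] unfolding setsM sp by (elim exE conjE)
  from measurable_hull_exists_countably_generated[OF this sub]
  obtain E where E: "measurable_hull M (trajectory_rel G) E" by (rule exE)
  have "is_poisson_boundary G \<mu> (quotient_measure M E)"
    unfolding is_poisson_boundary_def M_def[symmetric] by (rule exI[of _ E]) (rule conjI[OF E refl])
  moreover have "\<not> (\<exists>p\<in>space (quotient_measure M E). AE q in quotient_measure M E. q = p)"
    by (rule quotient_measure_hull_nontrivial[OF E sub A[folded M_def]])
  ultimately show ?thesis
    unfolding nontrivial_poisson_boundary_def by (intro exI[of _ "quotient_measure M E"] conjI)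
qed

section \<open>Random walks on countable groups\<close>

locale group_random_walk = group G + prob_space \<mu> for G (structure) and \<mu> :: "'a measure" +
  assumes countable_carrier: "countable (carrier G)"
    and sets_increment: "sets \<mu> = Pow (carrier G)"
begin

abbreviation \<S> :: "(nat \<Rightarrow> 'a) measure" where "\<S> \<equiv> PiM UNIV (\<lambda>_::nat. \<mu>)"

lemma space_increment: "space \<mu> = carrier G"
  using sets_eq_imp_space_eq[of \<mu> "count_space (carrier G)"] sets_increment by simp

lemma measurable_increment [measurable]:
  fixes f :: "'a \<Rightarrow> 'c::topological_space"
  shows "f \<in> borel_measurable \<mu>"
proof -
  have "measurable \<mu> (borel :: 'c measure) = measurable (count_space (carrier G)) borel"
    by (rule measurable_cong_sets) (simp_all add: sets_increment)
  then show ?thesis by simp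
qed

lemma sequence_space: "sequence_space \<mu>"
  unfolding sequence_space_def by (rule product_prob_spaceI) (rule prob_space_axioms)

lemma space_\<S>: "y \<in> space \<S> \<longleftrightarrow> (\<forall>n. y n \<in> carrier G)"
  by (auto simp: space_PiM space_increment PiE_def)

lemma prob_space_\<S>: "prob_space \<S>"
  by (rule prob_space_PiM) (rule prob_space_axioms)

lemma measurable_component_\<S>: "(\<lambda>y. y n) \<in> measurable \<S> (count_space (carrier G))"
proof -
  have "(\<lambda>y. y n) \<in> measurable \<S> \<mu>" by (rule measurable_component_singleton) simp
  moreover have "measurable \<S> \<mu> = measurable \<S> (count_space (carrier G))"
    by (rule measurable_cong_sets) (simp_all add: sets_increment)
  ultimately show ?thesis by simp
qed

text \<open>On a countable group every function of two measurable group elements is measurable.\<close>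

lemma measurable_pair_count_space:
  assumes "f \<in> measurable M (count_space (carrier G))" "h \<in> measurable M (count_space (carrier G))"
    and F: "\<And>x y. x \<in> carrier G \<Longrightarrow> y \<in> carrier G \<Longrightarrow> F x y \<in> space N"
  shows "(\<lambda>x. F (f x) (h x)) \<in> measurable M N"
proof -
  have "(\<lambda>x. (f x, h x)) \<in> measurable M (count_space (carrier G) \<Otimes>\<^sub>M count_space (carrier G))"
    using assms by (intro measurable_Pair)
  then have "(\<lambda>x. (f x, h x)) \<in> measurable M (count_space (carrier G \<times> carrier G))"
    by (simp add: pair_measure_countable countable_carrier)
  moreover have "case_prod F \<in> measurable (count_space (carrier G \<times> carrier G)) N"
    using F by (auto simp: space_increment)
  ultimately have "case_prod F \<circ> (\<lambda>x. (f x, h x)) \<in> measurable M N" by (rule measurable_comp)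
  then show ?thesis by (simp add: comp_def)
qed

lemma walk_closed: "(\<And>n. y n \<in> carrier G) \<Longrightarrow> walk G y n \<in> carrier G"
  by (induction n) auto

lemma measurable_walk_n: "(\<lambda>y. walk G y n) \<in> measurable \<S> (count_space (carrier G))"
proof (induction n)
  case (Suc n)
  show ?case
    unfolding walk.simps using measurable_component_\<S> Suc
    by (rule measurable_pair_count_space) simp
qed simp

lemma measurable_walk: "walk G \<in> measurable \<S> (PiM UNIV (\<lambda>_::nat. count_space (carrier G)))"
proof (rule measurable_PiM_single')
  show "(\<lambda>y. walk G y i) \<in> measurable \<S> (count_space (carrier G))" for i by (rule measurable_walk_n)
  show "walk G \<in> space \<S> \<rightarrow> UNIV \<rightarrow>\<^sub>E space (count_space (carrier G))"
    by (auto simp: space_\<S> PiE_def walk_closed)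
qed

lemma prob_space_markov_measure: "prob_space (markov_measure G \<mu>)"
  unfolding markov_measure_def by (rule prob_space.prob_space_distr[OF prob_space_\<S> measurable_walk])

text \<open>Increments are multiplied from the left, so the first one stays at the right end. The walk
  that starts with the step \<open>g\<close> is the walk of the remaining increments translated by \<open>g\<close>.\<close>

lemma walk_case_nat:
  assumes "g \<in> carrier G" "\<And>n. y n \<in> carrier G"
  shows "walk G (case_nat g y) (Suc n) = walk G y n \<otimes> g"
proof (induction n)
  case (Suc n)
  have "walk G (case_nat g y) (Suc (Suc n)) = y n \<otimes> walk G (case_nat g y) (Suc n)" by simp
  also have "\<dots> = walk G y (Suc n) \<otimes> g" unfolding Suc using assms walk_closed by (simp add: m_assoc)
  finally show ?case .
qed (use assms in simp)

lemma nn_integral_\<S>_case_nat: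
  assumes "f \<in> borel_measurable \<S>"
  shows "(\<integral>\<^sup>+y. f y \<partial>\<S>) = (\<integral>\<^sup>+g. \<integral>\<^sup>+y. f (case_nat g y) \<partial>\<S> \<partial>\<mu>)"
proof -
  interpret seq: sequence_space \<mu> by (rule sequence_space)
  have m: "(\<lambda>(s, \<omega>). case_nat s \<omega>) \<in> measurable (\<mu> \<Otimes>\<^sub>M \<S>) \<S>"
    by (simp add: split_beta')
  have "(\<integral>\<^sup>+y. f y \<partial>\<S>) = (\<integral>\<^sup>+y. f y \<partial>distr (\<mu> \<Otimes>\<^sub>M \<S>) \<S> (\<lambda>(s, \<omega>). case_nat s \<omega>))"
    by (simp add: seq.PiM_iter)
  also have "\<dots> = (\<integral>\<^sup>+p. f ((\<lambda>(s, \<omega>). case_nat s \<omega>) p) \<partial>(\<mu> \<Otimes>\<^sub>M \<S>))"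
    by (rule nn_integral_distr[OF m]) (simp add: assms)
  also have "\<dots> = (\<integral>\<^sup>+p. f (case_nat (fst p) (snd p)) \<partial>(\<mu> \<Otimes>\<^sub>M \<S>))"
    by (simp add: split_beta')
  also have "\<dots> = (\<integral>\<^sup>+g. \<integral>\<^sup>+y. f (case_nat (fst (g, y)) (snd (g, y))) \<partial>\<S> \<partial>\<mu>)"
    using measurable_compose[OF m assms]
    by (intro sigma_finite_measure.nn_integral_fst[OF prob_space_imp_sigma_finite[OF prob_space_\<S>], symmetric]) (simp add: split_beta')
  finally show ?thesis by simp
qed

end

section \<open>Symmetric walks on an orbit\<close>

text \<open>A symmetric walk on \<open>G\<close> acting on a countable set \<open>X\<close>; the base point \<open>a\<close> carries the pole
  of the Green function.\<close>

locale group_action_walk = group_random_walk G \<mu> for G (structure) and \<mu> :: "'a measure" +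
  fixes X :: "'x set" and act :: "'a \<Rightarrow> 'x \<Rightarrow> 'x" (infixr "\<bullet>" 75) and a :: 'x
  assumes symmetric: "symmetric_measure G \<mu>"
    and countable_X: "countable X"
    and a_X: "a \<in> X"
    and act_closed: "g \<in> carrier G \<Longrightarrow> x \<in> X \<Longrightarrow> g \<bullet> x \<in> X"
    and act_one: "x \<in> X \<Longrightarrow> \<one> \<bullet> x = x"
    and act_mult: "g \<in> carrier G \<Longrightarrow> h \<in> carrier G \<Longrightarrow> x \<in> X \<Longrightarrow> (g \<otimes> h) \<bullet> x = g \<bullet> h \<bullet> x"
begin

definition markov_op :: "('x \<Rightarrow> ennreal) \<Rightarrow> 'x \<Rightarrow> ennreal" where
  "markov_op f x = (\<integral>\<^sup>+g. f (g \<bullet> x) \<partial>\<mu>)"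

lemma act_bij: "g \<in> carrier G \<Longrightarrow> bij_betw (act g) X X"
  by (rule bij_betw_byWitness[where f'="act (inv g)"])
    (auto simp: act_closed act_one act_mult[symmetric])

text \<open>Symmetry of the measure of single elements extends to all sets, since the group is
  countable.\<close>

lemma distr_inv: "distr \<mu> \<mu> (\<lambda>g. inv g) = \<mu>"
proof -
  have m: "(\<lambda>g. inv g) \<in> measurable \<mu> \<mu>"
    unfolding measurable_def by (auto simp: space_increment sets_increment)
  show ?thesis
  proof (rule measure_eqI_countable[of _ "carrier G"])
    show "sets (distr \<mu> \<mu> (\<lambda>g. inv g)) = Pow (carrier G)" "sets \<mu> = Pow (carrier G)" "countable (carrier G)"
      by (simp_all add: sets_increment countable_carrier)
    fix g assume g: "g \<in> carrier G"
    have "(\<lambda>g. inv g) -` {g} \<inter> space \<mu> = {inv g}" using g by (auto simp: space_increment)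
    then have "emeasure (distr \<mu> \<mu> (\<lambda>g. inv g)) {g} = emeasure \<mu> {inv g}"
      using g by (subst emeasure_distr[OF m]) (auto simp: sets_increment)
    moreover have "measure \<mu> {g} = measure \<mu> {inv g}"
      using symmetric g unfolding symmetric_measure_def by (rule bspec)
    ultimately show "emeasure (distr \<mu> \<mu> (\<lambda>g. inv g)) {g} = emeasure \<mu> {g}"
      unfolding emeasure_eq_measure by (simp only:)
  qed
qed

lemma nn_integral_inv: "(\<integral>\<^sup>+g. f (inv g) \<partial>\<mu>) = (\<integral>\<^sup>+g. f g \<partial>\<mu>)"
proof -
  have m: "(\<lambda>g. inv g) \<in> measurable \<mu> \<mu>"
    unfolding measurable_def by (auto simp: space_increment sets_increment)
  have "(\<integral>\<^sup>+g. f g \<partial>\<mu>) = (\<integral>\<^sup>+g. f g \<partial>distr \<mu> \<mu> (\<lambda>g. inv g))" by (simp add: distr_inv)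
  also have "\<dots> = (\<integral>\<^sup>+g. f (inv g) \<partial>\<mu>)" by (rule nn_integral_distr[OF m]) simp
  finally show ?thesis by simp
qed

lemma nn_integral_X_swap:
  "(\<integral>\<^sup>+g. \<integral>\<^sup>+x. f x g \<partial>count_space X \<partial>\<mu>) = (\<integral>\<^sup>+x. \<integral>\<^sup>+g. f x g \<partial>\<mu> \<partial>count_space X)"
  using countable_X by (rule nn_integral_count_space_nn_integral) simp

text \<open>Each group element permutes \<open>X\<close>, so its adjoint is its inverse, and the measure is
  symmetric.\<close>

lemma markov_op_self_adjoint:
  "(\<integral>\<^sup>+x. markov_op f x * h x \<partial>count_space X) = (\<integral>\<^sup>+x. f x * markov_op h x \<partial>count_space X)"
proof -
  have "(\<integral>\<^sup>+x. markov_op f x * h x \<partial>count_space X) = (\<integral>\<^sup>+x. \<integral>\<^sup>+g. f (g \<bullet> x) * h x \<partial>\<mu> \<partial>count_space X)"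
    by (simp add: markov_op_def nn_integral_multc)
  also have "\<dots> = (\<integral>\<^sup>+g. \<integral>\<^sup>+x. f (g \<bullet> x) * h x \<partial>count_space X \<partial>\<mu>)"
    by (rule nn_integral_X_swap[symmetric])
  also have "\<dots> = (\<integral>\<^sup>+g. \<integral>\<^sup>+x. f x * h (inv g \<bullet> x) \<partial>count_space X \<partial>\<mu>)"
  proof (rule nn_integral_cong)
    fix g assume "g \<in> space \<mu>"
    then have g: "g \<in> carrier G" by (simp add: space_increment)
    have "(\<integral>\<^sup>+x. f x * h (inv g \<bullet> x) \<partial>count_space X) = (\<integral>\<^sup>+x. f (g \<bullet> x) * h (inv g \<bullet> g \<bullet> x) \<partial>count_space X)"
      by (rule nn_integral_bij_count_space[OF act_bij[OF g], symmetric])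
    also have "\<dots> = (\<integral>\<^sup>+x. f (g \<bullet> x) * h x \<partial>count_space X)"
      using g by (intro nn_integral_cong) (simp add: act_mult[symmetric] act_one)
    finally show "(\<integral>\<^sup>+x. f (g \<bullet> x) * h x \<partial>count_space X) = (\<integral>\<^sup>+x. f x * h (inv g \<bullet> x) \<partial>count_space X)" ..
  qed
  also have "\<dots> = (\<integral>\<^sup>+g. \<integral>\<^sup>+x. f x * h (g \<bullet> x) \<partial>count_space X \<partial>\<mu>)"
    by (rule nn_integral_inv[of "\<lambda>g. \<integral>\<^sup>+x. f x * h (g \<bullet> x) \<partial>count_space X"])
  also have "\<dots> = (\<integral>\<^sup>+x. \<integral>\<^sup>+g. f x * h (g \<bullet> x) \<partial>\<mu> \<partial>count_space X)"
    by (rule nn_integral_X_swap)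
  also have "\<dots> = (\<integral>\<^sup>+x. f x * markov_op h x \<partial>count_space X)"
    by (simp add: markov_op_def nn_integral_cmult)
  finally show ?thesis .
qed

lemma markov_op_power_self_adjoint:
  "(\<integral>\<^sup>+x. (markov_op ^^ n) f x * h x \<partial>count_space X) = (\<integral>\<^sup>+x. f x * (markov_op ^^ n) h x \<partial>count_space X)"
proof (induction n arbitrary: h)
  case (Suc n)
  have "(\<integral>\<^sup>+x. (markov_op ^^ Suc n) f x * h x \<partial>count_space X) = (\<integral>\<^sup>+x. (markov_op ^^ n) f x * markov_op h x \<partial>count_space X)"
    by (simp add: markov_op_self_adjoint)
  also have "\<dots> = (\<integral>\<^sup>+x. f x * (markov_op ^^ n) (markov_op h) x \<partial>count_space X)"
    by (rule Suc)
  also have "\<dots> = (\<integral>\<^sup>+x. f x * (markov_op ^^ Suc n) h x \<partial>count_space X)"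
    by (simp only: funpow_Suc_right comp_apply)
  finally show ?case .
qed simp

lemma nn_integral_walk:
  assumes "x \<in> X"
  shows "(\<integral>\<^sup>+y. F (y n) (walk G y n \<bullet> x) \<partial>\<S>) = (markov_op ^^ n) (\<lambda>x. \<integral>\<^sup>+g. F g x \<partial>\<mu>) x"
  using assms
proof (induction n arbitrary: x)
  have m: "(\<lambda>y. F (y n) (walk G y n \<bullet> x)) \<in> borel_measurable \<S>" for n x
    by (rule measurable_pair_count_space[OF measurable_component_\<S> measurable_walk_n, where F="\<lambda>g h. F g (h \<bullet> x)"]) simp
  interpret S: prob_space \<S> by (rule prob_space_\<S>)
  {
    case (0 x)
    then show ?case
      using nn_integral_\<S>_case_nat[OF m[of 0 x]] by (simp add: act_one S.emeasure_space_1)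
  next
    case (Suc n x)
    have "(\<integral>\<^sup>+y. F (y (Suc n)) (walk G y (Suc n) \<bullet> x) \<partial>\<S>)
        = (\<integral>\<^sup>+g. \<integral>\<^sup>+y. F (case_nat g y (Suc n)) (walk G (case_nat g y) (Suc n) \<bullet> x) \<partial>\<S> \<partial>\<mu>)"
      by (rule nn_integral_\<S>_case_nat[OF m])
    also have "\<dots> = (\<integral>\<^sup>+g. \<integral>\<^sup>+y. F (y n) (walk G y n \<bullet> (g \<bullet> x)) \<partial>\<S> \<partial>\<mu>)"
    proof (intro nn_integral_cong)
      fix g y assume "g \<in> space \<mu>" "y \<in> space \<S>"
      then have gy: "g \<in> carrier G" "\<And>n. y n \<in> carrier G" by (simp_all add: space_increment space_\<S>)
      show "F (case_nat g y (Suc n)) (walk G (case_nat g y) (Suc n) \<bullet> x) = F (y n) (walk G y n \<bullet> (g \<bullet> x))"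
        unfolding walk_case_nat[OF gy] using gy Suc.prems by (simp add: act_mult walk_closed)
    qed
    also have "\<dots> = (\<integral>\<^sup>+g. (markov_op ^^ n) (\<lambda>x. \<integral>\<^sup>+g. F g x \<partial>\<mu>) (g \<bullet> x) \<partial>\<mu>)"
      using Suc by (intro nn_integral_cong) (simp add: act_closed space_increment)
    also have "\<dots> = (markov_op ^^ Suc n) (\<lambda>x. \<integral>\<^sup>+g. F g x \<partial>\<mu>) x"
      by (simp add: markov_op_def)
    finally show ?case .
  }
qed

text \<open>The expected number of visits to \<open>a\<close>, before time \<open>N\<close>, of the walk that starts at \<open>x\<close>.\<close>

definition green :: "nat \<Rightarrow> 'x \<Rightarrow> ennreal" where
  "green N x = (\<Sum>n<N. (markov_op ^^ n) (indicator {a}) x)"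

lemma markov_op_sum: "markov_op (\<lambda>x. \<Sum>i\<in>I. f i x) x = (\<Sum>i\<in>I. markov_op (f i) x)"
  unfolding markov_op_def by (rule nn_integral_sum) simp

lemma green_Suc: "green (Suc N) x = indicator {a} x + markov_op (green N) x"
proof -
  have "markov_op (green N) x = (\<Sum>n<N. (markov_op ^^ Suc n) (indicator {a}) x)"
    unfolding green_def[abs_def] markov_op_sum by simp
  then show ?thesis
    unfolding green_def sum.lessThan_Suc_shift by simp
qed

text \<open>Away from \<open>a\<close> the Green function is an average of the Green function with one step less.\<close>

lemma green_max_principle:
  assumes "\<And>N. green N a \<le> K" "x \<in> X"
  shows "green N x \<le> K"
  using assms(2)
proof (induction N arbitrary: x)
  case (Suc N)
  show ?case
  proof (cases "x = a")
    case False
    have "markov_op (green N) x \<le> (\<integral>\<^sup>+g. K \<partial>\<mu>)"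
      unfolding markov_op_def using Suc act_closed by (intro nn_integral_mono) (simp add: space_increment)
    then show ?thesis using False by (simp add: green_Suc emeasure_space_1)
  qed (use assms in simp)
qed (simp add: green_def)

lemma nn_integral_at_point: "(\<integral>\<^sup>+x. indicator {a} x * f x \<partial>count_space X) = (f a :: ennreal)"
proof -
  have "(\<integral>\<^sup>+x. indicator {a} x * f x \<partial>count_space X) = (\<integral>\<^sup>+x. f a * indicator {a} x \<partial>count_space X)"
    by (intro nn_integral_cong) (simp split: split_indicator)
  also have "\<dots> = f a" using a_X by (subst nn_integral_cmult_indicator) auto
  finally show ?thesis .
qed

text \<open>By self-adjointness the sum on the left is the integral of \<open>x \<mapsto> \<integral> F g x d\<mu>(g)\<close> against the
  Green function, which is nowhere larger than at its pole.\<close>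

lemma sum_walk_visits_le:
  assumes K: "\<And>N. green N a \<le> K"
  shows "(\<Sum>n<N. \<integral>\<^sup>+y. F (y n) (walk G y n \<bullet> a) \<partial>\<S>) \<le> K * (\<integral>\<^sup>+g. \<integral>\<^sup>+x. F g x \<partial>count_space X \<partial>\<mu>)"
proof -
  define w where "w = (\<lambda>x. \<integral>\<^sup>+g. F g x \<partial>\<mu>)"
  have at_a: "(\<integral>\<^sup>+x. f x * indicator {a} x \<partial>count_space X) = f a" for f :: "'x \<Rightarrow> ennreal"
    using nn_integral_at_point[of f] by (simp only: mult.commute)
  have "(\<Sum>n<N. \<integral>\<^sup>+y. F (y n) (walk G y n \<bullet> a) \<partial>\<S>) = (\<Sum>n<N. (markov_op ^^ n) w a)"
    using nn_integral_walk[OF a_X] by (simp add: w_def)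
  also have "\<dots> = (\<Sum>n<N. \<integral>\<^sup>+x. w x * (markov_op ^^ n) (indicator {a}) x \<partial>count_space X)"
    by (rule sum.cong) (simp_all add: at_a[symmetric] markov_op_power_self_adjoint)
  also have "\<dots> = (\<integral>\<^sup>+x. w x * green N x \<partial>count_space X)"
    by (simp add: green_def sum_distrib_left nn_integral_sum)
  also have "\<dots> \<le> (\<integral>\<^sup>+x. w x * K \<partial>count_space X)"
    using green_max_principle[OF K] by (intro nn_integral_mono mult_left_mono) auto
  also have "\<dots> = K * (\<integral>\<^sup>+x. w x \<partial>count_space X)"
    by (subst nn_integral_multc) (simp_all add: mult.commute)
  also have "(\<integral>\<^sup>+x. w x \<partial>count_space X) = (\<integral>\<^sup>+g. \<integral>\<^sup>+x. F g x \<partial>count_space X \<partial>\<mu>)"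
    unfolding w_def by (rule nn_integral_X_swap[symmetric])
  finally show ?thesis .
qed

text \<open>The expected number of bad steps is finite, so the Borel-Cantelli lemma applies.\<close>

lemma AE_eventually_no_bad_step:
  assumes K: "\<And>N. green N a \<le> K" "K < \<infinity>"
    and bad: "(\<integral>\<^sup>+g. \<integral>\<^sup>+x. indicator (Bad g) x \<partial>count_space X \<partial>\<mu>) < \<infinity>"
  shows "AE y in \<S>. eventually (\<lambda>n. walk G y n \<bullet> a \<notin> Bad (y n)) sequentially"
proof -
  interpret S: prob_space \<S> by (rule prob_space_\<S>)
  define A where "A n = {y \<in> space \<S>. walk G y n \<bullet> a \<in> Bad (y n)}" for n
  have m: "(\<lambda>y. walk G y n \<bullet> a \<in> Bad (y n)) \<in> measurable \<S> (count_space UNIV)" for n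
    by (rule measurable_pair_count_space[OF measurable_component_\<S> measurable_walk_n, where F="\<lambda>g h. h \<bullet> a \<in> Bad g"]) simp
  have Am: "A n \<in> sets \<S>" for n
    unfolding A_def using m[of n] by (rule predE)
  have em: "emeasure \<S> (A n) = (\<integral>\<^sup>+y. indicator (Bad (y n)) (walk G y n \<bullet> a) \<partial>\<S>)" for n
  proof -
    have "emeasure \<S> (A n) = (\<integral>\<^sup>+y. indicator (A n) y \<partial>\<S>)" using Am by simp
    also have "\<dots> = (\<integral>\<^sup>+y. indicator (Bad (y n)) (walk G y n \<bullet> a) \<partial>\<S>)"
      by (intro nn_integral_cong) (simp add: A_def split: split_indicator)
    finally show ?thesis .
  qed
  define C where "C = K * (\<integral>\<^sup>+g. \<integral>\<^sup>+x. indicator (Bad g) x \<partial>count_space X \<partial>\<mu>)"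
  have C: "C < \<infinity>" unfolding C_def using K(2) bad by (simp add: ennreal_mult_less_top)
  have sum_le: "(\<Sum>n<N. measure \<S> (A n)) \<le> enn2real C" for N
  proof -
    have "ennreal (\<Sum>n<N. measure \<S> (A n)) = (\<Sum>n<N. emeasure \<S> (A n))"
      by (simp add: S.emeasure_eq_measure sum_ennreal)
    also have "\<dots> \<le> C" unfolding em C_def by (rule sum_walk_visits_le[OF K(1)])
    also have "\<dots> = ennreal (enn2real C)" using C by simp
    finally show ?thesis by (subst (asm) ennreal_le_iff) auto
  qed
  have "AE y in \<S>. eventually (\<lambda>n. y \<in> space \<S> - A n) sequentially"
  proof (rule borel_cantelli_AE1[OF Am])
    show "summable (\<lambda>n. measure \<S> (A n))"
      by (rule summableI_nonneg_bounded[OF measure_nonneg sum_le])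
  qed (simp add: S.emeasure_eq_measure)
  then show ?thesis
    by eventually_elim (auto elim!: eventually_mono simp: A_def)
qed

lemma markov_op_power_one: "(markov_op ^^ n) (\<lambda>_. 1) x = 1"
  by (induction n arbitrary: x) (simp_all add: markov_op_def emeasure_space_1)

section \<open>The Dirichlet energy of the Green function\<close>

lemma green_le_of_nat: "green N x \<le> of_nat N"
proof -
  have "(markov_op ^^ n) (indicator {a}) x \<le> 1" for n x
  proof (induction n arbitrary: x)
    case (Suc n)
    have "(\<integral>\<^sup>+g. (markov_op ^^ n) (indicator {a}) (g \<bullet> x) \<partial>\<mu>) \<le> (\<integral>\<^sup>+g. 1 \<partial>\<mu>)"
      by (intro nn_integral_mono Suc)
    then show ?case by (simp add: markov_op_def[of "(markov_op ^^ n) (indicator {a})"] emeasure_space_1)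
  qed (simp add: indicator_def)
  then have "green N x \<le> (\<Sum>n<N. 1)" unfolding green_def by (intro sum_mono)
  then show ?thesis by simp
qed

lemma nn_integral_green: "(\<integral>\<^sup>+x. green N x \<partial>count_space X) = of_nat N"
proof -
  have "(\<integral>\<^sup>+x. (markov_op ^^ n) (indicator {a}) x \<partial>count_space X) = 1" for n
    using markov_op_power_self_adjoint[of n "indicator {a}" "\<lambda>_. 1"] nn_integral_at_point[of "\<lambda>_. 1"]
    by (simp add: markov_op_power_one)
  then show ?thesis unfolding green_def by (simp add: nn_integral_sum)
qed

lemma green_mono: "green N x \<le> green (Suc N) x"
  unfolding green_def by simp

text \<open>The Green function is finite; as a real function it can be subtracted.\<close>

definition green_real :: "nat \<Rightarrow> 'x \<Rightarrow> real" where
  "green_real N x = enn2real (green N x)"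

lemma ennreal_green_real: "ennreal (green_real N x) = green N x"
proof -
  have "green N x < \<infinity>" using green_le_of_nat[of N x] by (rule le_less_trans) (simp add: of_nat_less_top)
  then show ?thesis unfolding green_real_def by simp
qed

lemma green_real_nonneg: "green_real N x \<ge> 0"
  by (simp add: green_real_def)

definition energy :: "nat \<Rightarrow> ennreal" where
  "energy N = (\<integral>\<^sup>+g. \<integral>\<^sup>+x. ennreal ((green_real N (g \<bullet> x) - green_real N x)\<^sup>2) \<partial>count_space X \<partial>\<mu>)"

lemma ennreal_square_diff:
  fixes s t :: real assumes "s \<ge> 0" "t \<ge> 0"
  shows "ennreal ((s - t)\<^sup>2) + 2 * (ennreal s * ennreal t) = ennreal s * ennreal s + ennreal t * ennreal t"
proof -
  have "ennreal ((s - t)\<^sup>2) + 2 * (ennreal s * ennreal t) = ennreal ((s - t)\<^sup>2) + ennreal (2 * (s * t))"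
    using assms by (simp add: ennreal_mult)
  also have "\<dots> = ennreal ((s - t)\<^sup>2 + 2 * (s * t))" using assms by (intro ennreal_plus[symmetric]) auto
  also have "(s - t)\<^sup>2 + 2 * (s * t) = s * s + t * t" by (simp add: power2_eq_square algebra_simps)
  also have "ennreal (s * s + t * t) = ennreal s * ennreal s + ennreal t * ennreal t"
    using assms by (simp add: ennreal_mult ennreal_plus)
  finally show ?thesis .
qed

text \<open>Expanding the square, the energy is \<open>2 \<langle>U, U\<rangle> - 2 \<langle>P U, U\<rangle>\<close> with \<open>P\<close> the Markov operator,
  and \<open>U \<le> indicator {a} + P U\<close> bounds the first inner product by \<open>U(a) + \<langle>P U, U\<rangle>\<close>.\<close>

lemma energy_le: "energy N \<le> 2 * green N a"
proof -
  \<comment> \<open>The inner products \<open>\<langle>P U, U\<rangle>\<close> and \<open>\<langle>U, U\<rangle>\<close>.\<close>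
  define Q where "Q = (\<integral>\<^sup>+x. markov_op (green N) x * green N x \<partial>count_space X)"
  define R where "R = (\<integral>\<^sup>+x. green N x * green N x \<partial>count_space X)"
  have shift: "(\<integral>\<^sup>+x. ennreal ((green_real N (g \<bullet> x) - green_real N x)\<^sup>2) \<partial>count_space X)
      + 2 * (\<integral>\<^sup>+x. green N (g \<bullet> x) * green N x \<partial>count_space X) = 2 * R" if g: "g \<in> carrier G" for g
  proof -
    have "(\<integral>\<^sup>+x. ennreal ((green_real N (g \<bullet> x) - green_real N x)\<^sup>2) \<partial>count_space X)
      + 2 * (\<integral>\<^sup>+x. green N (g \<bullet> x) * green N x \<partial>count_space X)
      = (\<integral>\<^sup>+x. ennreal ((green_real N (g \<bullet> x) - green_real N x)\<^sup>2) + 2 * (green N (g \<bullet> x) * green N x) \<partial>count_space X)"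
      by (simp add: nn_integral_add nn_integral_cmult)
    also have "\<dots> = (\<integral>\<^sup>+x. green N (g \<bullet> x) * green N (g \<bullet> x) + green N x * green N x \<partial>count_space X)"
      using ennreal_square_diff[OF green_real_nonneg green_real_nonneg]
      unfolding ennreal_green_real by (intro nn_integral_cong)
    also have "\<dots> = (\<integral>\<^sup>+x. green N (g \<bullet> x) * green N (g \<bullet> x) \<partial>count_space X) + R"
      unfolding R_def by (rule nn_integral_add) simp_all
    also have "(\<integral>\<^sup>+x. green N (g \<bullet> x) * green N (g \<bullet> x) \<partial>count_space X) = R"
      unfolding R_def by (rule nn_integral_bij_count_space[OF act_bij[OF g]])
    finally show ?thesis by (simp add: mult_2)
  qed
  have "(\<integral>\<^sup>+g. \<integral>\<^sup>+x. green N (g \<bullet> x) * green N x \<partial>count_space X \<partial>\<mu>) = Q"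
    unfolding Q_def markov_op_def nn_integral_X_swap by (intro nn_integral_cong nn_integral_multc) simp
  then have "energy N + 2 * Q = (\<integral>\<^sup>+g. (\<integral>\<^sup>+x. ennreal ((green_real N (g \<bullet> x) - green_real N x)\<^sup>2) \<partial>count_space X)
      + 2 * (\<integral>\<^sup>+x. green N (g \<bullet> x) * green N x \<partial>count_space X) \<partial>\<mu>)"
    by (simp add: energy_def nn_integral_add nn_integral_cmult)
  also have "\<dots> = (\<integral>\<^sup>+g. 2 * R \<partial>\<mu>)"
    by (intro nn_integral_cong shift) (simp add: space_increment)
  also have "\<dots> = 2 * R" by (simp add: emeasure_space_1)
  finally have eq: "energy N + 2 * Q = 2 * R" .
  have "R \<le> (\<integral>\<^sup>+x. indicator {a} x * green N x + markov_op (green N) x * green N x \<partial>count_space X)"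
    unfolding R_def using green_mono[of N] unfolding green_Suc distrib_right[symmetric]
    by (intro nn_integral_mono mult_right_mono) simp_all
  also have "\<dots> = green N a + Q"
    unfolding Q_def by (subst nn_integral_add) (simp_all add: nn_integral_at_point)
  finally have "2 * R \<le> 2 * (green N a + Q)" by (rule mult_left_mono) simp
  then have le: "energy N + 2 * Q \<le> 2 * green N a + 2 * Q" unfolding eq distrib_left .
  \<comment> \<open>Finiteness of \<open>Q\<close> allows to cancel it.\<close>
  have "Q \<le> (\<integral>\<^sup>+x. of_nat N * green N x \<partial>count_space X)"
  proof -
    have "markov_op (green N) x \<le> (\<integral>\<^sup>+g. of_nat N \<partial>\<mu>)" for x
      unfolding markov_op_def by (intro nn_integral_mono green_le_of_nat)
    then show ?thesis unfolding Q_def by (intro nn_integral_mono mult_right_mono) (simp_all add: emeasure_space_1)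
  qed
  also have "\<dots> = of_nat N * of_nat N" by (simp add: nn_integral_cmult nn_integral_green)
  also have "\<dots> < \<infinity>" by (simp add: ennreal_mult_less_top of_nat_less_top)
  finally have "2 * Q \<noteq> \<infinity>" by (simp add: ennreal_mult_eq_top_iff)
  with le show ?thesis unfolding add.commute[of _ "2 * Q"] ennreal_add_left_cancel_le by simp
qed

lemma sum_eq_nn_integral_X:
  assumes "finite D" "D \<subseteq> X"
  shows "(\<Sum>x\<in>D. f x) = (\<integral>\<^sup>+x. f x * indicator D x \<partial>count_space X)"
proof -
  have "(\<integral>\<^sup>+x. f x * indicator D x \<partial>count_space X) = (\<Sum>x\<in>D. f x * emeasure (count_space X) {x})"
    using assms by (intro nn_integral_indicator_finite) auto
  also have "\<dots> = (\<Sum>x\<in>D. f x)"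
  proof (rule sum.cong[OF refl])
    fix x assume "x \<in> D"
    then have "emeasure (count_space X) {x} = 1" using assms by (subst emeasure_count_space_finite) auto
    then show "f x * emeasure (count_space X) {x} = f x" by simp
  qed
  finally show ?thesis ..
qed

text \<open>The single element \<open>g\<close> and the points of \<open>D\<close> contribute only a part of the energy.\<close>

lemma sum_square_increment_le:
  assumes g: "g \<in> carrier G" and D: "finite D" "D \<subseteq> X"
  shows "measure \<mu> {g} * (\<Sum>x\<in>D. (green_real N (g \<bullet> x) - green_real N x)\<^sup>2) \<le> 2 * green_real N a"
proof -
  let ?d = "\<lambda>g x. (green_real N (g \<bullet> x) - green_real N x)\<^sup>2"
  have "ennreal (measure \<mu> {g} * (\<Sum>x\<in>D. ?d g x)) = (\<Sum>x\<in>D. ennreal (?d g x)) * emeasure \<mu> {g}"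
    by (simp add: emeasure_eq_measure ennreal_mult sum_nonneg mult.commute)
  also have "(\<Sum>x\<in>D. ennreal (?d g x)) = (\<integral>\<^sup>+x. ennreal (?d g x) * indicator D x \<partial>count_space X)"
    by (rule sum_eq_nn_integral_X[OF D])
  also have "\<dots> * emeasure \<mu> {g} \<le> (\<integral>\<^sup>+x. ennreal (?d g x) \<partial>count_space X) * emeasure \<mu> {g}"
    by (intro nn_integral_mono mult_right_mono) (simp_all split: split_indicator)
  also have "(\<integral>\<^sup>+x. ennreal (?d g x) \<partial>count_space X) * emeasure \<mu> {g}
      = (\<integral>\<^sup>+h. (\<integral>\<^sup>+x. ennreal (?d g x) \<partial>count_space X) * indicator {g} h \<partial>\<mu>)"
    using g by (intro nn_integral_cmult_indicator[symmetric]) (simp add: sets_increment)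
  also have "\<dots> \<le> energy N"
    unfolding energy_def by (intro nn_integral_mono) (simp split: split_indicator)
  also have "\<dots> \<le> 2 * green N a" by (rule energy_le)
  also have "\<dots> = ennreal (2 * green_real N a)"
    by (simp add: ennreal_mult green_real_nonneg ennreal_green_real)
  finally show ?thesis by (subst (asm) ennreal_le_iff) (simp_all add: green_real_nonneg)
qed

text \<open>The Cauchy-Schwarz inequality on the finite set \<open>D\<close>.\<close>

lemma abs_sum_increment_le:
  assumes g: "g \<in> carrier G" and D: "finite D" "D \<subseteq> X" and m: "0 < m" "m \<le> measure \<mu> {g}"
  shows "\<bar>(\<Sum>x\<in>D. green_real N (g \<bullet> x)) - (\<Sum>x\<in>D. green_real N x)\<bar> \<le> sqrt (2 * green_real N a) * sqrt (card D / m)"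
proof -
  let ?S = "\<Sum>x\<in>D. (green_real N (g \<bullet> x) - green_real N x)\<^sup>2"
  have "m * ?S \<le> measure \<mu> {g} * ?S" using m by (intro mult_right_mono) (auto intro: sum_nonneg)
  also have "\<dots> \<le> 2 * green_real N a" by (rule sum_square_increment_le[OF g D])
  finally have S: "?S \<le> 2 * green_real N a / m" using m by (simp add: field_simps)
  have "((\<Sum>x\<in>D. green_real N (g \<bullet> x)) - (\<Sum>x\<in>D. green_real N x))\<^sup>2 = (\<Sum>x\<in>D. green_real N (g \<bullet> x) - green_real N x)\<^sup>2"
    by (simp add: sum_subtractf)
  also have "\<dots> \<le> ?S * card D" by (rule sum_squared_le_sum_of_squares)
  also have "\<dots> \<le> 2 * green_real N a / m * card D" using S by (intro mult_right_mono) auto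
  also have "\<dots> = (2 * green_real N a) * (card D / m)" by simp
  finally have "sqrt (((\<Sum>x\<in>D. green_real N (g \<bullet> x)) - (\<Sum>x\<in>D. green_real N x))\<^sup>2) \<le> sqrt ((2 * green_real N a) * (card D / m))"
    by (rule real_sqrt_le_mono)
  then show ?thesis
    unfolding real_sqrt_abs real_sqrt_mult[of "2 * green_real N a" "card D / m"] .
qed

text \<open>A unit mass at \<open>a\<close> is spread evenly over \<open>2 ^ n\<close> points, by moves whose cost in terms of
  the energy is summable. In the limit the average of the Green function over these points
  vanishes, so its value at \<open>a\<close> is bounded by the total cost times the square root of the
  energy.\<close>

lemma green_bounded:
  assumes D0: "D 0 = {a}" and D_Suc: "\<And>n. D (Suc n) = act (p n) ` D n \<union> act (q n) ` D n"
    and card_D: "\<And>n. card (D n) = 2 ^ n"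
    and pq: "\<And>n. p n \<in> carrier G" "\<And>n. q n \<in> carrier G"
    and m: "\<And>n. 0 < m n" "\<And>n. m n \<le> measure \<mu> {p n}" "\<And>n. m n \<le> measure \<mu> {q n}"
    and sm: "summable (\<lambda>n. sqrt (1 / (2 ^ n * m n)))"
  shows "\<exists>K<\<infinity>. \<forall>N. green N a \<le> K"
proof -
  define c where "c = (\<Sum>n. sqrt (1 / (2 ^ n * m n)))"
  have fin: "finite (D n)" for n using card_D[of n] card_ge_0_finite[of "D n"] by simp
  have DX: "D n \<subseteq> X" for n by (induction n) (use D0 D_Suc a_X act_closed pq in auto)
  have bound: "green_real N a \<le> 2 * c\<^sup>2" for N
  proof -
    let ?U = "green_real N"
    define A where "A n = (\<Sum>x\<in>D n. ?U x) / 2 ^ n" for n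
    have step: "\<bar>A (Suc n) - A n\<bar> \<le> sqrt (2 * ?U a) * sqrt (1 / (2 ^ n * m n))" for n
    proof -
      let ?P = "act (p n) ` D n" and ?Q = "act (q n) ` D n"
      \<comment> \<open>The size of the next level forces both maps to be injective, with disjoint images.\<close>
      have "card ?P \<le> 2 ^ n" "card ?Q \<le> 2 ^ n" using card_image_le[OF fin[of n]] card_D[of n] by metis+
      moreover have "card ?P + card ?Q = 2 * 2 ^ n + card (?P \<inter> ?Q)"
        using card_Un_Int[of ?P ?Q] fin card_D[of "Suc n"] D_Suc[of n] by simp
      ultimately have c: "card ?P = 2 ^ n" "card ?Q = 2 ^ n" "card (?P \<inter> ?Q) = 0" by linarith+
      then have dis: "?P \<inter> ?Q = {}" using fin by simp
      have inj: "inj_on (act (p n)) (D n)" "inj_on (act (q n)) (D n)"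
        using c fin card_D by (simp_all add: eq_card_imp_inj_on)
      have "(\<Sum>x\<in>D (Suc n). ?U x) = (\<Sum>x\<in>D n. ?U (p n \<bullet> x)) + (\<Sum>x\<in>D n. ?U (q n \<bullet> x))"
        unfolding D_Suc using fin dis by (subst sum.union_disjoint) (simp_all add: sum.reindex inj)
      then have "A (Suc n) - A n = (((\<Sum>x\<in>D n. ?U (p n \<bullet> x)) - (\<Sum>x\<in>D n. ?U x))
          + ((\<Sum>x\<in>D n. ?U (q n \<bullet> x)) - (\<Sum>x\<in>D n. ?U x))) / (2 * 2 ^ n)" (is "_ = (?dp + ?dq) / _")
        unfolding A_def by (simp add: field_simps)
      then have "\<bar>A (Suc n) - A n\<bar> = \<bar>?dp + ?dq\<bar> / (2 * 2 ^ n)" by simp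
      also have "\<dots> \<le> (2 * (sqrt (2 * ?U a) * sqrt (card (D n) / m n))) / (2 * 2 ^ n)"
      proof (rule divide_right_mono)
        have "\<bar>?dp\<bar> \<le> sqrt (2 * ?U a) * sqrt (card (D n) / m n)"
          by (rule abs_sum_increment_le[OF pq(1) fin DX m(1,2)])
        moreover have "\<bar>?dq\<bar> \<le> sqrt (2 * ?U a) * sqrt (card (D n) / m n)"
          by (rule abs_sum_increment_le[OF pq(2) fin DX m(1,3)])
        ultimately show "\<bar>?dp + ?dq\<bar> \<le> 2 * (sqrt (2 * ?U a) * sqrt (card (D n) / m n))" by linarith
      qed simp
      also have "\<dots> = sqrt (2 * ?U a) * (sqrt (2 ^ n / m n) / 2 ^ n)" by (simp add: card_D)
      also have "sqrt (2 ^ n / m n) / 2 ^ n = sqrt (2 ^ n / m n) / sqrt ((2 ^ n)\<^sup>2)" by simp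
      also have "\<dots> = sqrt (1 / (2 ^ n * m n))"
        unfolding real_sqrt_divide[symmetric] using m(1)[of n] by (simp add: power2_eq_square field_simps)
      finally show ?thesis .
    qed
    have A_ge: "?U a \<le> A n + sqrt (2 * ?U a) * (\<Sum>i<n. sqrt (1 / (2 ^ i * m i)))" for n
    proof (induction n)
      case 0
      then show ?case by (simp add: A_def D0)
    next
      case (Suc n)
      then show ?case using step[of n] by (simp add: distrib_left)
    qed
    have part: "(\<Sum>i<n. sqrt (1 / (2 ^ i * m i))) \<le> c" for n
      unfolding c_def using m(1) by (intro sum_le_suminf sm) (auto intro: less_imp_le)
    \<comment> \<open>The total mass \<open>N\<close> is spread over \<open>2 ^ n\<close> points.\<close>
    have A_le: "A n \<le> real N / 2 ^ n" for n
    proof -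
      have "ennreal (\<Sum>x\<in>D n. ?U x) = (\<Sum>x\<in>D n. green N x)"
        by (simp add: sum_ennreal[symmetric] green_real_nonneg ennreal_green_real)
      also have "\<dots> = (\<integral>\<^sup>+x. green N x * indicator (D n) x \<partial>count_space X)"
        by (rule sum_eq_nn_integral_X[OF fin DX])
      also have "\<dots> \<le> (\<integral>\<^sup>+x. green N x \<partial>count_space X)"
        by (intro nn_integral_mono) (simp split: split_indicator)
      also have "\<dots> = ennreal (real N)" by (simp add: nn_integral_green ennreal_of_nat_eq_real_of_nat)
      finally have "(\<Sum>x\<in>D n. ?U x) \<le> real N" by (subst (asm) ennreal_le_iff) simp_all
      then show ?thesis unfolding A_def by (intro divide_right_mono) simp_all
    qed
    have "?U a \<le> real N / 2 ^ n + sqrt (2 * ?U a) * c" for n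
      using A_ge[of n] A_le[of n] mult_left_mono[OF part[of n], of "sqrt (2 * ?U a)"] green_real_nonneg[of N a] by simp
    moreover have "(\<lambda>n. real N / 2 ^ n + sqrt (2 * ?U a) * c) \<longlonglongrightarrow> 0 + sqrt (2 * ?U a) * c"
      by (intro tendsto_intros LIMSEQ_divide_realpow_zero) simp
    ultimately have le: "?U a \<le> 0 + sqrt (2 * ?U a) * c"
      by (intro LIMSEQ_le_const[where X="\<lambda>n. real N / 2 ^ n + sqrt (2 * ?U a) * c"]) auto
    have "?U a * ?U a \<le> (sqrt (2 * ?U a) * c)\<^sup>2"
      using le green_real_nonneg[of N a] unfolding power2_eq_square by (intro mult_mono) auto
    also have "\<dots> = ?U a * (2 * c\<^sup>2)" using green_real_nonneg[of N a] by (simp add: power_mult_distrib)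
    finally have *: "?U a * ?U a \<le> ?U a * (2 * c\<^sup>2)" .
    show "?U a \<le> 2 * c\<^sup>2"
    proof (cases "?U a = 0")
      case False
      then have "?U a > 0" using green_real_nonneg[of N a] by linarith
      then show ?thesis using * by (simp add: mult_le_cancel_left)
    qed simp
  qed
  have "green N a \<le> ennreal (2 * c\<^sup>2)" for N
    using bound[of N] by (subst ennreal_green_real[symmetric]) (rule ennreal_leI)
  then show ?thesis by (intro exI[of _ "ennreal (2 * c\<^sup>2)"]) simp
qed

section \<open>Boundaries from functions with an almost sure limit\<close>

text \<open>Think of \<open>\<Phi>\<close> as a function on the group which left multiplication changes rarely:
  multiplying \<open>h\<close> by \<open>g\<close> from the left matters only if the point \<open>h \<bullet> a\<close> belongs to the set
  \<open>Bad g\<close>. Then \<open>\<Phi>\<close> converges along almost every trajectory. A first step \<open>k\<close> is a right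
  multiplication, and turns the limit \<open>v\<close> into \<open>\<psi> v\<close>, so the limit is not almost surely
  constant.\<close>

lemma nontrivial_poisson_boundary:
  assumes K: "\<And>N. green N a \<le> K" "K < \<infinity>"
    and bad: "(\<integral>\<^sup>+g. \<integral>\<^sup>+x. indicator (Bad g) x \<partial>count_space X \<partial>\<mu>) < \<infinity>"
    and \<Phi>_bad: "\<And>g h. g \<in> carrier G \<Longrightarrow> h \<in> carrier G \<Longrightarrow> h \<bullet> a \<notin> Bad g \<Longrightarrow> \<Phi> (g \<otimes> h) = \<Phi> h"
    and k: "k \<in> carrier G" "measure \<mu> {k} > 0"
    and \<Phi>_k: "\<And>g. g \<in> carrier G \<Longrightarrow> \<Phi> (g \<otimes> k) = \<psi> (\<Phi> g)"
    and \<psi>: "\<And>g. g \<in> carrier G \<Longrightarrow> \<psi> (\<Phi> g) \<noteq> \<Phi> g"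
  shows "nontrivial_poisson_boundary G \<mu>"
proof -
  interpret S: prob_space \<S> by (rule prob_space_\<S>)
  interpret M: prob_space "markov_measure G \<mu>" by (rule prob_space_markov_measure)
  define T where "T = PiM UNIV (\<lambda>_::nat. count_space (carrier G))"
  have spT: "x \<in> space T \<longleftrightarrow> (\<forall>n. x n \<in> carrier G)" for x
    unfolding T_def by (auto simp: space_PiM PiE_def)
  define E where "E v = {x \<in> space T. eventually (\<lambda>n. \<Phi> (x n) = v) sequentially}" for v
  have E_sets: "E v \<in> sets T" for v
  proof -
    have "{x \<in> space T. \<Phi> (x n) = v} \<in> sets T" for n
    proof -
      have "(\<lambda>x. x n) \<in> measurable T (count_space (carrier G))"
        unfolding T_def by (rule measurable_component_singleton) simp
      from measurable_sets[OF this, of "{h \<in> carrier G. \<Phi> h = v}"]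
      have "(\<lambda>x. x n) -` {h \<in> carrier G. \<Phi> h = v} \<inter> space T \<in> sets T" by simp
      also have "(\<lambda>x. x n) -` {h \<in> carrier G. \<Phi> h = v} \<inter> space T = {x \<in> space T. \<Phi> (x n) = v}"
        using spT by auto
      finally show ?thesis .
    qed
    moreover have "E v = (\<Union>N. \<Inter>n\<in>{N..}. {x \<in> space T. \<Phi> (x n) = v})"
      by (auto simp: E_def eventually_sequentially)
    ultimately show ?thesis
      by (simp only:) (rule sets.countable_UN, rule image_subsetI, rule sets.countable_INT', auto)
  qed
  have walk_m: "walk G \<in> measurable \<S> T" unfolding T_def by (rule measurable_walk)
  define B where "B v = {y \<in> space \<S>. eventually (\<lambda>n. \<Phi> (walk G y n) = v) sequentially}" for v
  have B_eq: "B v = walk G -` E v \<inter> space \<S>" for v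
    using measurable_space[OF walk_m] by (auto simp: B_def E_def)
  have B_sets: "B v \<in> sets \<S>" for v
    unfolding B_eq by (rule measurable_sets[OF walk_m E_sets])
  have measure_E: "measure (markov_measure G \<mu>) (E v) = measure \<S> (B v)" for v
    unfolding markov_measure_def B_eq T_def[symmetric] by (rule measure_distr[OF walk_m E_sets])
  \<comment> \<open>There are countably many values of \<open>\<Phi>\<close>, so one of them is the limit with positive
      probability.\<close>
  have "\<exists>g0\<in>carrier G. measure \<S> (B (\<Phi> g0)) > 0"
  proof (rule ccontr)
    assume "\<not> ?thesis"
    then have zero: "measure \<S> (B (\<Phi> g)) \<le> 0" if "g \<in> carrier G" for g
      using that by (simp add: not_less)
    have "B (\<Phi> g) \<in> null_sets \<S>" if "g \<in> carrier G" for g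
    proof (rule null_setsI[OF _ B_sets])
      have "measure \<S> (B (\<Phi> g)) = 0" using zero[OF that] measure_nonneg[of \<S> "B (\<Phi> g)"] by (rule antisym)
      then show "emeasure \<S> (B (\<Phi> g)) = 0" by (simp add: S.emeasure_eq_measure)
    qed
    then have null: "(\<Union>g\<in>carrier G. B (\<Phi> g)) \<in> null_sets \<S>"
      by (rule null_sets_UN'[OF countable_carrier])
    have "AE y in \<S>. y \<in> (\<Union>g\<in>carrier G. B (\<Phi> g))"
      using AE_eventually_no_bad_step[OF K bad] AE_space
    proof eventually_elim
      case (elim y)
      have y: "y n \<in> carrier G" for n using elim(2) by (simp add: space_\<S>)
      obtain n0 where n0: "\<forall>n\<ge>n0. walk G y n \<bullet> a \<notin> Bad (y n)"
        using elim(1) unfolding eventually_sequentially by (elim exE)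
      have const: "\<Phi> (walk G y n) = \<Phi> (walk G y n0)" if "n \<ge> n0" for n
        using that
      proof (induction n rule: dec_induct)
        case (step n)
        have "\<Phi> (walk G y (Suc n)) = \<Phi> (walk G y n)"
          unfolding walk.simps using y walk_closed[OF y] n0[rule_format, OF step(1)] by (rule \<Phi>_bad)
        with step show ?case by simp
      qed simp
      have "y \<in> B (\<Phi> (walk G y n0))"
        unfolding B_def eventually_sequentially using elim(2) const by (intro CollectI conjI exI allI impI)
      then show ?case using walk_closed[OF y] by (rule UN_I[rotated])
    qed
    moreover have "AE y in \<S>. y \<notin> (\<Union>g\<in>carrier G. B (\<Phi> g))" by (rule AE_not_in[OF null])
    ultimately have "AE y in \<S>. False" by eventually_elim (rule notE)
    then show False by simp
  qed
  then obtain g0 where g0: "g0 \<in> carrier G" "measure \<S> (B (\<Phi> g0)) > 0" by (elim bexE)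
  define v where "v = \<Phi> g0"
  have pos: "measure \<S> (B v) > 0" using g0 by (simp add: v_def)
  \<comment> \<open>With positive probability the first step is \<open>k\<close>, and the limit for the remaining walk is
      \<open>v\<close>.\<close>
  have shift: "measure \<mu> {k} * measure \<S> (B v) \<le> measure \<S> (B (\<psi> v))"
  proof -
    have "ennreal (measure \<mu> {k} * measure \<S> (B v)) = emeasure \<S> (B v) * emeasure \<mu> {k}"
      by (simp add: S.emeasure_eq_measure emeasure_eq_measure ennreal_mult mult.commute)
    also have "\<dots> = (\<integral>\<^sup>+g. emeasure \<S> (B v) * indicator {k} g \<partial>\<mu>)"
      using k(1) by (intro nn_integral_cmult_indicator[symmetric]) (simp add: sets_increment)
    also have "\<dots> \<le> (\<integral>\<^sup>+g. \<integral>\<^sup>+y. indicator (B (\<psi> v)) (case_nat g y) \<partial>\<S> \<partial>\<mu>)"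
    proof (rule nn_integral_mono)
      fix g
      show "emeasure \<S> (B v) * indicator {k} g \<le> (\<integral>\<^sup>+y. indicator (B (\<psi> v)) (case_nat g y) \<partial>\<S>)"
      proof (cases "g = k")
        case True
        have "emeasure \<S> (B v) = (\<integral>\<^sup>+y. indicator (B v) y \<partial>\<S>)" using B_sets by simp
        also have "\<dots> \<le> (\<integral>\<^sup>+y. indicator (B (\<psi> v)) (case_nat k y) \<partial>\<S>)"
        proof (rule nn_integral_mono)
          fix y assume y: "y \<in> space \<S>"
          then have yc: "y n \<in> carrier G" for n by (simp add: space_\<S>)
          have "case_nat k y \<in> B (\<psi> v)" if "y \<in> B v"
          proof -
            have "eventually (\<lambda>n. \<Phi> (walk G (case_nat k y) (Suc n)) = \<psi> v) sequentially"
              using that unfolding B_def mem_Collect_eq walk_case_nat[OF k(1) yc] \<Phi>_k[OF walk_closed[OF yc]]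
              by (elim conjE eventually_mono) simp
            then have "eventually (\<lambda>n. \<Phi> (walk G (case_nat k y) n) = \<psi> v) sequentially"
              by (rule eventually_sequentially_Suc[THEN iffD1])
            moreover have "case_nat k y \<in> space \<S>" using yc k(1) by (simp add: space_\<S> split: nat.split)
            ultimately show ?thesis by (simp add: B_def)
          qed
          then show "indicator (B v) y \<le> (indicator (B (\<psi> v)) (case_nat k y) :: ennreal)"
            by (simp split: split_indicator)
        qed
        finally show ?thesis using True by simp
      qed simp
    qed
    also have "\<dots> = (\<integral>\<^sup>+y. indicator (B (\<psi> v)) y \<partial>\<S>)"
      using B_sets by (intro nn_integral_\<S>_case_nat[symmetric]) simp
    also have "\<dots> = ennreal (measure \<S> (B (\<psi> v)))" using B_sets by (simp add: S.emeasure_eq_measure)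
    finally show ?thesis by (subst (asm) ennreal_le_iff) simp_all
  qed
  have "0 < measure \<mu> {k} * measure \<S> (B v)" using pos k(2) by simp
  with shift have pos': "measure \<S> (B (\<psi> v)) > 0" by linarith
  have "B v \<inter> B (\<psi> v) = {}"
  proof (rule equals0I)
    fix y assume "y \<in> B v \<inter> B (\<psi> v)"
    then have "eventually (\<lambda>n. \<Phi> (walk G y n) = v \<and> \<Phi> (walk G y n) = \<psi> v) sequentially"
      by (auto simp: B_def intro: eventually_conj)
    from eventually_happens'[OF sequentially_bot this] have "\<psi> v = v" by (elim exE conjE) simp
    with \<psi>[OF g0(1)] show False unfolding v_def by (rule notE)
  qed
  then have "measure \<S> (B v) + measure \<S> (B (\<psi> v)) = measure \<S> (B v \<union> B (\<psi> v))"
    using B_sets by (intro S.finite_measure_Union[symmetric])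
  also have "\<dots> \<le> 1" by (rule S.prob_le_1)
  finally have less: "measure \<S> (B v) < 1" using pos' by linarith
  show ?thesis
  proof (rule nontrivial_poisson_boundaryI[OF countable_carrier prob_space_markov_measure])
    show "E v \<in> sets (markov_measure G \<mu>)" using E_sets unfolding markov_measure_def T_def by simp
    show "x \<in> E v \<longleftrightarrow> y \<in> E v" if "(x, y) \<in> trajectory_rel G" for x y
      using trajectory_rel_eventually_iff[OF that, of "\<lambda>g. \<Phi> g = v"] trajectory_rel_carrier[OF that]
      by (simp add: E_def spT)
    show "measure (markov_measure G \<mu>) (E v) > 0" "measure (markov_measure G \<mu>) (E v) < 1"
      unfolding measure_E by (rule pos, rule less)
  qed
qed

end

section \<open>Integral projective transformations\<close>

lemma proj_moebius_comp:
  assumes d: "a * d - b * c = 1" and d': "a' * d' - b' * c' = 1"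
  shows "proj_moebius a b c d (proj_moebius a' b' c' d' z)
    = proj_moebius (a * a' + b * c') (a * b' + b * d') (c * a' + d * c') (c * b' + d * d') z"
proof (cases z)
  case None
  show ?thesis
  proof (cases "c' = 0")
    case True
    then have "a' \<noteq> 0" using d' by auto
    then show ?thesis using None True by simp
  next
    case False
    have den: "c * (a' / c') + d = (c * a' + d * c') / c'" using False by (simp add: field_simps)
    have num: "a * (a' / c') + b = (a * a' + b * c') / c'" using False by (simp add: field_simps)
    show ?thesis using None False by (simp add: moebius_def den num del: times_divide_eq_right)
  qed
next
  case (Some x)
  have den: "(c * a' + d * c') * x + (c * b' + d * d') = c * (a' * x + b') + d * (c' * x + d')" by algebra
  have num: "(a * a' + b * c') * x + (a * b' + b * d') = a * (a' * x + b') + b * (c' * x + d')" by algebra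
  show ?thesis
  proof (cases "c' * x + d' = 0")
    case True
    have "a' * x + b' \<noteq> 0"
    proof
      assume "a' * x + b' = 0"
      with True d' have "1 = (0::real)" by algebra
      then show False by simp
    qed
    then show ?thesis unfolding Some using True by (simp add: den num moebius_def)
  next
    case False
    have "c * moebius a' b' c' d' x + d = (c * (a' * x + b') + d * (c' * x + d')) / (c' * x + d')"
      using False by (simp add: moebius_def field_simps)
    moreover have "a * moebius a' b' c' d' x + b = (a * (a' * x + b') + b * (c' * x + d')) / (c' * x + d')"
      using False by (simp add: moebius_def field_simps)
    ultimately show ?thesis unfolding Some using False
      by (simp add: den num moebius_def[of a b c d] moebius_def[of "a * a' + b * c'"])
  qed
qed

lemma proj_moebius_id: "proj_moebius 1 0 0 1 = id"
proof
  fix z show "proj_moebius 1 0 0 1 z = id z" by (cases z) (simp_all add: moebius_def)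
qed

lemma PSL2Z_cases:
  assumes "m \<in> PSL2Z"
  obtains a b c d :: int where "a * d - b * c = 1" "m = proj_moebius (of_int a) (of_int b) (of_int c) (of_int d)"
  using assms unfolding PSL2Z_def by auto

lemma of_int_det: "a * d - b * c = (1::int) \<Longrightarrow> of_int a * of_int d - of_int b * of_int c = (1::real)"
  by (metis of_int_1 of_int_diff of_int_mult)

lemma PSL2Z_I: "a * d - b * c = (1::int) \<Longrightarrow> proj_moebius (of_int a) (of_int b) (of_int c) (of_int d) \<in> PSL2Z"
  unfolding PSL2Z_def by blast

lemma PSL2Z_id: "id \<in> PSL2Z"
  using PSL2Z_I[of 1 1 0 0] by (simp add: proj_moebius_id)

lemma PSL2Z_comp:
  assumes "m \<in> PSL2Z" "m' \<in> PSL2Z"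
  shows "m \<circ> m' \<in> PSL2Z"
proof -
  obtain a b c d where m: "a * d - b * c = 1" "m = proj_moebius (of_int a) (of_int b) (of_int c) (of_int d)"
    using assms(1) by (rule PSL2Z_cases)
  obtain a' b' c' d' where m': "a' * d' - b' * c' = 1" "m' = proj_moebius (of_int a') (of_int b') (of_int c') (of_int d')"
    using assms(2) by (rule PSL2Z_cases)
  have eq: "m \<circ> m' = proj_moebius (of_int (a * a' + b * c')) (of_int (a * b' + b * d')) (of_int (c * a' + d * c')) (of_int (c * b' + d * d'))"
    unfolding m(2) m'(2) comp_def by (rule ext) (simp add: proj_moebius_comp of_int_det m(1) m'(1))
  have "(a * a' + b * c') * (c * b' + d * d') - (a * b' + b * d') * (c * a' + d * c') = (a * d - b * c) * (a' * d' - b' * c')" by algebra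
  then have "(a * a' + b * c') * (c * b' + d * d') - (a * b' + b * d') * (c * a' + d * c') = 1" using m(1) m'(1) by simp
  from PSL2Z_I[OF this] show ?thesis unfolding eq .
qed

lemma PSL2Z_inverse:
  assumes "m \<in> PSL2Z"
  shows "bij m" "inv_into UNIV m \<in> PSL2Z"
proof -
  obtain a b c d where m: "a * d - b * c = 1" "m = proj_moebius (of_int a) (of_int b) (of_int c) (of_int d)"
    using assms by (rule PSL2Z_cases)
  define m' where "m' = proj_moebius (of_int d) (of_int (- b)) (of_int (- c)) (of_int a)"
  have det: "d * a - (- b) * (- c) = 1" using m(1) by (simp add: mult.commute)
  have det_real: "of_int a * of_int d - of_int b * of_int c = (1::real)" using m(1) by (rule of_int_det)
  have l: "m' (m z) = z" for z
  proof -
    have "m' (m z) = proj_moebius 1 0 0 1 z"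
      unfolding m(2) m'_def proj_moebius_comp[OF of_int_det[OF det] of_int_det[OF m(1)]]
      using det_real by (simp add: algebra_simps)
    then show ?thesis by (simp add: proj_moebius_id)
  qed
  have r: "m (m' z) = z" for z
  proof -
    have "m (m' z) = proj_moebius 1 0 0 1 z"
      unfolding m(2) m'_def proj_moebius_comp[OF of_int_det[OF m(1)] of_int_det[OF det]]
      using det_real by (simp add: algebra_simps)
    then show ?thesis by (simp add: proj_moebius_id)
  qed
  show "bij m" by (rule o_bij[of m']) (simp_all add: fun_eq_iff l r)
  have "inv_into UNIV m = m'" using l r by (rule inv_equality)
  then show "inv_into UNIV m \<in> PSL2Z" unfolding m'_def using PSL2Z_I[OF det] by simp
qed

text \<open>The fixed points are the roots of \<open>c y\<^sup>2 + (d - a) y - b\<close>.\<close>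

lemma PSL2Z_eq_id:
  assumes m: "m \<in> PSL2Z" and inf: "infinite {y. m (Some y) = Some y}"
  shows "m = id"
proof -
  obtain a b c d where m: "a * d - b * c = 1" "m = proj_moebius (of_int a) (of_int b) (of_int c) (of_int d)"
    using m by (rule PSL2Z_cases)
  define p where "p = [:- of_int b, of_int d - of_int a, of_int c :: real:]"
  have "{y. m (Some y) = Some y} \<subseteq> {y. poly p y = 0}"
  proof
    fix y assume "y \<in> {y. m (Some y) = Some y}"
    then have "m (Some y) = Some y" by simp
    then have nz: "of_int c * y + of_int d \<noteq> 0" "moebius (of_int a) (of_int b) (of_int c) (of_int d) y = y"
      unfolding m(2) by (simp_all split: if_splits)
    then have "of_int a * y + of_int b = y * (of_int c * y + of_int d)" by (simp add: moebius_def field_simps)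
    then show "y \<in> {y. poly p y = 0}" by (simp add: p_def algebra_simps)
  qed
  with inf have "infinite {y. poly p y = 0}" using finite_subset by blast
  then have "p = 0" using poly_roots_finite by blast
  then have 0: "b = 0" "d = a" "c = 0" by (simp_all add: p_def)
  with m(1) have "a * a = 1" by simp
  then have "a = 1 \<or> a = -1" by (simp add: square_eq_1_iff)
  moreover have "proj_moebius (- 1) 0 0 (- 1) = id"
  proof
    fix z show "proj_moebius (- 1) 0 0 (- 1) z = id z" by (cases z) (simp_all add: moebius_def)
  qed
  ultimately show ?thesis unfolding m(2) 0 using proj_moebius_id by auto
qed

text \<open>This makes germs unique: maps that agree on an interval are equal.\<close>

lemma PSL2Z_eqI:
  assumes m: "m \<in> PSL2Z" "m' \<in> PSL2Z" and inf: "infinite {y. m (Some y) = m' (Some y)}"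
  shows "m = m'"
proof -
  have b: "bij m'" using m(2) by (rule PSL2Z_inverse)
  have "inv_into UNIV m' \<circ> m \<in> PSL2Z" using m by (intro PSL2Z_comp PSL2Z_inverse)
  moreover have "{y. m (Some y) = m' (Some y)} \<subseteq> {y. (inv_into UNIV m' \<circ> m) (Some y) = Some y}"
    using b by (auto simp: bij_is_inj)
  then have "infinite {y. (inv_into UNIV m' \<circ> m) (Some y) = Some y}" using inf finite_subset by blast
  ultimately have "inv_into UNIV m' \<circ> m = id" by (rule PSL2Z_eq_id)
  then have "inv_into UNIV m' (m z) = z" for z by (simp add: fun_eq_iff)
  then have "m' z = m z" for z using b by (metis bij_is_surj surj_f_inv_f)
  then show ?thesis by (simp add: fun_eq_iff)
qed

section \<open>Pieces as intervals of the line\<close>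

text \<open>The pieces of a map that fixes infinity, cut to intervals of the real line; an arc through
  infinity is cut into two half-lines.\<close>

definition interval_pieces :: "(real option \<Rightarrow> real option) \<Rightarrow> real set set \<Rightarrow> bool" where
  "interval_pieces f \<I> \<longleftrightarrow> finite \<I> \<and> \<Union>\<I> = UNIV \<and>
     (\<forall>I\<in>\<I>. is_interval I \<and> (\<exists>m\<in>PSL2Z. \<forall>y\<in>I. f (Some y) = m (Some y)))"

lemma topspace_proj_line: "topspace proj_line = UNIV"
proof -
  have "x \<in> topspace proj_line" for x :: "real option" by (cases x) simp_all
  then show ?thesis by blast
qed

lemma openin_proj_line_image_Some: "open U \<Longrightarrow> openin proj_line (Some ` U)"
  unfolding openin_Alexandroff_compactification_image_Some by (simp only: open_openin)

lemma openin_proj_line_outer: "openin proj_line (insert None (Some ` (- {u..v})))"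
proof -
  have "compactin euclideanreal {u..v}" "closedin euclideanreal {u..v}" by simp_all
  then show ?thesis unfolding openin_Alexandroff_compactification
    by (intro disjI2 exI[of _ "{u..v}"]) (simp add: Compl_eq_Diff_UNIV)
qed

lemma connectedin_proj_line_not_separated:
  assumes P: "connectedin proj_line P" and "openin proj_line E1" "openin proj_line E2"
    "P \<subseteq> E1 \<union> E2" "E1 \<inter> E2 = {}" "x \<in> P" "x \<in> E1" "y \<in> P" "y \<in> E2"
  shows False
  using assms unfolding connectedin by blast

text \<open>A connected set that avoids infinity cannot miss a point between two of its points. One
  that contains infinity cannot contain a point between two missing ones: these two separate
  the circle.\<close>

lemma connectedin_proj_line_interval:
  assumes P: "connectedin proj_line P"
  shows "is_interval {y. Some y \<in> P} \<or> is_interval {y. Some y \<notin> P}"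
proof (cases "None \<in> P")
  case False
  have "y \<in> {y. Some y \<in> P}" if "u \<in> {y. Some y \<in> P}" "v \<in> {y. Some y \<in> P}" "u \<le> y" "y \<le> v" for u v y
  proof (rule ccontr)
    assume "y \<notin> {y. Some y \<in> P}"
    then have y: "Some y \<notin> P" by simp
    have "P \<subseteq> Some ` {..<y} \<union> Some ` {y<..}"
    proof
      fix z assume z: "z \<in> P"
      then obtain t where "z = Some t" using False by (cases z) auto
      then show "z \<in> Some ` {..<y} \<union> Some ` {y<..}" using z y by (cases t y rule: linorder_cases) auto
    qed
    moreover have "u < y" "y < v" using that y by (auto simp: less_le)
    ultimately show False using that
      by (intro connectedin_proj_line_not_separated[OF P openin_proj_line_image_Some openin_proj_line_image_Some, of "{..<y}" "{y<..}" "Some u" "Some v"]) auto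
  qed
  then show ?thesis unfolding is_interval_1 by blast
next
  case True
  have "y \<in> {y. Some y \<notin> P}" if "u \<in> {y. Some y \<notin> P}" "v \<in> {y. Some y \<notin> P}" "u \<le> y" "y \<le> v" for u v y
  proof (rule ccontr)
    assume "y \<notin> {y. Some y \<notin> P}"
    then have y: "Some y \<in> P" by simp
    have "P \<subseteq> Some ` {u<..<v} \<union> insert None (Some ` (- {u..v}))"
    proof
      fix z assume z: "z \<in> P"
      show "z \<in> Some ` {u<..<v} \<union> insert None (Some ` (- {u..v}))"
      proof (cases z)
        case (Some t)
        then have "t \<noteq> u" "t \<noteq> v" using that z by auto
        then show ?thesis using Some by (cases "t \<in> {u..v}") auto
      qed simp
    qed
    moreover have "u < y" "y < v" using that y by (auto simp: less_le)
    ultimately show False using y True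
      by (intro connectedin_proj_line_not_separated[OF P openin_proj_line_image_Some openin_proj_line_outer, of "{u<..<v}" u v "Some y" None]) auto
  qed
  then show ?thesis unfolding is_interval_1 by blast
qed

lemma is_intervalI:
  fixes I :: "real set"
  assumes "\<And>u v y. u \<in> I \<Longrightarrow> v \<in> I \<Longrightarrow> u \<le> y \<Longrightarrow> y \<le> v \<Longrightarrow> y \<in> I"
  shows "is_interval I"
  unfolding is_interval_1 by (intro ballI allI impI, elim conjE) (rule assms)

lemma is_intervalD:
  fixes I :: "real set"
  shows "is_interval I \<Longrightarrow> u \<in> I \<Longrightarrow> v \<in> I \<Longrightarrow> u \<le> y \<Longrightarrow> y \<le> v \<Longrightarrow> y \<in> I"
  unfolding is_interval_1 by blast

lemma interval_split_complement:
  fixes Q :: "real set"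
  assumes "is_interval (- Q)"
  shows "\<exists>I J. is_interval I \<and> is_interval J \<and> Q = I \<union> J"
proof (cases "- Q = {}")
  case True
  then have "Q = UNIV" by auto
  then show ?thesis by (intro exI[of _ UNIV] exI[of _ "{}"]) simp
next
  case False
  then obtain t where t: "t \<notin> Q" by auto
  have conv: "y \<notin> Q" if "u \<notin> Q" "v \<notin> Q" "u \<le> y" "y \<le> v" for u v y
    using is_intervalD[OF assms, of u v y] that by simp
  have "is_interval (Q \<inter> {..<t})"
  proof (rule is_intervalI)
    fix u v y assume "u \<in> Q \<inter> {..<t}" "v \<in> Q \<inter> {..<t}" "u \<le> y" "y \<le> v"
    then show "y \<in> Q \<inter> {..<t}" using conv[of y t v] t by auto
  qed
  moreover have "is_interval (Q \<inter> {t<..})"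
  proof (rule is_intervalI)
    fix u v y assume "u \<in> Q \<inter> {t<..}" "v \<in> Q \<inter> {t<..}" "u \<le> y" "y \<le> v"
    then show "y \<in> Q \<inter> {t<..}" using conv[of t y u] t by auto
  qed
  moreover have "y < t \<or> t < y" if "y \<in> Q" for y using that t by (cases y t rule: linorder_cases) auto
  then have "Q = Q \<inter> {..<t} \<union> Q \<inter> {t<..}" by auto
  ultimately show ?thesis by (intro exI[of _ "Q \<inter> {..<t}"] exI[of _ "Q \<inter> {t<..}"] conjI)
qed

lemma piecewise_imp_interval_pieces:
  assumes "piecewise_PSL2Z f"
  shows "\<exists>\<I>. interval_pieces f \<I>"
proof -
  obtain \<P> where P: "finite \<P>" "\<Union>\<P> = topspace proj_line"
    "\<And>p. p \<in> \<P> \<Longrightarrow> connectedin proj_line p" "\<And>p. p \<in> \<P> \<Longrightarrow> \<exists>m\<in>PSL2Z. \<forall>x\<in>p. f x = m x"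
    using assms unfolding piecewise_PSL2Z_def by blast
  have "\<exists>I J. is_interval I \<and> is_interval J \<and> {y. Some y \<in> p} = I \<union> J" if "p \<in> \<P>" for p
    using connectedin_proj_line_interval[OF P(3)[OF that]]
  proof
    assume "is_interval {y. Some y \<in> p}"
    then show ?thesis by (intro exI[of _ "{y. Some y \<in> p}"]) simp
  next
    assume "is_interval {y. Some y \<notin> p}"
    then have "is_interval (- {y. Some y \<in> p})" by (simp add: Compl_eq)
    then show ?thesis by (rule interval_split_complement)
  qed
  then obtain I J where IJ: "\<And>p. p \<in> \<P> \<Longrightarrow> is_interval (I p)" "\<And>p. p \<in> \<P> \<Longrightarrow> is_interval (J p)"
    "\<And>p. p \<in> \<P> \<Longrightarrow> {y. Some y \<in> p} = I p \<union> J p" by metis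
  have "interval_pieces f (I ` \<P> \<union> J ` \<P>)"
    unfolding interval_pieces_def
  proof (intro conjI ballI)
    show "finite (I ` \<P> \<union> J ` \<P>)" using P(1) by simp
    show "\<Union>(I ` \<P> \<union> J ` \<P>) = UNIV"
    proof (intro equalityI subset_UNIV subsetI)
      fix y :: real
      have "Some y \<in> \<Union>\<P>" using P(2) topspace_proj_line by simp
      then obtain p where p: "p \<in> \<P>" "Some y \<in> p" by blast
      then have "y \<in> I p \<union> J p" using IJ(3)[OF p(1)] by blast
      then show "y \<in> \<Union>(I ` \<P> \<union> J ` \<P>)" using p(1) by blast
    qed
    fix K assume K: "K \<in> I ` \<P> \<union> J ` \<P>"
    then show "is_interval K" using IJ(1,2) by blast
    from K obtain p where p: "p \<in> \<P>" "K = I p \<or> K = J p" by blast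
    then have "Some y \<in> p" if "y \<in> K" for y using IJ(3)[OF p(1)] that by blast
    then show "\<exists>m\<in>PSL2Z. \<forall>y\<in>K. f (Some y) = m (Some y)" using P(4)[OF p(1)] by blast
  qed
  then show ?thesis by blast
qed

lemma interval_pieces_imp_piecewise:
  assumes "interval_pieces f \<I>" "f None = None"
  shows "piecewise_PSL2Z f"
proof -
  have fin: "finite \<I>" and un: "\<Union>\<I> = UNIV" and I: "\<And>I. I \<in> \<I> \<Longrightarrow> is_interval I"
    and m: "\<And>I. I \<in> \<I> \<Longrightarrow> \<exists>m\<in>PSL2Z. \<forall>y\<in>I. f (Some y) = m (Some y)"
    using assms(1) unfolding interval_pieces_def by blast+
  let ?P = "insert {None} ((`) Some ` \<I>)"
  show ?thesis unfolding piecewise_PSL2Z_def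
  proof (intro exI[of _ ?P] conjI ballI)
    show "finite ?P" using fin by simp
    show "\<Union>?P = topspace proj_line"
    proof (unfold topspace_proj_line, intro equalityI subset_UNIV subsetI)
      fix z :: "real option"
      show "z \<in> \<Union>?P"
      proof (cases z)
        case (Some y)
        have "y \<in> \<Union>\<I>" using un by simp
        then show ?thesis using Some by auto
      qed simp
    qed
    fix p assume p: "p \<in> ?P"
    then have "p = {None} \<or> (\<exists>I\<in>\<I>. p = Some ` I)" by auto
    then consider "p = {None}" | I where "I \<in> \<I>" "p = Some ` I" by auto
    then show "connectedin proj_line p"
    proof cases
      case 1
      then show ?thesis using topspace_proj_line by simp
    next
      case 2
      then have "connected I" using I is_interval_connected_1 by blast
      then show ?thesis unfolding 2(2)
        by (intro connectedin_continuous_map_image[OF continuous_map_Some]) simp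
    qed
    show "\<exists>m\<in>PSL2Z. \<forall>x\<in>p. f x = m x"
      using \<open>p = {None} \<or> (\<exists>I\<in>\<I>. p = Some ` I)\<close>
    proof (elim disjE bexE)
      assume "p = {None}"
      then have "\<forall>x\<in>p. f x = id x" using assms(2) by simp
      then show ?thesis using PSL2Z_id by (rule bexI)
    next
      fix I assume I: "I \<in> \<I>" "p = Some ` I"
      obtain m' where m': "\<forall>y\<in>I. f (Some y) = m' (Some y)" "m' \<in> PSL2Z" using m[OF I(1)] by blast
      have "\<forall>x\<in>p. f x = m' x" unfolding I(2) using m'(1) by blast
      then show ?thesis using m'(2) by (rule bexI)
    qed
  qed
qed

section \<open>One-sided germs\<close>

text \<open>Increasing homeomorphisms of the line permute these directions of approach, so germs along
  them can be composed.\<close>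

definition dirs :: "real filter set" where
  "dirs = range at_left \<union> range at_right \<union> {at_bot}"

lemma dirs_intros [simp]: "at_left x \<in> dirs" "at_right x \<in> dirs" "at_bot \<in> dirs"
  by (simp_all add: dirs_def)

lemma dirs_cases:
  assumes "F \<in> dirs"
  obtains x where "F = at_left x" | x where "F = at_right x" | "F = at_bot"
  using assms unfolding dirs_def by blast

lemma dirs_interval:
  assumes F: "F \<in> dirs" and ev: "eventually P F"
  shows "\<exists>u v. u < v \<and> (\<forall>y. u < y \<and> y < v \<longrightarrow> P y)"
  using F
proof (cases rule: dirs_cases)
  case (1 x)
  obtain b where "b < x" "\<forall>y>b. y < x \<longrightarrow> P y" using ev unfolding 1 eventually_at_left_field by blast
  then show ?thesis by blast
next
  case (2 x)
  obtain b where "b > x" "\<forall>y>x. y < b \<longrightarrow> P y" using ev unfolding 2 eventually_at_right_field by blast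
  then show ?thesis by blast
next
  case 3
  obtain N where "\<forall>y\<le>N. P y" using ev unfolding 3 eventually_at_bot_linorder by blast
  then show ?thesis by (intro exI[of _ "N - 1"] exI[of _ N]) auto
qed

lemma dirs_infinite:
  assumes "F \<in> dirs" "eventually P F"
  shows "infinite {y. P y}"
proof -
  obtain u v where uv: "u < v" "\<forall>y. u < y \<and> y < v \<longrightarrow> P y" using dirs_interval[OF assms] by blast
  have "infinite {u<..<v}" using uv(1) by (rule infinite_Ioo)
  moreover have "{u<..<v} \<subseteq> {y. P y}" using uv(2) by auto
  ultimately show ?thesis using finite_subset by blast
qed

lemma dirs_not_bot: "F \<in> dirs \<Longrightarrow> F \<noteq> bot"
  using dirs_infinite[of F "\<lambda>_. False"] by auto

text \<open>An interval that meets every neighbourhood in a direction contains one.\<close>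

lemma dirs_decided:
  assumes F: "F \<in> dirs" and I: "is_interval I" and freq: "\<not> eventually (\<lambda>y. y \<notin> I) F"
  shows "eventually (\<lambda>y. y \<in> I) F"
  using F
proof (cases rule: dirs_cases)
  case (1 x)
  have ex: "\<exists>i\<in>I. b < i \<and> i < x" if "b < x" for b
  proof (rule ccontr)
    assume "\<not> ?thesis"
    then have "\<forall>y>b. y < x \<longrightarrow> y \<notin> I" by blast
    then show False using freq that unfolding 1 eventually_at_left_field by blast
  qed
  obtain i where i: "i \<in> I" "i < x" using ex[of "x - 1"] by auto
  have "y \<in> I" if y: "i < y" "y < x" for y
  proof -
    obtain j where "j \<in> I" "y < j" using ex[OF y(2)] by blast
    then show ?thesis using is_intervalD[OF I i(1), of j y] y by simp
  qed
  then show ?thesis using i(2) unfolding 1 eventually_at_left_field by blast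
next
  case (2 x)
  have ex: "\<exists>i\<in>I. x < i \<and> i < b" if "x < b" for b
  proof (rule ccontr)
    assume "\<not> ?thesis"
    then have "\<forall>y>x. y < b \<longrightarrow> y \<notin> I" by blast
    then show False using freq that unfolding 2 eventually_at_right_field by blast
  qed
  obtain i where i: "i \<in> I" "x < i" using ex[of "x + 1"] by auto
  have "y \<in> I" if y: "x < y" "y < i" for y
  proof -
    obtain j where "j \<in> I" "j < y" using ex[OF y(1)] by blast
    then show ?thesis using is_intervalD[OF I _ i(1), of j y] y by simp
  qed
  then show ?thesis using i(2) unfolding 2 eventually_at_right_field by blast
next
  case 3
  have ex: "\<exists>i\<in>I. i \<le> b" for b
  proof (rule ccontr)
    assume "\<not> ?thesis"
    then have "\<forall>y\<le>b. y \<notin> I" by blast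
    then show False using freq unfolding 3 eventually_at_bot_linorder by blast
  qed
  obtain i where i: "i \<in> I" using ex[of 0] by auto
  have "y \<in> I" if "y \<le> i" for y
  proof -
    obtain j where "j \<in> I" "j \<le> y" using ex by blast
    then show ?thesis using is_intervalD[OF I _ i, of j y] that by simp
  qed
  then show ?thesis unfolding 3 eventually_at_bot_linorder by blast
qed

text \<open>Unique, since a neighbourhood in a direction contains an interval.\<close>

definition germ :: "real filter \<Rightarrow> (real option \<Rightarrow> real option) \<Rightarrow> real option \<Rightarrow> real option" where
  "germ F f = (THE m. m \<in> PSL2Z \<and> eventually (\<lambda>y. f (Some y) = m (Some y)) F)"

lemma germ_eqI:
  assumes F: "F \<in> dirs" and m: "m \<in> PSL2Z" "eventually (\<lambda>y. f (Some y) = m (Some y)) F"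
  shows "germ F f = m"
  unfolding germ_def
proof (rule the_equality)
  show "m \<in> PSL2Z \<and> eventually (\<lambda>y. f (Some y) = m (Some y)) F" using m by simp
  fix m' assume m': "m' \<in> PSL2Z \<and> eventually (\<lambda>y. f (Some y) = m' (Some y)) F"
  have "eventually (\<lambda>y. m' (Some y) = m (Some y)) F"
    using conjunct2[OF m'] m(2) by eventually_elim simp
  from dirs_infinite[OF F this] show "m' = m" using m' m(1) by (intro PSL2Z_eqI) simp_all
qed

text \<open>Of finitely many sets that cover a neighbourhood in the direction, one meets every smaller
  neighbourhood.\<close>

lemma interval_pieces_germ:
  assumes I: "interval_pieces f \<I>" and F: "F \<in> dirs"
  shows "\<exists>m\<in>PSL2Z. eventually (\<lambda>y. f (Some y) = m (Some y)) F"
proof -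
  have fin: "finite \<I>" and un: "\<Union>\<I> = UNIV" and I: "\<And>I. I \<in> \<I> \<Longrightarrow> is_interval I"
    and m: "\<And>I. I \<in> \<I> \<Longrightarrow> \<exists>m\<in>PSL2Z. \<forall>y\<in>I. f (Some y) = m (Some y)"
    using assms(1) unfolding interval_pieces_def by blast+
  have "\<exists>I\<in>\<I>. \<not> eventually (\<lambda>y. y \<notin> I) F"
  proof (rule ccontr)
    assume "\<not> ?thesis"
    then have "\<forall>I\<in>\<I>. eventually (\<lambda>y. y \<notin> I) F" by blast
    then have "eventually (\<lambda>y. \<forall>I\<in>\<I>. y \<notin> I) F" using fin by (simp add: eventually_ball_finite)
    moreover have "\<not> (\<forall>I\<in>\<I>. y \<notin> I)" for y :: real using un by blast
    ultimately have "eventually (\<lambda>y. False) F" by simp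
    then show False using dirs_not_bot[OF F] by simp
  qed
  then obtain I where I': "I \<in> \<I>" "\<not> eventually (\<lambda>y. y \<notin> I) F" by blast
  have ev: "eventually (\<lambda>y. y \<in> I) F" by (rule dirs_decided[OF F I[OF I'(1)] I'(2)])
  obtain m where "m \<in> PSL2Z" "\<forall>y\<in>I. f (Some y) = m (Some y)" using m[OF I'(1)] by blast
  then show ?thesis using ev by (intro bexI[of _ m]) (auto elim!: eventually_mono)
qed

section \<open>The group of piecewise projective homeomorphisms\<close>

definition re :: "(real option \<Rightarrow> real option) \<Rightarrow> real \<Rightarrow> real" where
  "re f x = the (f (Some x))"

lemma Gtilde_simps: "f \<otimes>\<^bsub>Gtilde\<^esub> g = f \<circ> g" "\<one>\<^bsub>Gtilde\<^esub> = id"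
  by (simp_all add: Gtilde_def)

lemma GtildeD:
  assumes "f \<in> carrier Gtilde"
  shows "homeomorphic_map proj_line proj_line f" "f None = None" "\<exists>\<I>. interval_pieces f \<I>"
  using assms piecewise_imp_interval_pieces by (simp_all add: Gtilde_def)

lemma GtildeI:
  assumes "homeomorphic_map proj_line proj_line f" "f None = None" "interval_pieces f \<I>"
  shows "f \<in> carrier Gtilde"
  using assms interval_pieces_imp_piecewise by (simp add: Gtilde_def)

lemma Gtilde_bij:
  assumes "f \<in> carrier Gtilde"
  shows "bij f"
  using bijective_open_imp_homeomorphic_map homeomorphic_imp_injective_map[OF GtildeD(1)[OF assms]]
    homeomorphic_imp_surjective_map[OF GtildeD(1)[OF assms]]
  unfolding bij_def topspace_proj_line by simp

lemma Gtilde_Some: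
  assumes "f \<in> carrier Gtilde"
  shows "f (Some x) = Some (re f x)"
proof -
  have "f (Some x) \<noteq> f None" using Gtilde_bij[OF assms] by (simp add: bij_is_inj inj_eq)
  then show ?thesis using GtildeD(2)[OF assms] by (auto simp: re_def)
qed

lemma continuous_on_re:
  assumes f: "f \<in> carrier Gtilde"
  shows "continuous_on UNIV (re f)"
proof -
  have c: "continuous_map euclideanreal proj_line (f \<circ> Some)"
    using continuous_map_Some homeomorphic_imp_continuous_map[OF GtildeD(1)[OF f]]
    by (rule continuous_map_compose)
  have "open (re f -` U)" if "open U" for U
  proof -
    have "openin euclideanreal {x \<in> topspace euclideanreal. (f \<circ> Some) x \<in> Some ` U}"
      by (rule openin_continuous_map_preimage[OF c openin_proj_line_image_Some[OF that]])
    also have "{x \<in> topspace euclideanreal. (f \<circ> Some) x \<in> Some ` U} = re f -` U"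
      by (auto simp: Gtilde_Some[OF f])
    finally show ?thesis by (rule open_openin[THEN iffD2])
  qed
  then show ?thesis by (simp add: continuous_on_open_vimage)
qed

lemma bij_re:
  assumes f: "f \<in> carrier Gtilde"
  shows "bij (re f)"
proof (rule bijI)
  show "inj (re f)"
  proof (rule injI)
    fix x y assume "re f x = re f y"
    then have "f (Some x) = f (Some y)" by (simp add: Gtilde_Some[OF f])
    then show "x = y" using Gtilde_bij[OF f] by (simp add: bij_is_inj inj_eq)
  qed
  show "surj (re f)"
    unfolding surj_def
  proof
    fix y
    obtain z where z: "f z = Some y" using Gtilde_bij[OF f] by (metis bij_pointE)
    have "z \<noteq> None" using GtildeD(2)[OF f] z by (metis option.distinct(1))
    then obtain x where "z = Some x" by (cases z) auto
    then have "y = re f x" using z by (simp add: Gtilde_Some[OF f])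
    then show "\<exists>x. y = re f x" by (rule exI)
  qed
qed

lemma moebius_increasing:
  fixes y z :: real
  assumes "a * d - b * c = 1" "(c * y + d) * (c * z + d) > 0" "y < z"
  shows "moebius a b c d y < moebius a b c d z"
proof -
  have nz: "c * y + d \<noteq> 0" "c * z + d \<noteq> 0" using assms(2) by auto
  have "moebius a b c d z - moebius a b c d y = ((a * z + b) * (c * y + d) - (a * y + b) * (c * z + d)) / ((c * y + d) * (c * z + d))"
    using nz by (simp add: moebius_def diff_frac_eq mult.commute)
  also have "(a * z + b) * (c * y + d) - (a * y + b) * (c * z + d) = (a * d - b * c) * (z - y)" by algebra
  also have "\<dots> = z - y" using assms(1) by simp
  also have "(z - y) / ((c * y + d) * (c * z + d)) > 0" using assms(2,3) by simp
  finally show ?thesis by simp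
qed

text \<open>A continuous injection is monotone, and it is increasing because on some small interval it
  is a projective map of determinant one.\<close>

lemma strict_mono_re:
  assumes f: "f \<in> carrier Gtilde"
  shows "strict_mono (re f)"
proof -
  have "strict_mono (re f) \<or> strict_antimono_on UNIV (re f)"
    using injective_eq_monotone_map[of UNIV "re f"] continuous_on_re[OF f] bij_is_inj[OF bij_re[OF f]] by simp
  moreover have "\<not> strict_antimono_on UNIV (re f)"
  proof
    assume anti: "strict_antimono_on UNIV (re f)"
    obtain \<I> where "interval_pieces f \<I>" using GtildeD(3)[OF f] by blast
    from interval_pieces_germ[OF this, of "at_right 0"]
    obtain m where m: "m \<in> PSL2Z" "eventually (\<lambda>y. f (Some y) = m (Some y)) (at_right 0)" by auto
    from m(1) obtain a b c d where abcd: "a * d - b * c = 1" "m = proj_moebius (of_int a) (of_int b) (of_int c) (of_int d)"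
      by (rule PSL2Z_cases)
    let ?den = "\<lambda>y. of_int c * y + of_int d :: real"
    have ev: "eventually (\<lambda>y. ?den y \<noteq> 0 \<and> re f y = moebius (of_int a) (of_int b) (of_int c) (of_int d) y) (at_right 0)"
      using m(2)
    proof eventually_elim
      case (elim y)
      then have "m (Some y) = Some (re f y)" by (simp add: Gtilde_Some[OF f])
      then show ?case unfolding abcd(2) by (simp split: if_splits)
    qed
    have iv: "is_interval {y. ?den y > 0}"
    proof (rule is_intervalI, unfold mem_Collect_eq)
      fix u v y :: real assume *: "?den u > 0" "?den v > 0" "u \<le> y" "y \<le> v"
      show "?den y > 0"
      proof (cases "c \<ge> 0")
        case True
        then have "of_int c * u \<le> of_int c * y" using *(3) by (intro mult_left_mono) simp_all
        then show ?thesis using *(1) by linarith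
      next
        case False
        then have "of_int c * v \<le> of_int c * y" using *(4) by (intro mult_left_mono_neg) simp_all
        then show ?thesis using *(2) by linarith
      qed
    qed
    have "eventually (\<lambda>y. ?den y > 0) (at_right 0) \<or> eventually (\<lambda>y. ?den y < 0) (at_right 0)"
    proof (cases "eventually (\<lambda>y. y \<notin> {y. ?den y > 0}) (at_right (0::real))")
      case True
      then have "eventually (\<lambda>y. ?den y < 0) (at_right 0)" using ev
        by eventually_elim auto
      then show ?thesis by (rule disjI2)
    next
      case False
      from dirs_decided[OF _ iv False] show ?thesis by simp
    qed
    \<comment> \<open>The denominator of the map has a constant sign \<open>s\<close> close to \<open>0\<close> on the right.\<close>
    then obtain s :: real where s: "eventually (\<lambda>y. ?den y * s > 0) (at_right 0)"
    proof
      assume "eventually (\<lambda>y. ?den y > 0) (at_right 0)"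
      then show thesis by (intro that[of 1]) simp
    next
      assume "eventually (\<lambda>y. ?den y < 0) (at_right 0)"
      then show thesis by (intro that[of "-1"]) (elim eventually_mono, simp)
    qed
    have "\<exists>u v. u < v \<and> (\<forall>y. u < y \<and> y < v \<longrightarrow> ((?den y \<noteq> 0 \<and> re f y = moebius (of_int a) (of_int b) (of_int c) (of_int d) y) \<and> ?den y * s > 0))"
      by (rule dirs_interval[of "at_right 0"]) (simp_all only: dirs_intros eventually_conj[OF ev s])
    then obtain u v where uv: "u < v" "\<And>y. u < y \<Longrightarrow> y < v \<Longrightarrow> re f y = moebius (of_int a) (of_int b) (of_int c) (of_int d) y"
      "\<And>y. u < y \<Longrightarrow> y < v \<Longrightarrow> ?den y * s > 0" by blast
    obtain y where y: "u < y" "y < v" using dense[OF uv(1)] by blast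
    obtain z where z: "y < z" "z < v" using dense[OF y(2)] by blast
    have "u < z" using y z by simp
    have "(?den y * s) * (?den z * s) > 0" using uv(3)[OF y] uv(3)[OF \<open>u < z\<close> z(2)] by (rule mult_pos_pos)
    then have "(?den y * ?den z) * (s * s) > 0" by (simp add: mult_ac)
    then have "?den y * ?den z > 0" by (simp add: zero_less_mult_iff)
    from moebius_increasing[OF of_int_det[OF abcd(1)] this z(1)] have "re f y < re f z"
      using uv(2)[OF y] uv(2)[OF \<open>u < z\<close> z(2)] by simp
    moreover have "re f z < re f y" using anti z(1) by (simp add: monotone_on_def)
    ultimately show False by simp
  qed
  ultimately show ?thesis by blast
qed

lemma re_comp: "g \<in> carrier Gtilde \<Longrightarrow> re (f \<circ> g) x = re f (re g x)"
  by (simp add: re_def[of "f \<circ> g"] Gtilde_Some) (simp add: re_def)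

lemma re_id: "re id x = x"
  by (simp add: re_def)

lemma interval_pieces_comp:
  assumes f: "interval_pieces f \<I>" and g: "g \<in> carrier Gtilde" "interval_pieces g \<J>"
  shows "interval_pieces (f \<circ> g) ((\<lambda>(I, J). J \<inter> re g -` I) ` (\<I> \<times> \<J>))"
  unfolding interval_pieces_def
proof (intro conjI ballI)
  have I: "finite \<I>" "\<Union>\<I> = UNIV" "\<And>I. I \<in> \<I> \<Longrightarrow> is_interval I"
     "\<And>I. I \<in> \<I> \<Longrightarrow> \<exists>m\<in>PSL2Z. \<forall>y\<in>I. f (Some y) = m (Some y)"
    using f unfolding interval_pieces_def by blast+
  have J: "finite \<J>" "\<Union>\<J> = UNIV" "\<And>I. I \<in> \<J> \<Longrightarrow> is_interval I"
     "\<And>I. I \<in> \<J> \<Longrightarrow> \<exists>m\<in>PSL2Z. \<forall>y\<in>I. g (Some y) = m (Some y)"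
    using g(2) unfolding interval_pieces_def by blast+
  show "finite ((\<lambda>(I, J). J \<inter> re g -` I) ` (\<I> \<times> \<J>))" using I(1) J(1) by simp
  show "\<Union>((\<lambda>(I, J). J \<inter> re g -` I) ` (\<I> \<times> \<J>)) = UNIV"
  proof (intro equalityI subset_UNIV subsetI)
    fix y :: real
    obtain A where A: "A \<in> \<I>" "re g y \<in> A" using I(2) by blast
    obtain B where B: "B \<in> \<J>" "y \<in> B" using J(2) by blast
    show "y \<in> \<Union>((\<lambda>(I, J). J \<inter> re g -` I) ` (\<I> \<times> \<J>))"
      using A B by (intro UN_I[of "(A, B)"]) auto
  qed
  fix K assume "K \<in> (\<lambda>(I, J). J \<inter> re g -` I) ` (\<I> \<times> \<J>)"
  then obtain A B where AB: "A \<in> \<I>" "B \<in> \<J>" "K = B \<inter> re g -` A" by auto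
  show "is_interval K"
  proof (rule is_intervalI)
    fix u v y assume *: "u \<in> K" "v \<in> K" "u \<le> y" "y \<le> v"
    have "re g u \<le> re g y" "re g y \<le> re g v"
      using *(3,4) strict_mono_less_eq[OF strict_mono_re[OF g(1)]] by simp_all
    then have "re g y \<in> A" using is_intervalD[OF I(3)[OF AB(1)], of "re g u" "re g v" "re g y"] * unfolding AB(3) by simp
    moreover have "y \<in> B" using is_intervalD[OF J(3)[OF AB(2)], of u v y] * unfolding AB(3) by simp
    ultimately show "y \<in> K" unfolding AB(3) by simp
  qed
  obtain m where m: "m \<in> PSL2Z" "\<forall>y\<in>A. f (Some y) = m (Some y)" using I(4)[OF AB(1)] by blast
  obtain m' where m': "m' \<in> PSL2Z" "\<forall>y\<in>B. g (Some y) = m' (Some y)" using J(4)[OF AB(2)] by blast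
  show "\<exists>m\<in>PSL2Z. \<forall>y\<in>K. (f \<circ> g) (Some y) = m (Some y)"
  proof (rule bexI[OF _ PSL2Z_comp[OF m(1) m'(1)]], rule ballI)
    fix y assume "y \<in> K"
    then have y: "y \<in> B" "re g y \<in> A" unfolding AB(3) by simp_all
    have "m' (Some y) = Some (re g y)" using m'(2) y(1) Gtilde_Some[OF g(1)] by simp
    then show "(f \<circ> g) (Some y) = (m \<circ> m') (Some y)" using m(2) y(2) Gtilde_Some[OF g(1)] by simp
  qed
qed

lemma interval_pieces_inverse:
  assumes g: "g \<in> carrier Gtilde" "interval_pieces g \<J>"
  shows "interval_pieces (inv_into UNIV g) ((`) (re g) ` \<J>)"
  unfolding interval_pieces_def
proof (intro conjI ballI)
  have J: "finite \<J>" "\<Union>\<J> = UNIV" "\<And>I. I \<in> \<J> \<Longrightarrow> is_interval I"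
     "\<And>I. I \<in> \<J> \<Longrightarrow> \<exists>m\<in>PSL2Z. \<forall>y\<in>I. g (Some y) = m (Some y)"
    using g(2) unfolding interval_pieces_def by blast+
  have surj: "surj (re g)" using bij_re[OF g(1)] by (rule bij_is_surj)
  show "finite ((`) (re g) ` \<J>)" using J(1) by simp
  show "\<Union>((`) (re g) ` \<J>) = UNIV" using J(2) surj by (metis image_Union)
  fix K assume "K \<in> (`) (re g) ` \<J>"
  then obtain B where B: "B \<in> \<J>" "K = re g ` B" by auto
  show "is_interval K"
  proof (rule is_intervalI)
    fix u v y assume *: "u \<in> K" "v \<in> K" "u \<le> y" "y \<le> v"
    obtain u' v' where uv: "u' \<in> B" "v' \<in> B" "u = re g u'" "v = re g v'" using * B by auto
    obtain y' where y': "y = re g y'" using surj by (rule surjE)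
    have "u' \<le> y'" "y' \<le> v'" using *(3,4) strict_mono_less_eq[OF strict_mono_re[OF g(1)]] uv y' by simp_all
    then have "y' \<in> B" using is_intervalD[OF J(3)[OF B(1)] uv(1,2)] by simp
    then show "y \<in> K" using y' B by simp
  qed
  obtain m where m: "m \<in> PSL2Z" "\<forall>y\<in>B. g (Some y) = m (Some y)" using J(4)[OF B(1)] by blast
  show "\<exists>m\<in>PSL2Z. \<forall>y\<in>K. inv_into UNIV g (Some y) = m (Some y)"
  proof (rule bexI[OF _ PSL2Z_inverse(2)[OF m(1)]], rule ballI)
    fix y assume "y \<in> K"
    then obtain t where t: "t \<in> B" "y = re g t" using B(2) by auto
    have "g (Some t) = Some y" "m (Some t) = Some y" using t m(2) Gtilde_Some[OF g(1)] by simp_all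
    then show "inv_into UNIV g (Some y) = inv_into UNIV m (Some y)"
      using Gtilde_bij[OF g(1)] PSL2Z_inverse(1)[OF m(1)] by (metis bij_is_inj inv_f_f)
  qed
qed

lemma Gtilde_inverse:
  assumes g: "g \<in> carrier Gtilde"
  shows "inv_into UNIV g \<in> carrier Gtilde"
proof -
  obtain \<J> where J: "interval_pieces g \<J>" using GtildeD(3)[OF g] by blast
  obtain h where h: "homeomorphic_maps proj_line proj_line g h"
    using GtildeD(1)[OF g] homeomorphic_map_maps by blast
  have "inv_into UNIV g = h"
    using h unfolding homeomorphic_maps_def topspace_proj_line by (intro inv_equality) simp_all
  moreover have "homeomorphic_map proj_line proj_line h"
    using h homeomorphic_maps_sym homeomorphic_map_maps by blast
  moreover have "inv_into UNIV g None = None"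
    using Gtilde_bij[OF g] GtildeD(2)[OF g] by (metis bij_is_inj inv_f_f)
  ultimately show ?thesis using interval_pieces_inverse[OF g J] by (intro GtildeI) simp_all
qed

lemma group_Gtilde: "group Gtilde"
proof (rule groupI)
  fix f g assume f: "f \<in> carrier Gtilde" and g: "g \<in> carrier Gtilde"
  obtain \<I> \<J> where "interval_pieces f \<I>" "interval_pieces g \<J>" using GtildeD(3)[OF f] GtildeD(3)[OF g] by blast
  from interval_pieces_comp[OF this(1) g this(2)]
  show "f \<otimes>\<^bsub>Gtilde\<^esub> g \<in> carrier Gtilde" unfolding Gtilde_simps
    using homeomorphic_map_compose[OF GtildeD(1)[OF g] GtildeD(1)[OF f]] GtildeD(2)[OF f] GtildeD(2)[OF g]
    by (intro GtildeI) simp_all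
next
  have "interval_pieces id {UNIV}" unfolding interval_pieces_def using PSL2Z_id by (auto intro: bexI[of _ id])
  then show "\<one>\<^bsub>Gtilde\<^esub> \<in> carrier Gtilde" unfolding Gtilde_simps
    by (intro GtildeI) (simp_all add: id_def[symmetric])
next
  fix f assume f: "f \<in> carrier Gtilde"
  show "\<exists>y\<in>carrier Gtilde. y \<otimes>\<^bsub>Gtilde\<^esub> f = \<one>\<^bsub>Gtilde\<^esub>"
    using Gtilde_inverse[OF f] Gtilde_bij[OF f] unfolding Gtilde_simps by (metis bij_is_inj inv_o_cancel)
qed (simp_all add: Gtilde_simps comp_assoc)

section \<open>Germs of compositions\<close>

lemma germ_props:
  assumes "f \<in> carrier Gtilde" "F \<in> dirs"
  shows "germ F f \<in> PSL2Z" "eventually (\<lambda>y. f (Some y) = germ F f (Some y)) F"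
proof -
  obtain \<I> where "interval_pieces f \<I>" using GtildeD(3)[OF assms(1)] by blast
  from interval_pieces_germ[OF this assms(2)]
  obtain m where m: "m \<in> PSL2Z" "eventually (\<lambda>y. f (Some y) = m (Some y)) F" by blast
  then have "germ F f = m" using germ_eqI[OF assms(2)] by blast
  then show "germ F f \<in> PSL2Z" "eventually (\<lambda>y. f (Some y) = germ F f (Some y)) F" using m by simp_all
qed

lemma germ_cong:
  assumes "g \<in> carrier Gtilde" "F \<in> dirs" "eventually (\<lambda>y. f (Some y) = g (Some y)) F"
  shows "germ F f = germ F g"
proof (rule germ_eqI[OF assms(2)])
  show "germ F g \<in> PSL2Z" by (rule germ_props[OF assms(1,2)])
  show "eventually (\<lambda>y. f (Some y) = germ F g (Some y)) F"
    using assms(3) germ_props(2)[OF assms(1,2)] by eventually_elim simp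
qed

lemma germ_comp:
  assumes f: "f \<in> carrier Gtilde" and g: "g \<in> carrier Gtilde" and F: "F \<in> dirs" "F' \<in> dirs"
    and lim: "filterlim (re g) F' F"
  shows "germ F (f \<circ> g) = germ F' f \<circ> germ F g"
proof (rule germ_eqI[OF F(1)])
  show "germ F' f \<circ> germ F g \<in> PSL2Z" using f g F by (intro PSL2Z_comp germ_props)
  have "eventually (\<lambda>y. f (Some (re g y)) = germ F' f (Some (re g y))) F"
    using germ_props(2)[OF f F(2)] lim by (rule eventually_compose_filterlim)
  then show "eventually (\<lambda>y. (f \<circ> g) (Some y) = (germ F' f \<circ> germ F g) (Some y)) F"
    using germ_props(2)[OF g F(1)]
  proof eventually_elim
    case (elim y)
    then show ?case by (simp add: Gtilde_Some[OF g])
  qed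
qed

lemma filterlim_re:
  assumes g: "g \<in> carrier Gtilde"
  shows "filterlim (re g) (at_left (re g x)) (at_left x)" "filterlim (re g) (at_right (re g x)) (at_right x)"
    "filterlim (re g) at_bot at_bot"
proof -
  have cont: "isCont (re g) x" using continuous_on_re[OF g] by (simp add: continuous_on_eq_continuous_at)
  have mono: "re g u < re g v \<longleftrightarrow> u < v" for u v using strict_mono_less[OF strict_mono_re[OF g]] .
  have l: "(re g \<longlongrightarrow> re g x) (at_left x)" and r: "(re g \<longlongrightarrow> re g x) (at_right x)"
    using cont unfolding isCont_def by (auto intro: tendsto_within_subset[of _ _ _ UNIV])
  show "filterlim (re g) (at_left (re g x)) (at_left x)"
    unfolding filterlim_at
  proof (intro conjI l)
    have "eventually (\<lambda>y. y < x) (at_left x)" by (auto simp: eventually_at_filter)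
    then show "eventually (\<lambda>y. re g y \<in> {..<re g x} \<and> re g y \<noteq> re g x) (at_left x)"
    proof eventually_elim
      case (elim y)
      then have "re g y < re g x" using mono by blast
      then show ?case by simp
    qed
  qed
  show "filterlim (re g) (at_right (re g x)) (at_right x)"
    unfolding filterlim_at
  proof (intro conjI r)
    have "eventually (\<lambda>y. x < y) (at_right x)" by (auto simp: eventually_at_filter)
    then show "eventually (\<lambda>y. re g y \<in> {re g x<..} \<and> re g y \<noteq> re g x) (at_right x)"
    proof eventually_elim
      case (elim y)
      then have "re g x < re g y" using mono by blast
      then show ?case by simp
    qed
  qed
  show "filterlim (re g) at_bot at_bot"
    unfolding filterlim_at_bot
  proof
    fix Z
    obtain y0 where y0: "re g y0 = Z" using bij_re[OF g] by (metis bij_pointE)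
    have "re g y \<le> Z" if "y \<le> y0" for y
      using strict_mono_less_eq[OF strict_mono_re[OF g], of y y0] that y0 by simp
    then show "eventually (\<lambda>y. re g y \<le> Z) at_bot" unfolding eventually_at_bot_linorder by blast
  qed
qed

section \<open>Jumps\<close>

text \<open>This is the identity if \<open>f\<close> is given by one projective map around \<open>x\<close>; it can be a
  nontrivial projective map although \<open>f\<close> is continuous at \<open>x\<close>.\<close>

definition jump :: "(real option \<Rightarrow> real option) \<Rightarrow> real \<Rightarrow> real option \<Rightarrow> real option" where
  "jump f x = inv_into UNIV (germ (at_left x) f) \<circ> germ (at_right x) f"

text \<open>The chain rule for the two germs. In particular, the factor \<open>f\<close> matters only through its
  jump at \<open>g x\<close>.\<close>

lemma jump_comp:
  assumes f: "f \<in> carrier Gtilde" and g: "g \<in> carrier Gtilde"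
  shows "jump (f \<circ> g) x = inv_into UNIV (germ (at_left x) g) \<circ> jump f (re g x) \<circ> germ (at_right x) g"
proof -
  have "bij (germ (at_left x) g)" "bij (germ (at_left (re g x)) f)"
    using f g by (auto intro!: PSL2Z_inverse germ_props)
  then show ?thesis
    unfolding jump_def germ_comp[OF f g dirs_intros(1) dirs_intros(1) filterlim_re(1)[OF g]]
      germ_comp[OF f g dirs_intros(2) dirs_intros(2) filterlim_re(2)[OF g]]
    by (simp add: o_inv_distrib comp_assoc)
qed

lemma jump_eq_id_iff:
  assumes f: "f \<in> carrier Gtilde"
  shows "jump f x = id \<longleftrightarrow> germ (at_left x) f = germ (at_right x) f"
proof
  have b: "bij (germ (at_left x) f)" using f by (auto intro!: PSL2Z_inverse germ_props)
  show "jump f x = id" if "germ (at_left x) f = germ (at_right x) f"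
    unfolding jump_def that[symmetric] using b by (simp add: bij_is_inj)
  assume j: "jump f x = id"
  have "germ (at_left x) f \<circ> jump f x = germ (at_right x) f"
    unfolding jump_def using b by (simp add: o_assoc surj_iff[symmetric] bij_is_surj surj_iff[THEN iffD1])
  then show "germ (at_left x) f = germ (at_right x) f" unfolding j by simp
qed

lemma jump_cong:
  assumes "g \<in> carrier Gtilde" "u < x" "x < v" "\<And>y. u < y \<Longrightarrow> y < v \<Longrightarrow> f (Some y) = g (Some y)"
  shows "jump f x = jump g x"
proof -
  have l: "f (Some y) = g (Some y)" if "u < y" "y < x" for y using assms(4)[of y] that assms(3) by simp
  have r: "f (Some y) = g (Some y)" if "x < y" "y < v" for y using assms(4)[of y] that assms(2) by simp
  have "eventually (\<lambda>y. f (Some y) = g (Some y)) (at_left x)"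
    unfolding eventually_at_left_field using assms(2) l by blast
  moreover have "eventually (\<lambda>y. f (Some y) = g (Some y)) (at_right x)"
    unfolding eventually_at_right_field using assms(3) r by blast
  ultimately have "germ (at_left x) f = germ (at_left x) g" "germ (at_right x) f = germ (at_right x) g"
    using assms(1) by (auto intro!: germ_cong)
  then show ?thesis unfolding jump_def by (simp only:)
qed

lemma finite_frontier_interval:
  fixes I :: "real set"
  assumes I: "is_interval I"
  shows "finite (frontier I)"
proof (rule ccontr)
  assume "infinite (frontier I)"
  \<comment> \<open>Of three points of the boundary, the middle one would be an interior point.\<close>
  then obtain A where A: "A \<subseteq> frontier I" "finite A" "card A = 3" using infinite_arbitrarily_large by blast
  then obtain x y z where xyz: "A = {x, y, z}" "x \<noteq> y" "x \<noteq> z" "y \<noteq> z" by (auto simp: card_3_iff)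
  have no: False if uvw: "u < v" "v < w" "u \<in> A" "v \<in> A" "w \<in> A" for u v w
  proof -
    have "u \<in> closure I" "v \<notin> interior I" "w \<in> closure I" using uvw A(1) by (auto simp: frontier_def)
    obtain p where p: "p \<in> I" "dist p u < v - u" using \<open>u \<in> closure I\<close> uvw(1) unfolding closure_approachable by (meson diff_gt_0_iff_gt)
    obtain q where q: "q \<in> I" "dist q w < w - v" using \<open>w \<in> closure I\<close> uvw(2) unfolding closure_approachable by (meson diff_gt_0_iff_gt)
    have "p < v" "v < q" using p(2) q(2) by (auto simp: dist_real_def)
    have "{p<..<q} \<subseteq> I" using is_intervalD[OF I p(1) q(1)] by auto
    then have "v \<in> interior I" using \<open>p < v\<close> \<open>v < q\<close> by (intro interiorI[of "{p<..<q}"]) auto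
    then show False using \<open>v \<notin> interior I\<close> by contradiction
  qed
  consider "x < y" "y < z" | "x < z" "z < y" | "y < x" "x < z" | "y < z" "z < x" | "z < x" "x < y" | "z < y" "y < x"
    using xyz by linarith
  then show False by cases (use no xyz(1) in auto)
qed

text \<open>In the interior of a piece there is no jump, and an interval has at most two boundary
  points.\<close>

lemma finite_jumps:
  assumes f: "f \<in> carrier Gtilde"
  shows "finite {x. jump f x \<noteq> id}"
proof -
  obtain \<I> where "interval_pieces f \<I>" using GtildeD(3)[OF f] by blast
  then have I: "finite \<I>" "\<Union>\<I> = UNIV" "\<And>I. I \<in> \<I> \<Longrightarrow> is_interval I"
     "\<And>I. I \<in> \<I> \<Longrightarrow> \<exists>m\<in>PSL2Z. \<forall>y\<in>I. f (Some y) = m (Some y)"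
    unfolding interval_pieces_def by blast+
  have "jump f x = id" if x: "x \<notin> (\<Union>I\<in>\<I>. frontier I)" for x
  proof -
    obtain K where K: "K \<in> \<I>" "x \<in> K" using I(2) by blast
    then have "x \<in> interior K" using x closure_subset[of K] by (auto simp: frontier_def)
    then obtain e where e: "e > 0" "ball x e \<subseteq> K" unfolding mem_interior by blast
    obtain m where m: "m \<in> PSL2Z" "\<forall>y\<in>K. f (Some y) = m (Some y)" using I(4)[OF K(1)] by blast
    have in_K: "y \<in> K" if "x - e < y" "y < x + e" for y
      using e(2) that by (auto simp: dist_real_def subset_iff)
    have "eventually (\<lambda>y. f (Some y) = m (Some y)) (at_left x)"
      unfolding eventually_at_left_field using in_K m(2) e(1) by (intro exI[of _ "x - e"]) auto
    moreover have "eventually (\<lambda>y. f (Some y) = m (Some y)) (at_right x)"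
      unfolding eventually_at_right_field using in_K m(2) e(1) by (intro exI[of _ "x + e"]) auto
    ultimately have "germ (at_left x) f = m" "germ (at_right x) f = m" using m(1) by (auto intro!: germ_eqI)
    then show ?thesis using jump_eq_id_iff[OF f] by simp
  qed
  then have "{x. jump f x \<noteq> id} \<subseteq> (\<Union>I\<in>\<I>. frontier I)" by blast
  moreover have "finite (\<Union>I\<in>\<I>. frontier I)" using I(1,3) finite_frontier_interval by blast
  ultimately show ?thesis by (rule finite_subset)
qed

section \<open>Germs at a common fixed point\<close>

text \<open>A homomorphism to the reals with discrete image has cyclic image: a generator \<open>s\<close> is an
  element with the least positive value, and division with remainder moves every other
  element into the kernel. The homomorphism is a relation, so that values can be read off
  from any matrix that represents a germ.\<close>

lemma (in group) cyclic_modulo_kernel: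
  fixes R :: "'a \<Rightarrow> real \<Rightarrow> bool"
  assumes H: "subgroup H G"
    and ex: "\<And>g. g \<in> H \<Longrightarrow> \<exists>r. R g r"
    and add: "\<And>g h r t. g \<in> H \<Longrightarrow> h \<in> H \<Longrightarrow> R g r \<Longrightarrow> R h t \<Longrightarrow> R (g \<otimes> h) (r + t)"
    and one: "\<And>r. R \<one> r \<Longrightarrow> r = 0"
    and e: "e > 0" "\<And>g r. g \<in> H \<Longrightarrow> R g r \<Longrightarrow> r > 0 \<Longrightarrow> r \<ge> e"
  shows "\<exists>s\<in>H. \<forall>g\<in>H. \<exists>j::int. R (inv (s [^] j) \<otimes> g) 0"
proof -
  interpret H: subgroup H G by (rule H)
  have R_inv: "R (inv g) (- r)" if g: "g \<in> H" "R g r" for g r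
  proof -
    obtain t where t: "R (inv g) t" using ex[of "inv g"] g(1) by auto
    have "R (g \<otimes> inv g) (r + t)" using add[OF g(1) H.m_inv_closed[OF g(1)] g(2) t] .
    then have "r + t = 0" using one g(1) by simp
    then have "t = - r" by simp
    with t show ?thesis by simp
  qed
  have R_one: "R \<one> 0" using ex[of \<one>] one by auto
  show ?thesis
  proof (cases "\<exists>g\<in>H. \<exists>r>0. R g r")
    case False
    have "R (inv (\<one> [^] (0::int)) \<otimes> g) 0" if g: "g \<in> H" for g
    proof -
      obtain r where r: "R g r" using ex[OF g] by blast
      have "\<not> r > 0" using False g r by blast
      moreover have "\<not> - r > 0" using False R_inv[OF g r] g by blast
      ultimately have "r = 0" by simp
      with r g show ?thesis by simp
    qed
    then show ?thesis using H.one_closed by blast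
  next
    case True
    define P where "P = {r. r > 0 \<and> (\<exists>g\<in>H. R g r)}"
    have P: "P \<noteq> {}" "bdd_below P" using True by (auto simp: P_def intro!: bdd_belowI[of _ 0])
    \<comment> \<open>Two values that are closer than \<open>e\<close> coincide, so a value near the infimum is the minimum.\<close>
    obtain r where r: "r \<in> P" "r < Inf P + e" using cInf_lessD[of P "Inf P + e"] P e(1) by auto
    then obtain s where s: "s \<in> H" "R s r" "r > 0" by (auto simp: P_def)
    have min: "r \<le> t" if t: "t \<in> P" for t
    proof (rule ccontr)
      assume "\<not> r \<le> t"
      obtain h where h: "h \<in> H" "R h t" using t by (auto simp: P_def)
      have "R (s \<otimes> inv h) (r + - t)" using add[OF s(1) H.m_inv_closed[OF h(1)] s(2) R_inv[OF h]] .
      moreover have "r + - t > 0" using \<open>\<not> r \<le> t\<close> by simp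
      ultimately have "e \<le> r + - t" using s(1) h(1) by (intro e(2)[of "s \<otimes> inv h"] H.m_closed H.m_inv_closed)
      moreover have "Inf P \<le> t" using t P(2) by (rule cInf_lower)
      ultimately show False using r(2) by simp
    qed
    have nat_pow_H: "s [^] n \<in> H" for n :: nat
    proof (induction n)
      case (Suc n)
      then show ?case using H.m_closed[OF Suc s(1)] by simp
    qed simp
    have pow_nat: "R (s [^] n) (real n * r)" for n :: nat
    proof (induction n)
      case 0
      show ?case using R_one by simp
    next
      case (Suc n)
      have "real n * r + r = real (Suc n) * r" by (simp add: distrib_right)
      then show ?case using add[OF nat_pow_H s(1) Suc s(2)] by simp
    qed
    have pow: "R (s [^] j) (of_int j * r)" for j :: int
    proof (cases j rule: int_cases2)
      case (nonneg n)
      have "s [^] j = s [^] n" unfolding nonneg by (rule int_pow_int)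
      then show ?thesis using pow_nat[of n] nonneg by simp
    next
      case (nonpos n)
      have "s [^] j = inv (s [^] n)" unfolding nonpos using s(1) by (simp add: int_pow_neg int_pow_int)
      then show ?thesis using R_inv[OF nat_pow_H pow_nat, of n] nonpos by simp
    qed
    have "\<exists>j::int. R (inv (s [^] j) \<otimes> g) 0" if g: "g \<in> H" for g
    proof -
      obtain t where t: "R g t" using ex[OF g] by blast
      define j where "j = \<lfloor>t / r\<rfloor>"
      have sj: "s [^] j \<in> H" by (rule subgroup_int_pow_closed[OF H s(1)])
      have R: "R (inv (s [^] j) \<otimes> g) (- (of_int j * r) + t)"
        using add[OF H.m_inv_closed[OF sj] g R_inv[OF sj pow] t] .
      have "of_int j \<le> t / r" "t / r < of_int j + 1" unfolding j_def by linarith+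
      then have "of_int j * r \<le> t" "t < (of_int j + 1) * r" using s(3) by (simp_all add: field_simps)
      then have b: "0 \<le> - (of_int j * r) + t" "- (of_int j * r) + t < r" by (simp_all add: distrib_right)
      have "\<not> 0 < - (of_int j * r) + t"
      proof
        assume "0 < - (of_int j * r) + t"
        then have "- (of_int j * r) + t \<in> P" unfolding P_def using R sj g by auto
        from min[OF this] show False using b(2) by simp
      qed
      then have "- (of_int j * r) + t = 0" using b(1) by simp
      then show ?thesis using R by (intro exI[of _ j]) simp
    qed
    then show ?thesis using s(1) by blast
  qed
qed

lemma proj_moebius_eq_id:
  fixes a b c d :: real
  assumes "proj_moebius a b c d = id" "a * d - b * c = 1"
  shows "c = 0" "b = 0" "a = d" "d \<noteq> 0"
proof -
  show c: "c = 0" using fun_cong[OF assms(1), of None] by (simp split: if_splits)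
  then show d: "d \<noteq> 0" using assms(2) by auto
  show b: "b = 0" using fun_cong[OF assms(1), of "Some 0"] c d by (simp add: moebius_def)
  show "a = d" using fun_cong[OF assms(1), of "Some 1"] b c d by (simp add: moebius_def)
qed

lemma germ_id: "F \<in> dirs \<Longrightarrow> germ F id = id"
  by (rule germ_eqI[OF _ PSL2Z_id]) simp_all

lemma eventually_eq_of_germ_quotient:
  assumes s: "s \<in> carrier Gtilde" and h: "h \<in> carrier Gtilde" and F: "F \<in> dirs"
    and g: "germ F (inv\<^bsub>Gtilde\<^esub> s \<otimes>\<^bsub>Gtilde\<^esub> h) = id"
  shows "eventually (\<lambda>y. h (Some y) = s (Some y)) F"
proof -
  interpret group Gtilde by (rule group_Gtilde)
  let ?q = "inv\<^bsub>Gtilde\<^esub> s \<otimes>\<^bsub>Gtilde\<^esub> h"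
  have "?q \<in> carrier Gtilde" using s h by simp
  then have ev: "eventually (\<lambda>y. ?q (Some y) = Some y) F" using germ_props(2)[of ?q F] F g by simp
  have "s \<circ> ?q = h" using s h unfolding Gtilde_simps(1)[symmetric] by (simp add: m_assoc[symmetric])
  then have sq: "s (?q z) = h z" for z by (metis comp_apply)
  from ev show ?thesis
  proof eventually_elim
    case (elim y)
    show ?case using sq[of "Some y"] unfolding elim by (rule sym)
  qed
qed

text \<open>If the lower left entry were not zero, the map would have a finite limit at minus
  infinity.\<close>

lemma germ_at_bot_translation:
  assumes h: "h \<in> carrier Gtilde"
  shows "\<exists>n::int. germ at_bot h = proj_moebius 1 (of_int n) 0 1"
proof -
  have "germ at_bot h \<in> PSL2Z" using h by (intro germ_props) simp_all
  then obtain a b c d where m: "a * d - b * c = 1" "germ at_bot h = proj_moebius (of_int a) (of_int b) (of_int c) (of_int d)"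
    by (rule PSL2Z_cases)
  have det: "of_int a * of_int d - of_int b * of_int c = (1::real)" using m(1) by (rule of_int_det)
  have ev: "eventually (\<lambda>y. h (Some y) = proj_moebius (of_int a) (of_int b) (of_int c) (of_int d) (Some y)) at_bot"
    using germ_props(2)[OF h, of at_bot] m(2) by simp
  have "c = 0"
  proof (rule ccontr)
    assume c: "c \<noteq> 0"
    \<comment> \<open>The limit of the map at minus infinity.\<close>
    define L where "L = of_int a / (of_int c :: real)"
    have "eventually (\<lambda>y. re h y \<le> L - 2) at_bot"
      using filterlim_re(3)[OF h] unfolding filterlim_at_bot by blast
    moreover have "eventually (\<lambda>y. y \<le> - \<bar>of_int d :: real\<bar> - 1) at_bot" by (rule eventually_le_at_bot)
    ultimately have "eventually (\<lambda>y::real. False) at_bot" using ev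
    proof eventually_elim
      case (elim y)
      have "\<bar>of_int c :: real\<bar> \<ge> 1" using c by (simp add: of_int_abs[symmetric] del: of_int_abs)
      then have "\<bar>of_int c * y\<bar> \<ge> \<bar>y\<bar>" by (simp add: abs_mult mult_le_cancel_right1)
      then have den: "\<bar>of_int c * y + of_int d\<bar> \<ge> 1" using elim(2) by linarith
      then have nz: "of_int c * y + of_int d \<noteq> 0" by auto
      then have r: "re h y = moebius (of_int a) (of_int b) (of_int c) (of_int d) y"
        using elim(3) by (simp add: re_def)
      have "L - re h y = 1 / (of_int c * (of_int c * y + of_int d))"
      proof -
        have "L - re h y = (of_int a * (of_int c * y + of_int d) - (of_int a * y + of_int b) * of_int c) / (of_int c * (of_int c * y + of_int d))"
          unfolding L_def r moebius_def using c nz by (simp add: diff_frac_eq mult.commute)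
        also have "of_int a * (of_int c * y + of_int d) - (of_int a * y + of_int b) * of_int c = (1::real)"
          using det by algebra
        finally show ?thesis .
      qed
      moreover have "\<bar>of_int c * (of_int c * y + of_int d)\<bar> \<ge> 1"
        using mult_mono[OF \<open>\<bar>of_int c :: real\<bar> \<ge> 1\<close> den] by (simp only: abs_mult mult_1)
      then have "\<bar>1 / (of_int c * (of_int c * y + of_int d))\<bar> \<le> 1" unfolding abs_divide abs_one by (subst divide_le_eq_1) linarith
      ultimately show False using elim(1) by linarith
    qed
    then show False by simp
  qed
  then have "a * d = 1" using m(1) by simp
  then have "a = 1 \<and> d = 1 \<or> a = -1 \<and> d = -1" by (rule zmult_eq_1_iff[THEN iffD1])
  then show ?thesis
  proof
    assume "a = 1 \<and> d = 1"
    then show ?thesis using m(2) \<open>c = 0\<close> by (intro exI[of _ b]) simp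
  next
    assume ad: "a = -1 \<and> d = -1"
    have "proj_moebius (- 1) (of_int b) 0 (- 1) z = proj_moebius 1 (of_int (- b)) 0 1 z" for z
      by (cases z) (simp_all add: moebius_def)
    then have "proj_moebius (- 1) (of_int b) 0 (- 1) = proj_moebius 1 (of_int (- b)) 0 1" by (rule ext)
    then show ?thesis using m(2) \<open>c = 0\<close> ad by (intro exI[of _ "- b"]) simp
  qed
qed

text \<open>The translation length is an injective homomorphism from the germs to the integers.\<close>

lemma germs_cyclic_at_bot:
  assumes H: "subgroup H Gtilde"
  shows "\<exists>s\<in>H. \<forall>h\<in>H. \<exists>j::int. eventually (\<lambda>y. h (Some y) = (s [^]\<^bsub>Gtilde\<^esub> j) (Some y)) at_bot"
proof -
  interpret group Gtilde by (rule group_Gtilde)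
  interpret H: subgroup H Gtilde by (rule H)
  define R where "R h r \<longleftrightarrow> (\<exists>n::int. r = of_int n \<and> germ at_bot h = proj_moebius 1 (of_int n) 0 1)" for h and r :: real
  have "\<exists>s\<in>H. \<forall>g\<in>H. \<exists>j::int. R (inv\<^bsub>Gtilde\<^esub> (s [^]\<^bsub>Gtilde\<^esub> j) \<otimes>\<^bsub>Gtilde\<^esub> g) 0"
  proof (rule cyclic_modulo_kernel[OF H, where e=1])
    fix g assume "g \<in> H"
    then obtain n :: int where "germ at_bot g = proj_moebius 1 (of_int n) 0 1"
      using germ_at_bot_translation[of g] by auto
    then have "R g (of_int n)" unfolding R_def by (intro exI[of _ n] conjI refl)
    then show "\<exists>r. R g r" by (rule exI)
  next
    fix g h r t assume gh: "g \<in> H" "h \<in> H" "R g r" "R h t"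
    obtain n :: int where n: "r = of_int n" "germ at_bot g = proj_moebius 1 (of_int n) 0 1" using gh(3) unfolding R_def by (elim exE conjE)
    obtain k :: int where k: "t = of_int k" "germ at_bot h = proj_moebius 1 (of_int k) 0 1" using gh(4) unfolding R_def by (elim exE conjE)
    have "germ at_bot (g \<circ> h) = germ at_bot g \<circ> germ at_bot h"
      using gh by (intro germ_comp filterlim_re(3)) auto
    also have "\<dots> = proj_moebius 1 (of_int (n + k)) 0 1"
      unfolding n(2) k(2) by (rule ext) (simp add: proj_moebius_comp add.commute)
    finally show "R (g \<otimes>\<^bsub>Gtilde\<^esub> h) (r + t)" unfolding R_def Gtilde_simps by (intro exI[of _ "n + k"]) (simp add: n k)
  next
    fix r assume "R \<one>\<^bsub>Gtilde\<^esub> r"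
    then obtain n :: int where n: "r = of_int n" "germ at_bot id = proj_moebius 1 (of_int n) 0 1"
      unfolding R_def Gtilde_simps by (elim exE conjE)
    then have "proj_moebius 1 (of_int n) 0 1 = id" using germ_id[of at_bot] by simp
    with n(1) show "r = 0" using proj_moebius_eq_id(2)[of 1 "of_int n" 0 1] by simp
  next
    fix g r assume "g \<in> H" "R g r" "r > 0"
    then show "1 \<le> r" unfolding R_def by auto
  qed simp
  then obtain s where s: "s \<in> H" "\<And>g. g \<in> H \<Longrightarrow> \<exists>j::int. R (inv\<^bsub>Gtilde\<^esub> (s [^]\<^bsub>Gtilde\<^esub> j) \<otimes>\<^bsub>Gtilde\<^esub> g) 0" by blast
  have "\<exists>j::int. eventually (\<lambda>y. h (Some y) = (s [^]\<^bsub>Gtilde\<^esub> j) (Some y)) at_bot" if h: "h \<in> H" for h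
  proof -
    obtain j :: int where "R (inv\<^bsub>Gtilde\<^esub> (s [^]\<^bsub>Gtilde\<^esub> j) \<otimes>\<^bsub>Gtilde\<^esub> h) 0" using s(2)[OF h] by blast
    then have "germ at_bot (inv\<^bsub>Gtilde\<^esub> (s [^]\<^bsub>Gtilde\<^esub> j) \<otimes>\<^bsub>Gtilde\<^esub> h) = id"
      unfolding R_def by (auto simp: proj_moebius_id)
    then have "eventually (\<lambda>y. h (Some y) = (s [^]\<^bsub>Gtilde\<^esub> j) (Some y)) at_bot"
      using s(1) h by (intro eventually_eq_of_germ_quotient) auto
    then show ?thesis by blast
  qed
  then show ?thesis using s(1) by blast
qed

text \<open>An integral matrix for the right germ of \<open>h\<close> at the fixed point \<open>p\<close>. The vector \<open>(p, 1)\<close>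
  is an eigenvector with eigenvalue \<open>c p + d\<close>, and the sign of the matrix is chosen such
  that this eigenvalue is positive.\<close>

definition stab_matrix :: "real \<Rightarrow> (real option \<Rightarrow> real option) \<Rightarrow> int \<Rightarrow> int \<Rightarrow> int \<Rightarrow> int \<Rightarrow> bool" where
  "stab_matrix p h a b c d \<longleftrightarrow> a * d - b * c = 1 \<and> of_int a * p + of_int b = p * (of_int c * p + of_int d) \<and>
     of_int c * p + of_int d > 0 \<and> germ (at_right p) h = proj_moebius (of_int a) (of_int b) (of_int c) (of_int d)"

lemma stab_matrix_exists:
  assumes h: "h \<in> carrier Gtilde" and fix_p: "re h p = p"
  shows "\<exists>a b c d. stab_matrix p h a b c d"
proof -
  have "germ (at_right p) h \<in> PSL2Z" using h by (intro germ_props) simp_all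
  then obtain a b c d where m: "a * d - b * c = 1" "germ (at_right p) h = proj_moebius (of_int a) (of_int b) (of_int c) (of_int d)"
    by (rule PSL2Z_cases)
  have ev: "eventually (\<lambda>y. h (Some y) = proj_moebius (of_int a) (of_int b) (of_int c) (of_int d) (Some y)) (at_right p)"
    using germ_props(2)[OF h, of "at_right p"] m(2) by simp
  have ev': "eventually (\<lambda>y. re h y * (of_int c * y + of_int d) = of_int a * y + of_int b) (at_right p)"
    using ev
  proof eventually_elim
    case (elim y)
    then have "proj_moebius (of_int a) (of_int b) (of_int c) (of_int d) (Some y) = Some (re h y)" by (simp add: Gtilde_Some[OF h])
    then have "of_int c * y + of_int d \<noteq> 0" "re h y = moebius (of_int a) (of_int b) (of_int c) (of_int d) y"
      by (simp_all split: if_splits)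
    then show ?case by (simp add: moebius_def)
  qed
  have lim_re: "(re h \<longlongrightarrow> p) (at_right p)"
    using filterlim_re(2)[OF h, of p] fix_p by (simp add: filterlim_at)
  have "((\<lambda>y. re h y * (of_int c * y + of_int d)) \<longlongrightarrow> p * (of_int c * p + of_int d)) (at_right p)"
    by (intro tendsto_intros lim_re)
  moreover have "((\<lambda>y. re h y * (of_int c * y + of_int d)) \<longlongrightarrow> of_int a * p + of_int b) (at_right p)"
  proof (rule Lim_transform_eventually[of "\<lambda>y. of_int a * y + of_int b"])
    show "((\<lambda>y. of_int a * y + of_int b) \<longlongrightarrow> of_int a * p + of_int b) (at_right p)" by (intro tendsto_intros)
    show "eventually (\<lambda>y. of_int a * y + of_int b = re h y * (of_int c * y + of_int d)) (at_right p)"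
      using ev' by eventually_elim simp
  qed
  ultimately have eq: "of_int a * p + of_int b = p * (of_int c * p + of_int d)"
    by (intro tendsto_unique[of "at_right p"]) simp_all
  have nz: "of_int c * p + of_int d \<noteq> 0"
  proof
    assume 0: "of_int c * p + of_int d = 0"
    with eq have "of_int a * p + of_int b = 0" by simp
    with 0 of_int_det[OF m(1)] have "1 = (0::real)" by algebra
    then show False by simp
  qed
  show ?thesis
  proof (cases "of_int c * p + of_int d > 0")
    case True
    then show ?thesis unfolding stab_matrix_def using m eq by blast
  next
    \<comment> \<open>The matrix and its negative define the same map.\<close>
    case False
    have "proj_moebius (of_int a) (of_int b) (of_int c) (of_int d) z = proj_moebius (of_int (- a)) (of_int (- b)) (of_int (- c)) (of_int (- d)) z" for z
    proof (cases z)
      case (Some x)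
      have 1: "- (of_int a * x) - of_int b = - (of_int a * x + of_int b)" "- (of_int c * x) - of_int d = - (of_int c * x + of_int d)" by simp_all
      show ?thesis unfolding Some by (simp add: moebius_def 1 del: minus_add_distrib)
    qed simp
    then have "germ (at_right p) h = proj_moebius (of_int (- a)) (of_int (- b)) (of_int (- c)) (of_int (- d))"
      unfolding m(2) by (rule ext)
    moreover have "(- a) * (- d) - (- b) * (- c) = 1" using m(1) by simp
    moreover have "of_int (- a) * p + of_int (- b) = p * (of_int (- c) * p + of_int (- d))"
    proof -
      have "of_int (- a) * p + of_int (- b) = - (of_int a * p + of_int b)" by simp
      also have "\<dots> = p * (of_int (- c) * p + of_int (- d))" unfolding eq by (simp add: algebra_simps)
      finally show ?thesis .
    qed
    moreover have "of_int (- c) * p + of_int (- d) > 0" using False nz by simp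
    ultimately show ?thesis unfolding stab_matrix_def by blast
  qed
qed

text \<open>The left factor is the trace minus the eigenvalue \<open>c p + d\<close>.\<close>

lemma stab_matrix_other_eigenvalue:
  assumes "stab_matrix p h a b c d"
  shows "(of_int a - of_int c * p) * (of_int c * p + of_int d) = 1"
proof -
  have "of_int a * of_int d - of_int b * of_int c = (1::real)" "of_int a * p + of_int b = p * (of_int c * p + of_int d)"
    using assms of_int_det[of a d b c] by (simp_all add: stab_matrix_def)
  then show ?thesis by algebra
qed

text \<open>The common eigenvector makes the eigenvalue multiplicative.\<close>

lemma stab_matrix_comp:
  assumes g: "g \<in> carrier Gtilde" and h: "h \<in> carrier Gtilde" "re h p = p"
    and sg: "stab_matrix p g a b c d" and sh: "stab_matrix p h a' b' c' d'"
  shows "stab_matrix p (g \<circ> h) (a * a' + b * c') (a * b' + b * d') (c * a' + d * c') (c * b' + d * d')"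
    and "of_int (c * a' + d * c') * p + of_int (c * b' + d * d') = (of_int c * p + of_int d) * (of_int c' * p + of_int d')"
proof -
  have 1: "a * d - b * c = 1" "of_int a * p + of_int b = p * (of_int c * p + of_int d)" "of_int c * p + of_int d > 0"
    "germ (at_right p) g = proj_moebius (of_int a) (of_int b) (of_int c) (of_int d)"
    using sg unfolding stab_matrix_def by blast+
  have 2: "a' * d' - b' * c' = 1" "of_int a' * p + of_int b' = p * (of_int c' * p + of_int d')" "of_int c' * p + of_int d' > 0"
    "germ (at_right p) h = proj_moebius (of_int a') (of_int b') (of_int c') (of_int d')"
    using sh unfolding stab_matrix_def by blast+
  have "of_int (c * a' + d * c') * p + of_int (c * b' + d * d') = of_int c * (of_int a' * p + of_int b') + of_int d * (of_int c' * p + of_int d')"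
    by (simp add: algebra_simps)
  also have "\<dots> = (of_int c * p + of_int d) * (of_int c' * p + of_int d')" unfolding 2(2) by (simp add: algebra_simps)
  finally show lam: "of_int (c * a' + d * c') * p + of_int (c * b' + d * d') = (of_int c * p + of_int d) * (of_int c' * p + of_int d')" .
  have "of_int (a * a' + b * c') * p + of_int (a * b' + b * d') = of_int a * (of_int a' * p + of_int b') + of_int b * (of_int c' * p + of_int d')"
    by (simp add: algebra_simps)
  also have "\<dots> = (of_int a * p + of_int b) * (of_int c' * p + of_int d')" unfolding 2(2) by (simp add: algebra_simps)
  finally have fp: "of_int (a * a' + b * c') * p + of_int (a * b' + b * d') = p * (of_int (c * a' + d * c') * p + of_int (c * b' + d * d'))"
    unfolding lam 1(2) by simp
  have det: "(a * a' + b * c') * (c * b' + d * d') - (a * b' + b * d') * (c * a' + d * c') = 1"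
  proof -
    have "(a * a' + b * c') * (c * b' + d * d') - (a * b' + b * d') * (c * a' + d * c') = (a * d - b * c) * (a' * d' - b' * c')" by algebra
    then show ?thesis using 1(1) 2(1) by simp
  qed
  have "filterlim (re h) (at_right p) (at_right p)" using filterlim_re(2)[OF h(1), of p] h(2) by simp
  then have "germ (at_right p) (g \<circ> h) = germ (at_right p) g \<circ> germ (at_right p) h"
    using g h(1) by (intro germ_comp) simp_all
  also have "\<dots> = proj_moebius (of_int (a * a' + b * c')) (of_int (a * b' + b * d')) (of_int (c * a' + d * c')) (of_int (c * b' + d * d'))"
    unfolding 1(4) 2(4) by (rule ext) (simp add: proj_moebius_comp[OF of_int_det[OF 1(1)] of_int_det[OF 2(1)]])
  finally show "stab_matrix p (g \<circ> h) (a * a' + b * c') (a * b' + b * d') (c * a' + d * c') (c * b' + d * d')"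
    unfolding stab_matrix_def using det fp 1(3) 2(3) lam by (simp del: of_int_add of_int_mult)
qed

lemma stab_matrix_id:
  assumes "stab_matrix p id a b c d"
  shows "c = 0" "d = 1"
proof -
  have m: "a * d - b * c = 1" "of_int c * p + of_int d > 0" "proj_moebius (of_int a) (of_int b) (of_int c) (of_int d) = id"
    using assms germ_id[of "at_right p"] by (simp_all add: stab_matrix_def)
  note z = proj_moebius_eq_id[OF m(3) of_int_det[OF m(1)]]
  show c: "c = 0" using z(1) by simp
  have "a = d" using z(3) by simp
  then have "d * d = 1" using m(1) c by simp
  moreover have "d > 0" using m(2) c by simp
  ultimately show "d = 1" by (simp add: zmult_eq_1_iff)
qed

lemma stab_matrix_unipotent:
  assumes "stab_matrix p h a b c d" "of_int c * p + of_int d = 1" "c = 0"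
  shows "germ (at_right p) h = id"
proof -
  have "d = 1" using assms(2,3) by simp
  moreover have "a * d - b * c = 1" "of_int a * p + of_int b = p * (of_int c * p + of_int d)"
    "germ (at_right p) h = proj_moebius (of_int a) (of_int b) (of_int c) (of_int d)"
    using assms(1) by (simp_all add: stab_matrix_def)
  ultimately show ?thesis using assms(3) by (simp add: proj_moebius_id)
qed

text \<open>Since \<open>x\<close> is integral over the integers, and so is its inverse, it is an integral unit.\<close>

lemma rational_unit_eq_one:
  fixes x :: real
  assumes "x \<in> \<rat>" "x > 0" "x * x + 1 = of_int t * x"
  shows "x = 1"
proof -
  obtain m n :: nat where mn: "n \<noteq> 0" "\<bar>x\<bar> = real m / real n" "coprime m n"
    using Rats_abs_nat_div_natE[OF assms(1)] by blast
  then have x: "x * real n = real m" using assms(2) by (simp add: field_simps)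
  have "(x * real n) * (x * real n) + real n * real n = of_int t * (x * real n) * real n"
    using arg_cong[OF assms(3), of "\<lambda>u. u * (real n * real n)"] by (simp add: algebra_simps)
  then have "real m * real m + real n * real n = of_int t * real m * real n" unfolding x .
  then have "of_int (int m * int m + int n * int n) = (of_int (t * int m * int n) :: real)" by simp
  then have eq: "int m * int m + int n * int n = t * int m * int n" by (simp only: of_int_eq_iff)
  have cop: "coprime (int m) (int n)" using mn(3) by simp
  have "int n dvd int m * int m"
  proof -
    have "int m * int m = int n * (t * int m - int n)" using eq by (simp add: algebra_simps)
    then show ?thesis by simp
  qed
  then have "int n dvd 1" using cop by (metis coprime_commute coprime_dvd_mult_left_iff coprime_imp_coprime dvd_refl is_unit_right_imp_coprime coprime_common_divisor)
  moreover have "int m dvd int n * int n"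
  proof -
    have "int n * int n = int m * (t * int n - int m)" using eq by (simp add: algebra_simps)
    then show ?thesis by simp
  qed
  then have "int m dvd 1" using cop by (metis coprime_commute coprime_dvd_mult_left_iff coprime_imp_coprime dvd_refl is_unit_right_imp_coprime coprime_common_divisor)
  ultimately have "n = 1" "m = 1" by simp_all
  then show ?thesis using x by simp
qed

text \<open>If every eigenvalue \<open>c p + d\<close> is one, the lower left entry \<open>c\<close> is an integral
  homomorphism. Otherwise the logarithm of the eigenvalue is a homomorphism. It has discrete
  image, because an eigenvalue \<open>l > 1\<close> has an integral trace \<open>l + 1 / l > 2\<close>, which is
  therefore at least three. It is injective: a nontrivial germ with eigenvalue one would
  make \<open>p\<close> rational; then all eigenvalues are rational units, hence one.\<close>

lemma germs_cyclic_at_right: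
  assumes H: "subgroup H Gtilde" and fix_p: "\<And>h. h \<in> H \<Longrightarrow> re h p = p"
  shows "\<exists>s\<in>H. \<forall>h\<in>H. \<exists>j::int. eventually (\<lambda>y. h (Some y) = (s [^]\<^bsub>Gtilde\<^esub> j) (Some y)) (at_right p)"
proof -
  interpret group Gtilde by (rule group_Gtilde)
  interpret H: subgroup H Gtilde by (rule H)
  have ex: "\<exists>a b c d. stab_matrix p h a b c d" if "h \<in> H" for h
    using that fix_p by (intro stab_matrix_exists) auto
  have quot: "inv\<^bsub>Gtilde\<^esub> (s [^]\<^bsub>Gtilde\<^esub> j) \<otimes>\<^bsub>Gtilde\<^esub> g \<in> H" if "s \<in> H" "g \<in> H" for s g and j :: int
    using that subgroup_int_pow_closed[OF H that(1)] by simp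
  \<comment> \<open>If the kernel of a homomorphism consists of trivial germs, cyclic values mean cyclic
      germs.\<close>
  have conclude: "\<exists>s\<in>H. \<forall>g\<in>H. \<exists>j::int. germ (at_right p) (inv\<^bsub>Gtilde\<^esub> (s [^]\<^bsub>Gtilde\<^esub> j) \<otimes>\<^bsub>Gtilde\<^esub> g) = id"
    if R1: "\<exists>s\<in>H. \<forall>g\<in>H. \<exists>j::int. R (inv\<^bsub>Gtilde\<^esub> (s [^]\<^bsub>Gtilde\<^esub> j) \<otimes>\<^bsub>Gtilde\<^esub> g) 0"
      and R2: "\<And>h. h \<in> H \<Longrightarrow> R h 0 \<Longrightarrow> germ (at_right p) h = id" for R :: "_ \<Rightarrow> real \<Rightarrow> bool"
  proof -
    from R1 obtain s where s: "s \<in> H" "\<forall>g\<in>H. \<exists>j::int. R (inv\<^bsub>Gtilde\<^esub> (s [^]\<^bsub>Gtilde\<^esub> j) \<otimes>\<^bsub>Gtilde\<^esub> g) 0" by (elim bexE)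
    show ?thesis
    proof (intro bexI[OF _ s(1)] ballI)
      fix g assume g: "g \<in> H"
      obtain j :: int where "R (inv\<^bsub>Gtilde\<^esub> (s [^]\<^bsub>Gtilde\<^esub> j) \<otimes>\<^bsub>Gtilde\<^esub> g) 0" using bspec[OF s(2) g] by (elim exE)
      from R2[OF quot[OF s(1) g] this] show "\<exists>j::int. germ (at_right p) (inv\<^bsub>Gtilde\<^esub> (s [^]\<^bsub>Gtilde\<^esub> j) \<otimes>\<^bsub>Gtilde\<^esub> g) = id" by (rule exI)
    qed
  qed
  have "\<exists>s\<in>H. \<forall>g\<in>H. \<exists>j::int. germ (at_right p) (inv\<^bsub>Gtilde\<^esub> (s [^]\<^bsub>Gtilde\<^esub> j) \<otimes>\<^bsub>Gtilde\<^esub> g) = id"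
  proof (cases "\<exists>h\<in>H. \<exists>a b c d. stab_matrix p h a b c d \<and> of_int c * p + of_int d \<noteq> 1")
    case False
    then have lam: "of_int c * p + of_int d = 1" if "h \<in> H" "stab_matrix p h a b c d" for h a b c d
      using that by metis
    \<comment> \<open>All germs are unipotent.\<close>
    define R where "R h r \<longleftrightarrow> (\<exists>a b c d. stab_matrix p h a b c d \<and> r = of_int c)" for h and r :: real
    have "\<exists>s\<in>H. \<forall>g\<in>H. \<exists>j::int. R (inv\<^bsub>Gtilde\<^esub> (s [^]\<^bsub>Gtilde\<^esub> j) \<otimes>\<^bsub>Gtilde\<^esub> g) 0"
    proof (rule cyclic_modulo_kernel[OF H, where e=1])
      fix g assume "g \<in> H"
      from ex[OF this] obtain a b c d where "stab_matrix p g a b c d" by (elim exE)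
      then show "\<exists>r. R g r" unfolding R_def by (intro exI conjI) (assumption, rule refl)
    next
      fix g h r t assume gh: "g \<in> H" "h \<in> H" "R g r" "R h t"
      obtain a b c d where 1: "stab_matrix p g a b c d" "r = of_int c" using gh(3) unfolding R_def by (elim exE conjE)
      obtain a' b' c' d' where 2: "stab_matrix p h a' b' c' d'" "t = of_int c'" using gh(4) unfolding R_def by (elim exE conjE)
      have 3: "stab_matrix p (g \<circ> h) (a * a' + b * c') (a * b' + b * d') (c * a' + d * c') (c * b' + d * d')"
        by (rule stab_matrix_comp[OF H.mem_carrier[OF gh(1)] H.mem_carrier[OF gh(2)] fix_p[OF gh(2)] 1(1) 2(1)])
      have d: "of_int d = 1 - of_int c * p" using lam[OF gh(1) 1(1)] by simp
      have a': "of_int a' = 1 + of_int c' * p"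
        using stab_matrix_other_eigenvalue[OF 2(1)] lam[OF gh(2) 2(1)] by simp
      have l: "of_int (c * a' + d * c') = r + t" by (simp add: d a' 1(2) 2(2) algebra_simps)
      show "R (g \<otimes>\<^bsub>Gtilde\<^esub> h) (r + t)" unfolding R_def Gtilde_simps
        by (intro exI conjI) (rule 3, rule l[symmetric])
    next
      fix r assume "R \<one>\<^bsub>Gtilde\<^esub> r"
      then obtain a b c d where *: "stab_matrix p id a b c d" "r = of_int c" unfolding R_def Gtilde_simps by (elim exE conjE)
      then show "r = 0" using stab_matrix_id(1)[OF *(1)] by simp
    next
      fix g r assume "g \<in> H" "R g r" "r > 0"
      then show "1 \<le> r" unfolding R_def by auto
    qed simp
    moreover have "germ (at_right p) h = id" if "h \<in> H" "R h 0" for h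
    proof -
      obtain a b c d where *: "stab_matrix p h a b c d" "0 = real_of_int c" using \<open>R h 0\<close> unfolding R_def by (elim exE conjE)
      then show ?thesis using stab_matrix_unipotent[OF *(1) lam[OF \<open>h \<in> H\<close> *(1)]] by simp
    qed
    ultimately show ?thesis by (rule conclude)
  next
    case True
    \<comment> \<open>Some germ \<open>h0\<close> is hyperbolic.\<close>
    then obtain h0 a0 b0 c0 d0 where h0: "h0 \<in> H" "stab_matrix p h0 a0 b0 c0 d0" "of_int c0 * p + of_int d0 \<noteq> 1" by (elim bexE exE conjE)
    define R where "R h r \<longleftrightarrow> (\<exists>a b c d. stab_matrix p h a b c d \<and> r = ln (of_int c * p + of_int d))" for h and r :: real
    have "\<exists>s\<in>H. \<forall>g\<in>H. \<exists>j::int. R (inv\<^bsub>Gtilde\<^esub> (s [^]\<^bsub>Gtilde\<^esub> j) \<otimes>\<^bsub>Gtilde\<^esub> g) 0"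
    proof (rule cyclic_modulo_kernel[OF H, where e="ln 2"])
      fix g assume "g \<in> H"
      from ex[OF this] obtain a b c d where "stab_matrix p g a b c d" by (elim exE)
      then show "\<exists>r. R g r" unfolding R_def by (intro exI conjI) (assumption, rule refl)
    next
      fix g h r t assume gh: "g \<in> H" "h \<in> H" "R g r" "R h t"
      obtain a b c d where 1: "stab_matrix p g a b c d" "r = ln (of_int c * p + of_int d)" using gh(3) unfolding R_def by (elim exE conjE)
      obtain a' b' c' d' where 2: "stab_matrix p h a' b' c' d'" "t = ln (of_int c' * p + of_int d')" using gh(4) unfolding R_def by (elim exE conjE)
      have 3: "stab_matrix p (g \<circ> h) (a * a' + b * c') (a * b' + b * d') (c * a' + d * c') (c * b' + d * d')"
        "of_int (c * a' + d * c') * p + of_int (c * b' + d * d') = (of_int c * p + of_int d) * (of_int c' * p + of_int d')"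
        by (rule stab_matrix_comp[OF H.mem_carrier[OF gh(1)] H.mem_carrier[OF gh(2)] fix_p[OF gh(2)] 1(1) 2(1)])+
      have "of_int c * p + of_int d > 0" "of_int c' * p + of_int d' > 0"
        using 1(1) 2(1) by (simp_all add: stab_matrix_def)
      then have l: "ln (of_int (c * a' + d * c') * p + of_int (c * b' + d * d')) = r + t"
        unfolding 3(2) 1(2) 2(2) by (rule ln_mult_pos)
      show "R (g \<otimes>\<^bsub>Gtilde\<^esub> h) (r + t)" unfolding R_def Gtilde_simps
        by (intro exI conjI) (rule 3(1), rule l[symmetric])
    next
      fix r assume "R \<one>\<^bsub>Gtilde\<^esub> r"
      then obtain a b c d where *: "stab_matrix p id a b c d" "r = ln (of_int c * p + of_int d)" unfolding R_def Gtilde_simps by (elim exE conjE)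
      then show "r = 0" using stab_matrix_id[OF *(1)] by simp
    next
      fix g r assume "g \<in> H" "R g r" "r > 0"
      then obtain a b c d where *: "stab_matrix p g a b c d" "r = ln (of_int c * p + of_int d)" unfolding R_def by (elim exE conjE)
      define l where "l = of_int c * p + of_int d"
      have l0: "l > 0" using *(1) by (simp add: stab_matrix_def l_def)
      have l1: "l > 1" using \<open>r > 0\<close> *(2) l0 by (simp add: l_def ln_gt_zero_iff)
      have other: "(of_int a - of_int c * p) * l = 1" using stab_matrix_other_eigenvalue[OF *(1)] by (simp add: l_def)
      have "l \<ge> 2"
      proof (rule ccontr)
        assume "\<not> l \<ge> 2"
        \<comment> \<open>The other eigenvalue, which is the inverse of \<open>l\<close>; the sum of both is the trace.\<close>
        define k where "k = of_int a - of_int c * p"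
        have kl: "k * l = 1" using other by (simp add: k_def)
        have k: "0 < k" "k < 1" using kl l1 l0 by (smt (verit) mult_less_cancel_right2 zero_less_mult_iff)+
        have sum: "k + l = of_int (a + d)" by (simp add: k_def l_def)
        have "(1 - k) * (l - 1) > 0" using k l1 by simp
        then have "k + l > 2" using kl by (simp add: algebra_simps)
        then have "of_int (a + d) > (2::real)" using sum by simp
        then have "a + d > 2" by linarith
        then have "a + d \<ge> 3" by simp
        then have "k + l \<ge> 3" using sum by linarith
        then show False using k(2) \<open>\<not> l \<ge> 2\<close> by simp
      qed
      then show "ln 2 \<le> r" using *(2) l0 by (simp add: l_def)
    qed simp
    moreover have "germ (at_right p) h = id" if h: "h \<in> H" "R h 0" for h
    proof -
      obtain a b c d where *: "stab_matrix p h a b c d" "ln (of_int c * p + of_int d) = 0" using h(2)[unfolded R_def] by (elim exE conjE) (rule that, assumption, erule sym)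
      have pos: "of_int c * p + of_int d > 0" using *(1) by (simp add: stab_matrix_def)
      then have l: "of_int c * p + of_int d = 1" using *(2) by simp
      \<comment> \<open>A nontrivial unipotent germ forces \<open>p\<close>, and the eigenvalue of \<open>h0\<close>, to be rational.\<close>
      have "c = 0"
      proof (rule ccontr)
        assume "c \<noteq> 0"
        then have "p = (1 - of_int d) / of_int c" using l by (simp add: field_simps)
        then have "p \<in> \<rat>" by simp
        define l0 where "l0 = of_int c0 * p + of_int d0"
        have "l0 \<in> \<rat>" using \<open>p \<in> \<rat>\<close> by (simp add: l0_def)
        moreover have "l0 > 0" using h0(2) by (simp add: stab_matrix_def l0_def)
        moreover have "l0 * l0 + 1 = of_int (a0 + d0) * l0"
        proof -
          have "(of_int a0 - of_int c0 * p) * l0 = 1" using stab_matrix_other_eigenvalue[OF h0(2)] by (simp add: l0_def)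
          then have "l0 * l0 + 1 = (l0 + (of_int a0 - of_int c0 * p)) * l0" by (simp add: distrib_right)
          also have "l0 + (of_int a0 - of_int c0 * p) = of_int (a0 + d0)" by (simp add: l0_def)
          finally show ?thesis .
        qed
        ultimately have "l0 = 1" by (rule rational_unit_eq_one)
        then show False using h0(3) by (simp add: l0_def)
      qed
      then show ?thesis using stab_matrix_unipotent[OF *(1) l] by simp
    qed
    ultimately show ?thesis by (rule conclude)
  qed
  then obtain s where s: "s \<in> H" "\<forall>g\<in>H. \<exists>j::int. germ (at_right p) (inv\<^bsub>Gtilde\<^esub> (s [^]\<^bsub>Gtilde\<^esub> j) \<otimes>\<^bsub>Gtilde\<^esub> g) = id" by (elim bexE)
  have "\<exists>j::int. eventually (\<lambda>y. h (Some y) = (s [^]\<^bsub>Gtilde\<^esub> j) (Some y)) (at_right p)" if h: "h \<in> H" for h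
  proof -
    obtain j :: int where "germ (at_right p) (inv\<^bsub>Gtilde\<^esub> (s [^]\<^bsub>Gtilde\<^esub> j) \<otimes>\<^bsub>Gtilde\<^esub> h) = id" using bspec[OF s(2) h] by (elim exE)
    moreover have sj: "s [^]\<^bsub>Gtilde\<^esub> j \<in> H" by (rule subgroup_int_pow_closed[OF H s(1)])
    ultimately have "eventually (\<lambda>y. h (Some y) = (s [^]\<^bsub>Gtilde\<^esub> j) (Some y)) (at_right p)"
      using sj h by (intro eventually_eq_of_germ_quotient) auto
    then show ?thesis by blast
  qed
  then show ?thesis using s(1) by blast
qed

section \<open>Iteration of monotone maps\<close>

text \<open>Otherwise the iterates increase to a fixed point.\<close>

lemma iterate_exceeds:
  fixes t :: "real \<Rightarrow> real"
  assumes cont: "continuous_on UNIV t" and I: "is_interval I" and up: "\<And>y. y \<in> I \<Longrightarrow> y < t y"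
    and z: "z \<in> I" and B: "B \<in> I"
  shows "\<exists>m. B < (t ^^ m) z"
proof (rule ccontr)
  assume "\<not> ?thesis"
  then have le: "(t ^^ m) z \<le> B" for m by (simp add: not_less)
  have ge: "z \<le> (t ^^ m) z" for m
  proof (induction m)
    case (Suc m)
    have "(t ^^ m) z \<in> I" using is_intervalD[OF I z B Suc le] .
    then have "(t ^^ m) z < t ((t ^^ m) z)" by (rule up)
    then show ?case using Suc by simp
  qed simp
  have inI: "(t ^^ m) z \<in> I" for m using is_intervalD[OF I z B ge le] .
  have "incseq (\<lambda>m. (t ^^ m) z)"
  proof (rule incseq_SucI)
    fix m show "(t ^^ m) z \<le> (t ^^ Suc m) z" using up[OF inI[of m]] by simp
  qed
  then obtain L where L: "(\<lambda>m. (t ^^ m) z) \<longlonglongrightarrow> L"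
    using incseq_convergent[of "\<lambda>m. (t ^^ m) z" B] le by blast
  have "L \<le> B" using le by (intro LIMSEQ_le_const2[OF L]) auto
  have "z \<le> L" using ge by (intro LIMSEQ_le_const[OF L]) auto
  have "L \<in> I" by (rule is_intervalD[OF I z B \<open>z \<le> L\<close> \<open>L \<le> B\<close>])
  have "isCont t L" using cont by (simp add: continuous_on_eq_continuous_at)
  then have "(\<lambda>m. t ((t ^^ m) z)) \<longlonglongrightarrow> t L" using L by (rule isCont_tendsto_compose)
  moreover have "(\<lambda>m. (t ^^ Suc m) z) \<longlonglongrightarrow> L" using L by (rule LIMSEQ_Suc)
  then have "(\<lambda>m. t ((t ^^ m) z)) \<longlonglongrightarrow> L" by simp
  ultimately have "t L = L" by (rule LIMSEQ_unique)
  then show False using up[OF \<open>L \<in> I\<close>] by simp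
qed

text \<open>The intermediate value theorem.\<close>

lemma no_fixed_point_below:
  fixes f :: "real \<Rightarrow> real"
  assumes cont: "continuous_on UNIV f" and I: "is_interval I" and nofix: "\<And>y. y \<in> I \<Longrightarrow> f y \<noteq> y"
    and y0: "y0 \<in> I" "f y0 < y0" and y: "y \<in> I"
  shows "f y < y"
proof (rule ccontr)
  assume "\<not> f y < y"
  then have fy: "f y - y \<ge> 0" by simp
  have cd: "continuous_on {u..v} (\<lambda>x. f x - x)" for u v
    by (intro continuous_intros continuous_on_subset[OF cont]) simp
  have "\<exists>x. x \<in> I \<and> f x - x = 0"
  proof (cases "y0 \<le> y")
    case True
    then obtain x where "y0 \<le> x" "x \<le> y" "f x - x = 0"
      using IVT'[of "\<lambda>x. f x - x" y0 0 y, OF _ fy True cd] y0(2) by auto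
    then show ?thesis using is_intervalD[OF I y0(1) y] by blast
  next
    case False
    then obtain x where "y \<le> x" "x \<le> y0" "f x - x = 0"
      using IVT2'[of "\<lambda>x. f x - x" y0 0 y, OF _ fy _ cd] y0(2) by auto
    then show ?thesis using is_intervalD[OF I y y0(1)] by blast
  qed
  then show False using nofix by force
qed

section \<open>The component next to an end\<close>

text \<open>The half-line \<open>D\<close> to the right of an end, which is minus infinity or a common fixed point
  of \<open>H\<close>; the filter \<open>F\<close> approaches the end from inside.\<close>

locale germ_dynamics = Gt: group Gtilde +
  fixes S H :: "(real option \<Rightarrow> real option) set" and D :: "real set" and F :: "real filter"
  assumes finite_S: "finite S" and S_carrier: "S \<subseteq> carrier Gtilde" and H_eq: "H = generate Gtilde S"
    and end_cases: "(D = UNIV \<and> F = at_bot) \<or> (\<exists>p. D = {p<..} \<and> F = at_right p \<and> (\<forall>h\<in>H. re h p = p))"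
begin

abbreviation mult_Gt (infixl "\<cdot>" 70) where "f \<cdot> g \<equiv> f \<otimes>\<^bsub>Gtilde\<^esub> g"
abbreviation pow_Gt (infixr "\<up>" 75) where "f \<up> n \<equiv> f [^]\<^bsub>Gtilde\<^esub> n"
abbreviation inv_Gt ("\<iota> _" [81] 80) where "\<iota> f \<equiv> inv\<^bsub>Gtilde\<^esub> f"

lemma H_subgroup: "subgroup H Gtilde"
  unfolding H_eq using S_carrier by (rule Gt.generate_is_subgroup)

lemma H_carrier: "h \<in> H \<Longrightarrow> h \<in> carrier Gtilde"
  using subgroup.mem_carrier[OF H_subgroup] .

lemma H_mult: "g \<in> H \<Longrightarrow> h \<in> H \<Longrightarrow> g \<cdot> h \<in> H"
  using subgroup.m_closed[OF H_subgroup] .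

lemma H_inv: "h \<in> H \<Longrightarrow> \<iota> h \<in> H"
  using subgroup.m_inv_closed[OF H_subgroup] .

lemma H_id: "id \<in> H"
  using subgroup.one_closed[OF H_subgroup] by (simp add: Gtilde_simps)

lemma H_pow: "h \<in> H \<Longrightarrow> h \<up> (n :: nat) \<in> H"
  using Gt.subgroup_int_pow_closed[OF H_subgroup, of h "int n"] by (simp add: int_pow_int)

lemma H_int_pow: "h \<in> H \<Longrightarrow> h \<up> (n :: int) \<in> H"
  by (rule Gt.subgroup_int_pow_closed[OF H_subgroup])

lemma re_mult: "h \<in> H \<Longrightarrow> re (g \<cdot> h) x = re g (re h x)"
  unfolding Gtilde_simps by (rule re_comp[OF H_carrier])

lemma re_inv1: "h \<in> H \<Longrightarrow> re (\<iota> h) (re h x) = x"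
  using re_mult[of h "\<iota> h" x] Gt.l_inv[OF H_carrier] by (simp add: Gtilde_simps re_id)

lemma re_inv2: "h \<in> H \<Longrightarrow> re h (re (\<iota> h) x) = x"
  using re_mult[OF H_inv, of h h x] Gt.r_inv[OF H_carrier] by (simp add: Gtilde_simps re_id)

lemma re_less: "h \<in> H \<Longrightarrow> re h x < re h y \<longleftrightarrow> x < y"
  using strict_mono_less[OF strict_mono_re[OF H_carrier]] .

lemma re_le: "h \<in> H \<Longrightarrow> re h x \<le> re h y \<longleftrightarrow> x \<le> y"
  using strict_mono_less_eq[OF strict_mono_re[OF H_carrier]] .

lemma re_pow: "h \<in> H \<Longrightarrow> re (h \<up> (n :: nat)) x = (re h ^^ n) x"
proof (induction n arbitrary: x)
  case 0
  show ?case unfolding Gt.nat_pow_0 Gtilde_simps(2) by (simp only: re_id funpow_0)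
next
  case (Suc n)
  have "re (h \<up> Suc n) x = re (h \<up> n) (re h x)"
    unfolding Gt.nat_pow_Suc by (rule re_mult[OF Suc.prems])
  also have "\<dots> = (re h ^^ n) (re h x)" by (rule Suc.IH[OF Suc.prems])
  also have "\<dots> = (re h ^^ Suc n) x" by (simp only: funpow_Suc_right comp_apply)
  finally show ?case .
qed

lemma D_up: "y \<in> D \<Longrightarrow> y \<le> z \<Longrightarrow> z \<in> D"
  using end_cases by auto

lemma D_no_min: "y \<in> D \<Longrightarrow> \<exists>z\<in>D. z < y"
proof -
  assume y: "y \<in> D"
  from end_cases show ?thesis
  proof (elim disjE exE conjE)
    assume "D = UNIV"
    then show ?thesis by (intro bexI[of _ "y - 1"]) simp_all
  next
    fix p assume D: "D = {p<..}"
    then obtain z where "p < z" "z < y" using y dense[of p y] by auto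
    then show ?thesis using D by (intro bexI[of _ z]) simp_all
  qed
qed

lemma D_ex: "\<exists>d. d \<in> D"
  using end_cases gt_ex by auto

lemma D_invariant: "h \<in> H \<Longrightarrow> y \<in> D \<Longrightarrow> re h y \<in> D"
proof -
  assume h: "h \<in> H" and y: "y \<in> D"
  from end_cases show ?thesis
  proof (elim disjE exE conjE)
    assume "D = UNIV"
    then show ?thesis by simp
  next
    fix p assume D: "D = {p<..}" and p: "\<forall>h\<in>H. re h p = p"
    have "re h p < re h y" using y D re_less[OF h] by simp
    then show ?thesis using p h D by simp
  qed
qed

lemma F_dirs: "F \<in> dirs"
  using end_cases by auto

lemma eventually_F: "eventually P F \<longleftrightarrow> (\<exists>d\<in>D. \<forall>y\<in>D. y < d \<longrightarrow> P y)"
  using end_cases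
proof (elim disjE exE conjE)
  assume D: "D = UNIV" and F: "F = at_bot"
  show ?thesis unfolding D F eventually_at_bot_dense by auto
next
  fix p assume D: "D = {p<..}" and F: "F = at_right p"
  show ?thesis unfolding D F eventually_at_right_field by auto
qed

lemma filterlim_F: "h \<in> H \<Longrightarrow> filterlim (re h) F F"
proof -
  assume h: "h \<in> H"
  from end_cases show ?thesis
  proof (elim disjE exE conjE)
    assume F: "F = at_bot"
    show ?thesis unfolding F by (rule filterlim_re(3)[OF H_carrier[OF h]])
  next
    fix p assume F: "F = at_right p" and p: "\<forall>h\<in>H. re h p = p"
    have "re h p = p" using p h by (rule bspec)
    then show ?thesis unfolding F using filterlim_re(2)[OF H_carrier[OF h], of p] by (simp only:)
  qed
qed

lemma germ_F_mult: "g \<in> H \<Longrightarrow> h \<in> H \<Longrightarrow> germ F (g \<cdot> h) = germ F g \<circ> germ F h"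
  unfolding Gtilde_simps by (rule germ_comp[OF H_carrier H_carrier F_dirs F_dirs filterlim_F])

lemma re_eq_of_germ:
  assumes g: "g \<in> H" and h: "h \<in> H" and eq: "germ F g = germ F h"
  shows "\<exists>d\<in>D. \<forall>y\<in>D. y < d \<longrightarrow> re g y = re h y"
proof -
  have "eventually (\<lambda>y. re g y = re h y) F"
    using germ_props(2)[OF H_carrier[OF g] F_dirs] germ_props(2)[OF H_carrier[OF h] F_dirs]
  proof eventually_elim
    case (elim y)
    then have "g (Some y) = h (Some y)" unfolding eq by simp
    then show ?case by (simp add: re_def)
  qed
  then show ?thesis unfolding eventually_F .
qed

lemma germs_cyclic: "\<exists>s\<in>H. \<forall>h\<in>H. \<exists>j::int. germ F h = germ F (s \<up> j)"
proof -
  have "\<exists>s\<in>H. \<forall>h\<in>H. \<exists>j::int. eventually (\<lambda>y. h (Some y) = (s \<up> j) (Some y)) F"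
    using end_cases
  proof (elim disjE exE conjE)
    assume F: "F = at_bot"
    show ?thesis unfolding F by (rule germs_cyclic_at_bot[OF H_subgroup])
  next
    fix p assume F: "F = at_right p" and p: "\<forall>h\<in>H. re h p = p"
    show ?thesis unfolding F by (rule germs_cyclic_at_right[OF H_subgroup]) (rule bspec[OF p])
  qed
  then obtain s where s: "s \<in> H" "\<forall>h\<in>H. \<exists>j::int. eventually (\<lambda>y. h (Some y) = (s \<up> j) (Some y)) F" by (elim bexE)
  show ?thesis
  proof (intro bexI[OF _ s(1)] ballI)
    fix h assume "h \<in> H"
    then obtain j :: int where "eventually (\<lambda>y. h (Some y) = (s \<up> j) (Some y)) F"
      using bspec[OF s(2)] by blast
    then have "germ F h = germ F (s \<up> j)"
      by (rule germ_cong[OF H_carrier[OF H_int_pow[OF s(1)]] F_dirs])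
    then show "\<exists>j::int. germ F h = germ F (s \<up> j)" by (rule exI)
  qed
qed

text \<open>All germs at the end are powers of one germ.\<close>

lemma germs_commute:
  assumes g: "g \<in> H" and h: "h \<in> H"
  shows "germ F (g \<cdot> h) = germ F (h \<cdot> g)"
proof -
  obtain s where s: "s \<in> H" "\<forall>h\<in>H. \<exists>j::int. germ F h = germ F (s \<up> j)" using germs_cyclic by (elim bexE)
  obtain i :: int where i: "germ F g = germ F (s \<up> i)" using bspec[OF s(2) g] by (elim exE)
  obtain j :: int where j: "germ F h = germ F (s \<up> j)" using bspec[OF s(2) h] by (elim exE)
  have "s \<up> i \<cdot> s \<up> j = s \<up> (i + j)"
    by (rule Gt.int_pow_mult[symmetric, OF H_carrier[OF s(1)]])
  also have "\<dots> = s \<up> (j + i)" by (simp only: add.commute)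
  also have "\<dots> = s \<up> j \<cdot> s \<up> i" by (rule Gt.int_pow_mult[OF H_carrier[OF s(1)]])
  finally have "germ F (s \<up> i \<cdot> s \<up> j) = germ F (s \<up> j \<cdot> s \<up> i)" by (rule arg_cong)
  then show ?thesis
    unfolding germ_F_mult[OF g h] germ_F_mult[OF h g] germ_F_mult[OF H_int_pow[OF s(1)] H_int_pow[OF s(1)]] i j .
qed

text \<open>The component of the end: the part of \<open>D\<close> to the left of the first common fixed point of
  \<open>H\<close>.\<close>

definition \<Omega> :: "real set" where
  "\<Omega> = {y \<in> D. \<forall>z\<in>D. z \<le> y \<longrightarrow> (\<exists>h\<in>H. re h z \<noteq> z)}"

lemma \<Omega>_D: "y \<in> \<Omega> \<Longrightarrow> y \<in> D"
  by (simp add: \<Omega>_def)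

lemma \<Omega>_moved: "y \<in> \<Omega> \<Longrightarrow> \<exists>h\<in>H. re h y \<noteq> y"
  unfolding \<Omega>_def by blast

lemma \<Omega>_down: "y \<in> \<Omega> \<Longrightarrow> z \<in> D \<Longrightarrow> z \<le> y \<Longrightarrow> z \<in> \<Omega>"
  unfolding \<Omega>_def using order_trans by blast

lemma \<Omega>_interval: "is_interval \<Omega>"
proof (rule is_intervalI)
  fix u v y assume "u \<in> \<Omega>" "v \<in> \<Omega>" "u \<le> y" "y \<le> v"
  then show "y \<in> \<Omega>" using \<Omega>_down[of v y] D_up[OF \<Omega>_D, of u y] by simp
qed

lemma \<Omega>_invariant:
  assumes h: "h \<in> H" and y: "y \<in> \<Omega>"
  shows "re h y \<in> \<Omega>"
proof -
  have "\<exists>g\<in>H. re g z \<noteq> z" if z: "z \<in> D" "z \<le> re h y" for z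
  proof (rule ccontr)
    assume no: "\<not> ?thesis"
    then have "re (\<iota> h) z = z" using H_inv[OF h] by blast
    moreover have "re (\<iota> h) z \<le> re (\<iota> h) (re h y)" using z(2) re_le[OF H_inv[OF h]] by simp
    ultimately have "z \<le> y" using re_inv1[OF h] by simp
    then have "z \<in> \<Omega>" by (rule \<Omega>_down[OF y z(1)])
    from \<Omega>_moved[OF this] no show False by contradiction
  qed
  then show ?thesis using D_invariant[OF h \<Omega>_D[OF y]] unfolding \<Omega>_def by simp
qed

text \<open>The infimum of the orbit would be a common fixed point of \<open>H\<close> in the component.\<close>

lemma orbit_descends:
  assumes y: "y \<in> \<Omega>" and d: "d \<in> D"
  shows "\<exists>h\<in>H. re h y < d"
proof (rule ccontr)
  assume no: "\<not> ?thesis"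
  define A where "A = (\<lambda>h. re h y) ` H"
  have lb: "d \<le> x" if "x \<in> A" for x using that no unfolding A_def by force
  have A: "A \<noteq> {}" "bdd_below A" using H_id bdd_belowI[OF lb] by (auto simp: A_def)
  define i where "i = Inf A"
  have "d \<le> i" unfolding i_def using A(1) lb by (rule cInf_greatest)
  then have iD: "i \<in> D" by (rule D_up[OF d])
  have "y \<in> A" unfolding A_def using H_id by (intro image_eqI[of _ _ id]) (simp_all add: re_id)
  then have iy: "i \<le> y" unfolding i_def using A(2) by (rule cInf_lower)
  have le: "re h i \<le> i" if h: "h \<in> H" for h
  proof -
    have "re h i \<le> x" if x: "x \<in> A" for x
    proof -
      obtain g where g: "g \<in> H" "x = re g y" using x by (auto simp: A_def)
      have "re (\<iota> h) x \<in> A" unfolding A_def g(2) using re_mult[OF g(1), of "\<iota> h" y] H_mult[OF H_inv[OF h] g(1)] by (intro image_eqI) simp_all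
      then have "i \<le> re (\<iota> h) x" unfolding i_def using A(2) by (rule cInf_lower)
      then have "re h i \<le> re h (re (\<iota> h) x)" using re_le[OF h] by simp
      then show ?thesis using re_inv2[OF h] by simp
    qed
    then have "re h i \<le> Inf A" by (rule cInf_greatest[OF A(1)])
    then show "re h i \<le> i" by (simp only: i_def)
  qed
  have "re h i = i" if h: "h \<in> H" for h
  proof (rule antisym[OF le[OF h]])
    have "re h (re (\<iota> h) i) \<le> re h i" using le[OF H_inv[OF h]] re_le[OF h] by simp
    then show "i \<le> re h i" using re_inv2[OF h] by simp
  qed
  moreover have "i \<in> \<Omega>" using y iD iy by (rule \<Omega>_down)
  ultimately show False using \<Omega>_moved by blast
qed

text \<open>The commutator of two elements is the identity near the end, where germs commute, but
  moves some point of the component. The point \<open>a\<close> is the infimum of its moved points.\<close>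

lemma exists_left_jump:
  assumes nonab: "g \<in> H" "h \<in> H" "x \<in> \<Omega>" "re (g \<cdot> h) x \<noteq> re (h \<cdot> g) x"
  shows "\<exists>k\<in>H. \<exists>a\<in>\<Omega>. re k a = a \<and> germ (at_left a) k = id \<and> germ (at_right a) k \<noteq> id"
proof -
  \<comment> \<open>The two products agree at a point if and only if their quotient fixes it.\<close>
  define k where "k = \<iota> (h \<cdot> g) \<cdot> (g \<cdot> h)"
  note gh = H_mult[OF nonab(1,2)] and hg = H_mult[OF nonab(2,1)]
  have k: "k \<in> H" unfolding k_def by (rule H_mult[OF H_inv[OF hg] gh])
  have k_eq: "re k y = y \<longleftrightarrow> re (g \<cdot> h) y = re (h \<cdot> g) y" for y
    unfolding k_def re_mult[OF gh] using re_inv1[OF hg] re_inv2[OF hg] by metis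
  obtain d where d: "d \<in> D" "\<And>y. y \<in> D \<Longrightarrow> y < d \<Longrightarrow> re k y = y"
    using re_eq_of_germ[OF gh hg germs_commute[OF nonab(1,2)]] unfolding k_eq by blast
  define A where "A = {y \<in> D. re k y \<noteq> y}"
  have xA: "x \<in> A" using nonab(3,4) \<Omega>_D k_eq by (simp add: A_def)
  have lb: "d \<le> y" if "y \<in> A" for y using that d(2)[of y] by (force simp: A_def)
  have bdd: "bdd_below A" using lb by (rule bdd_belowI)
  define a where "a = Inf A"
  have "d \<le> a" unfolding a_def using xA lb by (intro cInf_greatest) auto
  then have aD: "a \<in> D" by (rule D_up[OF d(1)])
  have "a \<le> x" unfolding a_def using xA bdd by (rule cInf_lower)
  then have a\<Omega>: "a \<in> \<Omega>" by (rule \<Omega>_down[OF nonab(3) aD])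
  have below: "re k y = y" if "y \<in> D" "y < a" for y
  proof (rule ccontr)
    assume "re k y \<noteq> y"
    then have "y \<in> A" using that(1) by (simp add: A_def)
    then have "a \<le> y" unfolding a_def using bdd by (rule cInf_lower)
    then show False using that(2) by simp
  qed
  obtain e where e: "e \<in> D" "e < a" using D_no_min[OF aD] by blast
  have fix_a: "re k a = a"
  proof (rule antisym)
    show "a \<le> re k a"
    proof (rule dense_le_bounded[OF e(2)])
      fix y assume y: "e < y" "y < a"
      then have "y \<in> D" using D_up[OF e(1)] by simp
      then have "y = re k y" using below y(2) by simp
      also have "\<dots> < re k a" using y(2) re_less[OF k] by simp
      finally show "y \<le> re k a" by simp
    qed
    have "a \<le> re (\<iota> k) a"
    proof (rule dense_le_bounded[OF e(2)])
      fix y assume y: "e < y" "y < a"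
      then have "y \<in> D" using D_up[OF e(1)] by simp
      then have "re (\<iota> k) y = y" using below[of y] y(2) re_inv1[OF k, of y] by simp
      moreover have "re (\<iota> k) y < re (\<iota> k) a" using y(2) re_less[OF H_inv[OF k]] by simp
      ultimately show "y \<le> re (\<iota> k) a" by simp
    qed
    then have "re k a \<le> re k (re (\<iota> k) a)" using re_le[OF k] by simp
    then show "re k a \<le> a" using re_inv2[OF k] by simp
  qed
  have "germ (at_left a) k = id"
  proof (rule germ_eqI[OF _ PSL2Z_id])
    have "k (Some y) = id (Some y)" if "e < y" "y < a" for y
      using below[of y] that D_up[OF e(1), of y] Gtilde_Some[OF H_carrier[OF k]] by simp
    then show "eventually (\<lambda>y. k (Some y) = id (Some y)) (at_left a)"
      unfolding eventually_at_left_field using e(2) by blast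
  qed simp
  moreover have "germ (at_right a) k \<noteq> id"
  proof
    assume "germ (at_right a) k = id"
    then have "eventually (\<lambda>y. k (Some y) = id (Some y)) (at_right a)"
      using germ_props(2)[OF H_carrier[OF k], of "at_right a"] by simp
    then obtain b where b: "b > a" "\<And>y. a < y \<Longrightarrow> y < b \<Longrightarrow> k (Some y) = id (Some y)"
      unfolding eventually_at_right_field by blast
    obtain y where y: "y \<in> A" "y < b" using cInf_lessD[of A b] xA b(1) unfolding a_def by blast
    have "a \<le> y" unfolding a_def using y(1) bdd by (rule cInf_lower)
    moreover have "y \<noteq> a" using y(1) fix_a by (auto simp: A_def)
    ultimately have "k (Some y) = id (Some y)" using b(2) y(2) by simp
    then show False using y(1) Gtilde_Some[OF H_carrier[OF k]] by (simp add: A_def)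
  qed
  ultimately show ?thesis using k a\<Omega> fix_a by blast
qed

text \<open>Conjugation by \<open>h\<close> transports the jump from \<open>a\<close> to \<open>h a\<close>.\<close>

lemma conjugate_left_jump:
  assumes k: "k \<in> H" "re k a = a" "germ (at_left a) k = id" "germ (at_right a) k \<noteq> id" and h: "h \<in> H"
  shows "re (h \<cdot> k \<cdot> \<iota> h) (re h a) = re h a" "germ (at_left (re h a)) (h \<cdot> k \<cdot> \<iota> h) = id"
    "germ (at_right (re h a)) (h \<cdot> k \<cdot> \<iota> h) \<noteq> id"
proof -
  note hk = H_mult[OF h k(1)] and hi = H_inv[OF h]
  have bk: "re (\<iota> h) (re h a) = a" by (rule re_inv1[OF h])
  show "re (h \<cdot> k \<cdot> \<iota> h) (re h a) = re h a"
    unfolding re_mult[OF hi] bk re_mult[OF k(1)] k(2) ..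
  have ga: "germ (filt (re h a)) (h \<cdot> k \<cdot> \<iota> h) = germ (filt a) h \<circ> germ (filt a) k \<circ> germ (filt (re h a)) (\<iota> h)"
    and gb: "germ (filt a) h \<circ> germ (filt (re h a)) (\<iota> h) = id"
    if filt: "\<And>x. filt x \<in> dirs" "\<And>g x. g \<in> H \<Longrightarrow> filterlim (re g) (filt (re g x)) (filt x)" for filt
  proof -
    have l1: "filterlim (re (\<iota> h)) (filt a) (filt (re h a))" using filt(2)[OF hi, of "re h a"] unfolding bk .
    have l2: "filterlim (re k) (filt a) (filt a)" using filt(2)[OF k(1), of a] unfolding k(2) .
    have "germ (filt (re h a)) ((h \<cdot> k) \<cdot> \<iota> h) = germ (filt a) (h \<cdot> k) \<circ> germ (filt (re h a)) (\<iota> h)"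
      unfolding Gtilde_simps(1)[of "h \<cdot> k"] by (rule germ_comp[OF H_carrier[OF hk] H_carrier[OF hi] filt(1) filt(1) l1])
    also have "germ (filt a) (h \<cdot> k) = germ (filt a) h \<circ> germ (filt a) k"
      unfolding Gtilde_simps(1) by (rule germ_comp[OF H_carrier[OF h] H_carrier[OF k(1)] filt(1) filt(1) l2])
    finally show "germ (filt (re h a)) (h \<cdot> k \<cdot> \<iota> h) = germ (filt a) h \<circ> germ (filt a) k \<circ> germ (filt (re h a)) (\<iota> h)" .
    have "germ (filt (re h a)) (h \<cdot> \<iota> h) = germ (filt a) h \<circ> germ (filt (re h a)) (\<iota> h)"
      unfolding Gtilde_simps(1) by (rule germ_comp[OF H_carrier[OF h] H_carrier[OF hi] filt(1) filt(1) l1])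
    moreover have "h \<cdot> \<iota> h = id" using Gt.r_inv[OF H_carrier[OF h]] by (simp add: Gtilde_simps)
    ultimately show "germ (filt a) h \<circ> germ (filt (re h a)) (\<iota> h) = id" using germ_id[OF filt(1)] by simp
  qed
  have L: "filterlim (re g) (at_left (re g x)) (at_left x)" if "g \<in> H" for g x by (rule filterlim_re(1)[OF H_carrier[OF that]])
  have R: "filterlim (re g) (at_right (re g x)) (at_right x)" if "g \<in> H" for g x by (rule filterlim_re(2)[OF H_carrier[OF that]])
  have gaL: "germ (at_left (re h a)) (h \<cdot> k \<cdot> \<iota> h) = germ (at_left a) h \<circ> germ (at_left a) k \<circ> germ (at_left (re h a)) (\<iota> h)"
    by (rule ga[of at_left]) (rule dirs_intros(1), erule L)
  have gbL: "germ (at_left a) h \<circ> germ (at_left (re h a)) (\<iota> h) = id"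
    by (rule gb[of at_left]) (rule dirs_intros(1), erule L)
  have gaR: "germ (at_right (re h a)) (h \<cdot> k \<cdot> \<iota> h) = germ (at_right a) h \<circ> germ (at_right a) k \<circ> germ (at_right (re h a)) (\<iota> h)"
    by (rule ga[of at_right]) (rule dirs_intros(2), erule R)
  have gbR: "germ (at_right a) h \<circ> germ (at_right (re h a)) (\<iota> h) = id"
    by (rule gb[of at_right]) (rule dirs_intros(2), erule R)
  show "germ (at_left (re h a)) (h \<cdot> k \<cdot> \<iota> h) = id"
    unfolding gaL k(3) comp_id by (rule gbL)
  show "germ (at_right (re h a)) (h \<cdot> k \<cdot> \<iota> h) \<noteq> id"
  proof
    assume eq: "germ (at_right (re h a)) (h \<cdot> k \<cdot> \<iota> h) = id"
    define p where "p = germ (at_right a) h"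
    define q where "q = germ (at_right (re h a)) (\<iota> h)"
    have "bij p" unfolding p_def using h by (intro PSL2Z_inverse germ_props H_carrier) simp_all
    have pq: "p \<circ> q = id" unfolding p_def q_def by (rule gbR)
    have pkq: "p \<circ> germ (at_right a) k \<circ> q = id"
      using eq unfolding gaR p_def q_def .
    have "bij q" unfolding q_def using hi by (intro PSL2Z_inverse germ_props H_carrier) simp_all
    have "germ (at_right a) k z = z" for z
    proof -
      obtain w where w: "z = q w" using \<open>bij q\<close> by (metis bij_pointE)
      have "p (germ (at_right a) k (q w)) = p (q w)" using fun_cong[OF pq, of w] fun_cong[OF pkq, of w] by simp
      then show ?thesis using \<open>bij p\<close> w by (simp add: bij_is_inj inj_eq)
    qed
    then show False using k(4) by (simp add: fun_eq_iff)
  qed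
qed

section \<open>A generator of the germs at the end\<close>

lemma below_finite:
  assumes "finite A"
  shows "\<exists>d\<in>D. \<forall>x\<in>A. x \<in> D \<longrightarrow> d \<le> x"
  using assms
proof (induction A)
  case empty
  then show ?case using D_ex by blast
next
  case (insert x A)
  then obtain d where d: "d \<in> D" "\<forall>x\<in>A. x \<in> D \<longrightarrow> d \<le> x" by blast
  show ?case
  proof (cases "x \<in> D")
    case True
    have "min d x \<in> D" using d(1) True by (simp add: min_def)
    then show ?thesis using d(2) by (intro bexI[of _ "min d x"]) force+
  next
    case False
    then show ?thesis using d by (intro bexI[of _ d]) auto
  qed
qed

text \<open>Otherwise the finitely many generators, and with them \<open>H\<close>, would fix all points of a
  neighbourhood of the end.\<close>

lemma some_germ_nontrivial:
  assumes "\<Omega> \<noteq> {}"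
  shows "\<exists>h\<in>H. germ F h \<noteq> id"
proof (rule ccontr)
  assume "\<not> ?thesis"
  then have triv: "germ F h = germ F id" if "h \<in> H" for h using that germ_id[OF F_dirs] by auto
  have SH: "h \<in> S \<Longrightarrow> h \<in> H" for h unfolding H_eq by (rule generate.incl)
  have "\<exists>d\<in>D. \<forall>y\<in>D. y < d \<longrightarrow> re h y = y" if "h \<in> H" for h
    using re_eq_of_germ[OF that H_id triv[OF that]] by (simp add: re_id)
  then obtain d where d: "\<And>h. h \<in> S \<Longrightarrow> d h \<in> D" "\<And>h y. h \<in> S \<Longrightarrow> y \<in> D \<Longrightarrow> y < d h \<Longrightarrow> re h y = y"
    using SH by metis
  obtain e where e: "e \<in> D" "\<forall>x\<in>d ` S. x \<in> D \<longrightarrow> e \<le> x" using below_finite[of "d ` S"] finite_S by auto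
  obtain w where w: "w \<in> \<Omega>" using assms by blast
  have "min e w \<in> D" using e(1) \<Omega>_D[OF w] by (simp add: min_def)
  then obtain y where y: "y \<in> D" "y < min e w" using D_no_min by blast
  have fixS: "re h y = y" if "h \<in> S" for h
  proof -
    have "e \<le> d h" using e(2) d(1)[OF that] that by blast
    then show ?thesis using y by (intro d(2)[OF that y(1)]) simp
  qed
  have "h \<in> H \<and> re h y = y" if "h \<in> generate Gtilde S" for h
    using that
  proof (induction rule: generate.induct)
    case one
    show ?case unfolding Gtilde_simps(2) by (rule conjI[OF H_id re_id])
  next
    case (incl h)
    then show ?case using fixS SH by simp
  next
    case (inv h)
    then show ?case using fixS[of h] SH[of h] H_inv[of h] re_inv1[of h y] by simp
  next
    case (eng g h)
    then show ?case using H_mult[of g h] re_mult[of h g y] by simp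
  qed
  then have "\<forall>h\<in>H. re h y = y" unfolding H_eq by blast
  moreover have "y \<in> \<Omega>" using y by (intro \<Omega>_down[OF w y(1)]) simp
  ultimately show False using \<Omega>_moved by blast
qed

text \<open>A nontrivial germ has only finitely many fixed points, so near the end its representative
  moves all points in the same direction; the direction is reversed by passing to the
  inverse.\<close>

lemma contracting_generator:
  assumes "\<Omega> \<noteq> {}"
  shows "\<exists>s\<in>H. (\<forall>h\<in>H. \<exists>j::int. germ F h = germ F (s \<up> j)) \<and>
    (\<exists>d\<in>D. \<forall>y\<in>D. y < d \<longrightarrow> re s y < y)"
proof -
  obtain s where s: "s \<in> H" "\<forall>h\<in>H. \<exists>j::int. germ F h = germ F (s \<up> j)" using germs_cyclic by (elim bexE)
  have sc: "s \<in> carrier Gtilde" by (rule H_carrier[OF s(1)])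
  have nontriv: "germ F s \<noteq> id"
  proof
    assume s_triv: "germ F s = id"
    have nat: "germ F (s \<up> n) = id" for n :: nat
    proof (induction n)
      case 0
      show ?case unfolding Gt.nat_pow_0 Gtilde_simps(2) by (rule germ_id[OF F_dirs])
    next
      case (Suc n)
      show ?case unfolding Gt.nat_pow_Suc germ_F_mult[OF H_pow[OF s(1)] s(1)] Suc s_triv by simp
    qed
    have "germ F (s \<up> j) = id" for j :: int
    proof (cases j rule: int_cases2)
      case (nonneg n)
      show ?thesis unfolding nonneg int_pow_int by (rule nat)
    next
      case (nonpos n)
      have "germ F (\<iota> (s \<up> n) \<cdot> s \<up> n) = id"
        using Gt.l_inv[OF H_carrier[OF H_pow[OF s(1)]], of n] germ_id[OF F_dirs] by (simp add: Gtilde_simps(2))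
      then have "germ F (\<iota> (s \<up> n)) = id"
        unfolding germ_F_mult[OF H_inv[OF H_pow[OF s(1)]] H_pow[OF s(1)]] nat by simp
      then show ?thesis unfolding nonpos Gt.int_pow_neg[OF sc] int_pow_int .
    qed
    then have "germ F h = id" if "h \<in> H" for h using bspec[OF s(2) that] by auto
    then show False using some_germ_nontrivial[OF assms] by blast
  qed
  have fin: "finite {y. germ F s (Some y) = Some y}"
    using PSL2Z_eq_id[OF germ_props(1)[OF sc F_dirs]] nontriv by blast
  obtain d1 where d1: "d1 \<in> D" "\<forall>y\<in>D. y < d1 \<longrightarrow> s (Some y) = germ F s (Some y)"
    using germ_props(2)[OF sc F_dirs] unfolding eventually_F by blast
  obtain d2 where d2: "d2 \<in> D" "\<forall>x\<in>{y. germ F s (Some y) = Some y}. x \<in> D \<longrightarrow> d2 \<le> x" using below_finite[OF fin] by blast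
  define d where "d = min d1 d2"
  have dD: "d \<in> D" using d1(1) d2(1) by (simp add: d_def min_def)
  have nofix: "re s y \<noteq> y" if "y \<in> D" "y < d" for y
  proof
    assume "re s y = y"
    then have "germ F s (Some y) = Some y" using d1(2) that Gtilde_Some[OF sc, of y] by (simp add: d_def)
    then show False using d2(2) that by (force simp: d_def)
  qed
  obtain y0 where y0: "y0 \<in> D" "y0 < d" using D_no_min[OF dD] by blast
  have int: "is_interval {y \<in> D. y < d}"
    by (rule is_intervalI) (use D_up in auto)
  show ?thesis
  proof (cases "re s y0 < y0")
    case True
    have "re s y < y" if "y \<in> D" "y < d" for y
      using no_fixed_point_below[OF continuous_on_re[OF sc] int, of y0 y] nofix y0 True that by simp
    then show ?thesis using s dD by blast
  next
    case False
    then have up: "y0 < re s y0" using nofix[OF y0] by simp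
    \<comment> \<open>In this case \<open>s\<close> expands near the end, and its inverse contracts.\<close>
    let ?t = "\<iota> s"
    have t: "?t \<in> H" by (rule H_inv[OF s(1)])
    have tc: "?t \<in> carrier Gtilde" by (rule H_carrier[OF t])
    have t_nofix: "re ?t y \<noteq> y" if "y \<in> D" "y < d" for y
    proof
      assume "re ?t y = y"
      then have "re s y = y" using re_inv2[OF s(1), of y] by simp
      then show False using nofix[OF that] by contradiction
    qed
    have "re ?t y0 < re ?t (re s y0)" using up re_less[OF t] by simp
    then have t0: "re ?t y0 < y0" using re_inv1[OF s(1)] by simp
    have "re ?t y < y" if "y \<in> D" "y < d" for y
      using no_fixed_point_below[OF continuous_on_re[OF tc] int, of y0 y] t_nofix y0 t0 that by simp
    moreover have "\<exists>j::int. germ F h = germ F (?t \<up> j)" if h: "h \<in> H" for h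
    proof -
      obtain j :: int where "germ F h = germ F (s \<up> j)" using bspec[OF s(2) h] by (elim exE)
      moreover have "?t \<up> (- j) = s \<up> j"
        using Gt.int_pow_neg[OF tc, of j] Gt.int_pow_inv[OF sc, of j] Gt.inv_inv[OF H_carrier[OF H_int_pow[OF s(1), of j]]] by simp
      ultimately have "germ F h = germ F (?t \<up> (- j))" by simp
      then show ?thesis by (rule exI)
    qed
    ultimately show ?thesis using t dD by blast
  qed
qed

section \<open>Eventual jumps\<close>

lemma jump_mult: "f \<in> H \<Longrightarrow> g \<in> H \<Longrightarrow>
    jump (f \<cdot> g) x = inv_into UNIV (germ (at_left x) g) \<circ> jump f (re g x) \<circ> germ (at_right x) g"
  unfolding Gtilde_simps by (rule jump_comp[OF H_carrier H_carrier])

lemma jump_mult_trivial: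
  assumes f: "f \<in> H" and g: "g \<in> H" and j: "jump f (re g x) = id"
  shows "jump (f \<cdot> g) x = jump g x"
  unfolding jump_mult[OF f g] j by (simp add: jump_def)

text \<open>The condition under which the eventual jumps defined below exist.\<close>

definition stable_jump :: "(real option \<Rightarrow> real option) \<Rightarrow> bool" where
  "stable_jump r \<longleftrightarrow> (\<forall>z\<in>\<Omega>. \<exists>v. eventually (\<lambda>m. jump (\<iota> r \<up> (m :: nat)) z = v) sequentially)"

text \<open>The points \<open>z\<close> at which a further factor \<open>y\<close> on the right of \<open>r^(-m)\<close> affects the jump for
  arbitrarily large \<open>m\<close>. For \<open>r = id\<close> these are the jumps of \<open>y\<close>.\<close>

definition bad :: "(real option \<Rightarrow> real option) \<Rightarrow> (real option \<Rightarrow> real option) \<Rightarrow> real set" where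
  "bad r y = {z \<in> \<Omega>. \<not> eventually (\<lambda>m. jump (\<iota> r \<up> (m :: nat) \<cdot> y) z = jump (\<iota> r \<up> m) z) sequentially}"

text \<open>The value is the limit of the jumps of \<open>r^(-m) g\<close> at \<open>a\<close>, which exists when \<open>r\<close> satisfies
  \<open>stable_jump\<close>. It measures the jump of \<open>g\<close> up to powers of \<open>r\<close> on the left.\<close>

definition final_jump :: "(real option \<Rightarrow> real option) \<Rightarrow> real \<Rightarrow> (real option \<Rightarrow> real option) \<Rightarrow> real option \<Rightarrow> real option" where
  "final_jump r a g = (SOME v. eventually (\<lambda>m. jump (\<iota> r \<up> (m :: nat) \<cdot> g) a = v) sequentially)"

lemma final_jump_eqI:
  assumes "eventually (\<lambda>m. jump (\<iota> r \<up> (m :: nat) \<cdot> g) a = v) sequentially"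
  shows "final_jump r a g = v"
proof -
  have "eventually (\<lambda>m. jump (\<iota> r \<up> (m :: nat) \<cdot> g) a = final_jump r a g) sequentially"
    unfolding final_jump_def
    by (rule someI[of "\<lambda>v. eventually (\<lambda>m. jump (\<iota> r \<up> (m :: nat) \<cdot> g) a = v) sequentially" v]) (rule assms)
  then have "eventually (\<lambda>m::nat. final_jump r a g = v) sequentially"
    using assms by eventually_elim simp
  then show ?thesis by simp
qed

lemma final_jump_eventually:
  assumes r: "r \<in> H" "stable_jump r" and a: "a \<in> \<Omega>" and g: "g \<in> H"
  shows "eventually (\<lambda>m. jump (\<iota> r \<up> (m :: nat) \<cdot> g) a = final_jump r a g) sequentially"
proof -
  have "\<exists>v. eventually (\<lambda>m. jump (\<iota> r \<up> (m :: nat)) (re g a) = v) sequentially"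
    using bspec[OF r(2)[unfolded stable_jump_def] \<Omega>_invariant[OF g a]] .
  then obtain v where "eventually (\<lambda>m. jump (\<iota> r \<up> (m :: nat)) (re g a) = v) sequentially" by (rule exE)
  then have "eventually (\<lambda>m. jump (\<iota> r \<up> (m :: nat) \<cdot> g) a
      = inv_into UNIV (germ (at_left a) g) \<circ> v \<circ> germ (at_right a) g) sequentially"
    by eventually_elim (simp only: jump_mult[OF H_pow[OF H_inv[OF r(1)]] g])
  then show ?thesis using final_jump_eqI by simp
qed

text \<open>By the chain rule the jump of \<open>r^(-m) y g\<close> at \<open>a\<close> is determined by \<open>g\<close> and the jump of
  \<open>r^(-m) y\<close> at \<open>g a\<close>.\<close>

lemma final_jump_not_bad:
  assumes r: "r \<in> H" "stable_jump r" and a: "a \<in> \<Omega>" and y: "y \<in> H" and g: "g \<in> H"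
    and nb: "re g a \<notin> bad r y"
  shows "final_jump r a (y \<cdot> g) = final_jump r a g"
proof (rule final_jump_eqI)
  have "eventually (\<lambda>m. jump (\<iota> r \<up> (m :: nat) \<cdot> y) (re g a) = jump (\<iota> r \<up> m) (re g a)) sequentially"
    using nb \<Omega>_invariant[OF g a] unfolding bad_def by blast
  then show "eventually (\<lambda>m. jump (\<iota> r \<up> (m :: nat) \<cdot> (y \<cdot> g)) a = final_jump r a g) sequentially"
    using final_jump_eventually[OF r a g]
  proof eventually_elim
    case (elim m)
    note rm = H_pow[OF H_inv[OF r(1)], of m]
    have "jump (\<iota> r \<up> m \<cdot> (y \<cdot> g)) a = jump ((\<iota> r \<up> m \<cdot> y) \<cdot> g) a"
      unfolding Gt.m_assoc[OF H_carrier[OF rm] H_carrier[OF y] H_carrier[OF g]] ..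
    also have "\<dots> = jump (\<iota> r \<up> m \<cdot> g) a"
      unfolding jump_mult[OF H_mult[OF rm y] g] jump_mult[OF rm g] elim(1) ..
    also have "\<dots> = final_jump r a g" by (rule elim(2))
    finally show ?case .
  qed
qed

text \<open>The element \<open>k\<close> returns to \<open>a\<close>, so the chain rule contributes only its germs at \<open>a\<close>.\<close>

lemma final_jump_right:
  assumes r: "r \<in> H" "stable_jump r" and a: "a \<in> \<Omega>" and k: "k \<in> H" "re k a = a" "germ (at_left a) k = id" and g: "g \<in> H"
  shows "final_jump r a (g \<cdot> k) = final_jump r a g \<circ> germ (at_right a) k"
proof (rule final_jump_eqI)
  show "eventually (\<lambda>m. jump (\<iota> r \<up> (m :: nat) \<cdot> (g \<cdot> k)) a = final_jump r a g \<circ> germ (at_right a) k) sequentially"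
    using final_jump_eventually[OF r a g]
  proof eventually_elim
    case (elim m)
    note rm = H_pow[OF H_inv[OF r(1)], of m]
    have "jump (\<iota> r \<up> m \<cdot> (g \<cdot> k)) a = jump ((\<iota> r \<up> m \<cdot> g) \<cdot> k) a"
      unfolding Gt.m_assoc[OF H_carrier[OF rm] H_carrier[OF g] H_carrier[OF k(1)]] ..
    also have "\<dots> = jump (\<iota> r \<up> m \<cdot> g) a \<circ> germ (at_right a) k"
      unfolding jump_mult[OF H_mult[OF rm g] k(1)] k(2,3) by simp
    finally show ?case unfolding elim .
  qed
qed

lemma final_jump_bij:
  assumes r: "r \<in> H" "stable_jump r" and a: "a \<in> \<Omega>" and g: "g \<in> H"
  shows "bij (final_jump r a g)"
proof -
  obtain m :: nat where m: "jump (\<iota> r \<up> m \<cdot> g) a = final_jump r a g"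
    using eventually_happens'[OF sequentially_bot final_jump_eventually[OF r a g]] by (rule exE)
  have c: "\<iota> r \<up> m \<cdot> g \<in> carrier Gtilde"
    by (rule H_carrier[OF H_mult[OF H_pow[OF H_inv[OF r(1)]] g]])
  have "bij (germ (at_left a) (\<iota> r \<up> m \<cdot> g))" "bij (germ (at_right a) (\<iota> r \<up> m \<cdot> g))"
    using germ_props(1)[OF c] by (simp_all add: PSL2Z_inverse(1))
  then show ?thesis unfolding m[symmetric] jump_def by (intro bij_comp bij_imp_bij_inv)
qed

lemma final_jump_moved:
  assumes r: "r \<in> H" "stable_jump r" and a: "a \<in> \<Omega>" and g: "g \<in> H" and \<kappa>: "\<kappa> \<noteq> id"
  shows "final_jump r a g \<circ> \<kappa> \<noteq> final_jump r a g"
proof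
  assume eq: "final_jump r a g \<circ> \<kappa> = final_jump r a g"
  have "\<kappa> z = z" for z
    using fun_cong[OF eq, of z] bij_is_inj[OF final_jump_bij[OF r a g]] by (simp add: inj_eq)
  then show False using \<kappa> by (simp add: fun_eq_iff)
qed

lemma pow_id: "\<iota> id \<up> (m :: nat) = id"
proof -
  have "\<iota> id = id" using Gt.inv_one unfolding Gtilde_simps(2) .
  then show ?thesis using Gt.nat_pow_one[of m] unfolding Gtilde_simps(2) by (simp only:)
qed

lemma stable_jump_id: "stable_jump id"
  unfolding stable_jump_def pow_id by simp

lemma bad_id:
  assumes y: "y \<in> H"
  shows "bad id y = {z \<in> \<Omega>. jump y z \<noteq> id}"
proof -
  have "id \<cdot> y = y" unfolding Gtilde_simps by simp
  moreover have "jump id z = id" for z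
    using germ_id[of "at_left z"] germ_id[of "at_right z"] unfolding jump_def by simp
  ultimately show ?thesis unfolding bad_def pow_id by simp
qed

lemma finite_bad_id: "y \<in> H \<Longrightarrow> finite (bad id y)"
  unfolding bad_id using finite_jumps[OF H_carrier] by (rule finite_subset[rotated]) auto

lemma bad_id_pow: "bad id (id \<up> (j :: int)) = {}"
proof -
  have "id \<up> j = id" using Gt.int_pow_one[of j] unfolding Gtilde_simps(2) .
  moreover have "jump id z = id" for z
    using germ_id[of "at_left z"] germ_id[of "at_right z"] unfolding jump_def by simp
  ultimately show ?thesis using bad_id[OF H_id] by simp
qed

section \<open>Contractions of the component\<close>

text \<open>The inverse of \<open>s\<close> moves every point of the component to the right, and has no fixed point
  there.\<close>

lemma contraction_escapes:
  assumes s: "s \<in> H" and down: "\<forall>y\<in>\<Omega>. re s y < y" and z: "z \<in> \<Omega>" and B: "B \<in> \<Omega>"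
  shows "\<exists>N. \<forall>m\<ge>N. B < re (\<iota> s \<up> (m :: nat)) z"
proof -
  have t: "\<iota> s \<in> H" by (rule H_inv[OF s])
  have up: "y < re (\<iota> s) y" if "y \<in> \<Omega>" for y
    using bspec[OF down \<Omega>_invariant[OF t that]] re_inv2[OF s] by simp
  obtain N where N: "B < (re (\<iota> s) ^^ N) z"
    using iterate_exceeds[OF continuous_on_re[OF H_carrier[OF t]] \<Omega>_interval up z B] by blast
  have "B < re (\<iota> s \<up> m) z" if "N \<le> m" for m
    using that
  proof (induction m rule: dec_induct)
    case base
    then show ?case using N re_pow[OF t] by simp
  next
    case (step m)
    have "re (\<iota> s \<up> m) z < re (\<iota> s) (re (\<iota> s \<up> m) z)"
      by (rule up[OF \<Omega>_invariant[OF H_pow[OF t] z]])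
    also have "\<dots> = re (\<iota> s \<up> Suc m) z" unfolding re_pow[OF t] by simp
    finally show ?case using step.IH by simp
  qed
  then show ?thesis by blast
qed

lemma above_jumps:
  assumes f: "f \<in> H" and w: "w \<in> \<Omega>"
  shows "\<exists>B\<in>\<Omega>. \<forall>z\<in>\<Omega>. B < z \<longrightarrow> jump f z = id"
proof -
  define A where "A = insert w ({z. jump f z \<noteq> id} \<inter> \<Omega>)"
  have A: "finite A" "A \<noteq> {}" "A \<subseteq> \<Omega>" using finite_jumps[OF H_carrier[OF f]] w by (auto simp: A_def)
  have "Max A \<in> \<Omega>" using Max_in[OF A(1,2)] A(3) by blast
  moreover have "jump f z = id" if "z \<in> \<Omega>" "Max A < z" for z
  proof (rule ccontr)
    assume "jump f z \<noteq> id"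
    then have "z \<in> A" using that(1) by (simp add: A_def)
    then have "z \<le> Max A" using A(1) by simp
    then show False using that(2) by simp
  qed
  ultimately show ?thesis by blast
qed

text \<open>Once the orbit under \<open>s^(-1)\<close> has passed the last jump \<open>B\<close> of \<open>s^(-1)\<close>, further factors do
  not contribute to the jump.\<close>

lemma jump_pow_stable:
  assumes s: "s \<in> H" and B: "\<forall>z\<in>\<Omega>. B < z \<longrightarrow> jump (\<iota> s) z = id" and g: "g \<in> H" and z: "z \<in> \<Omega>"
    and esc: "\<And>m. N \<le> m \<Longrightarrow> B < re (\<iota> s \<up> (m :: nat)) (re g z)" and m: "N \<le> m"
  shows "jump (\<iota> s \<up> m \<cdot> g) z = jump (\<iota> s \<up> N \<cdot> g) z"
  using m
proof (induction m rule: dec_induct)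
  case (step m)
  have t: "\<iota> s \<in> H" by (rule H_inv[OF s])
  have pg: "\<iota> s \<up> m \<cdot> g \<in> H" by (rule H_mult[OF H_pow[OF t] g])
  have "\<iota> s \<up> Suc m \<cdot> g = \<iota> s \<cdot> (\<iota> s \<up> m \<cdot> g)"
    using Gt.nat_pow_Suc2[OF H_carrier[OF t], of m] Gt.m_assoc[OF H_carrier[OF t] H_carrier[OF H_pow[OF t]] H_carrier[OF g], of m] by simp
  moreover have "jump (\<iota> s) (re (\<iota> s \<up> m \<cdot> g) z) = id"
    using B esc[OF step.hyps(1)] \<Omega>_invariant[OF pg z] re_mult[OF g, of "\<iota> s \<up> m" z] by simp
  ultimately have "jump (\<iota> s \<up> Suc m \<cdot> g) z = jump (\<iota> s \<up> m \<cdot> g) z"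
    using jump_mult_trivial[OF t pg] by simp
  then show ?case using step.IH by simp
qed simp

lemma mult_id: "g \<cdot> id = g"
  by (simp add: Gtilde_simps)

lemma stable_jump_contraction:
  assumes s: "s \<in> H" and down: "\<forall>y\<in>\<Omega>. re s y < y"
  shows "stable_jump s"
  unfolding stable_jump_def
proof
  fix z assume z: "z \<in> \<Omega>"
  obtain B where B: "B \<in> \<Omega>" "\<forall>z\<in>\<Omega>. B < z \<longrightarrow> jump (\<iota> s) z = id" using above_jumps[OF H_inv[OF s] z] by (elim bexE)
  obtain N where N: "\<forall>m\<ge>N. B < re (\<iota> s \<up> (m :: nat)) z" using contraction_escapes[OF s down z B(1)] by (elim exE)
  have "jump (\<iota> s \<up> m) z = jump (\<iota> s \<up> N) z" if "N \<le> m" for m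
    using jump_pow_stable[OF s B(2) H_id z, of N m] N that unfolding mult_id by (simp add: re_id)
  then show "\<exists>v. eventually (\<lambda>m. jump (\<iota> s \<up> (m :: nat)) z = v) sequentially"
    unfolding eventually_sequentially by blast
qed

text \<open>Replacing \<open>m\<close> by \<open>m - j\<close> does not change the limit of the jumps of \<open>s^(-m)\<close>.\<close>

lemma jump_shift_power:
  assumes s: "s \<in> H" and down: "\<forall>y\<in>\<Omega>. re s y < y" and z: "z \<in> \<Omega>"
  shows "eventually (\<lambda>m. jump (\<iota> s \<up> (m :: nat) \<cdot> s \<up> (j :: int)) z = jump (\<iota> s \<up> m) z) sequentially"
proof -
  have sc: "s \<in> carrier Gtilde" by (rule H_carrier[OF s])
  obtain v where v: "eventually (\<lambda>m. jump (\<iota> s \<up> (m :: nat)) z = v) sequentially"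
    using bspec[OF stable_jump_contraction[OF s down, unfolded stable_jump_def] z] by (elim exE)
  then obtain N where N: "\<And>m. N \<le> m \<Longrightarrow> jump (\<iota> s \<up> (m :: nat)) z = v" unfolding eventually_sequentially by blast
  have pw: "\<iota> s \<up> (m :: nat) = s \<up> (- int m)" for m
    using Gt.int_pow_neg[OF sc, of "int m"] Gt.nat_pow_inv[OF sc, of m] by (simp add: int_pow_int)
  have "jump (\<iota> s \<up> m \<cdot> s \<up> j) z = jump (\<iota> s \<up> m) z" if m: "N + nat \<bar>j\<bar> \<le> m" for m
  proof -
    define i where "i = nat (int m - j)"
    have i: "- int m + j = - int i" "N \<le> i" using m unfolding i_def by linarith+
    have "\<iota> s \<up> m \<cdot> s \<up> j = \<iota> s \<up> i"
      unfolding pw Gt.int_pow_mult[OF sc, symmetric] i(1) ..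
    moreover have "N \<le> m" using m by linarith
    ultimately show ?thesis using N[OF i(2)] N[of m] by simp
  qed
  then show ?thesis unfolding eventually_sequentially by blast
qed

lemma bad_contraction_power:
  assumes s: "s \<in> H" and down: "\<forall>y\<in>\<Omega>. re s y < y"
  shows "bad s (s \<up> (j :: int)) = {}"
  unfolding bad_def using jump_shift_power[OF s down] by blast

text \<open>Close to the end \<open>y\<close> agrees with a power of \<open>s\<close>, which has no effect on the limit. The
  points away from the end, and their images under \<open>y\<close>, have all left the jumps of \<open>s^(-1)\<close>
  behind after a common number \<open>N\<close> of steps, because the maps are increasing. There the
  limit is attained at \<open>m = N\<close>, and only the finitely many jumps of \<open>s^(-N) y\<close> and \<open>s^(-N)\<close>
  matter.\<close>

lemma finite_bad_contraction:
  assumes s: "s \<in> H" and down: "\<forall>y\<in>\<Omega>. re s y < y"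
    and gen: "\<forall>h\<in>H. \<exists>j::int. germ F h = germ F (s \<up> j)" and w: "w \<in> \<Omega>" and y: "y \<in> H"
  shows "finite (bad s y)"
proof -
  have t: "\<iota> s \<in> H" by (rule H_inv[OF s])
  obtain j :: int where j: "germ F y = germ F (s \<up> j)" using bspec[OF gen y] by (elim exE)
  obtain d0 where d0: "d0 \<in> D" "\<forall>x\<in>D. x < d0 \<longrightarrow> re y x = re (s \<up> j) x"
    using re_eq_of_germ[OF y H_int_pow[OF s] j] by (elim bexE)
  define d where "d = min d0 w"
  have d: "d \<in> \<Omega>" using \<Omega>_down[OF w, of d] d0(1) \<Omega>_D[OF w] by (simp add: d_def min_def split: if_splits)
  obtain B where B: "B \<in> \<Omega>" "\<forall>z\<in>\<Omega>. B < z \<longrightarrow> jump (\<iota> s) z = id" using above_jumps[OF t w] by (elim bexE)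
  obtain N1 where N1: "\<forall>m\<ge>N1. B < re (\<iota> s \<up> (m :: nat)) d" using contraction_escapes[OF s down d B(1)] by (elim exE)
  obtain N2 where N2: "\<forall>m\<ge>N2. B < re (\<iota> s \<up> (m :: nat)) (re y d)"
    using contraction_escapes[OF s down \<Omega>_invariant[OF y d] B(1)] by (elim exE)
  define N where "N = max N1 N2"
  define R where "R = \<iota> s \<up> N"
  have R: "R \<in> H" unfolding R_def by (rule H_pow[OF t])
  have "bad s y \<subseteq> {z. jump (R \<cdot> y) z \<noteq> id} \<union> {z. jump R z \<noteq> id}"
  proof
    fix z assume zb: "z \<in> bad s y"
    then have z: "z \<in> \<Omega>" and not_ev: "\<not> eventually (\<lambda>m. jump (\<iota> s \<up> (m :: nat) \<cdot> y) z = jump (\<iota> s \<up> m) z) sequentially"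
      unfolding bad_def by blast+
    \<comment> \<open>The points close to the end are those to the left of \<open>d\<close>.\<close>
    show "z \<in> {z. jump (R \<cdot> y) z \<noteq> id} \<union> {z. jump R z \<noteq> id}"
    proof (cases "z < d")
      case True
      obtain u where u: "u \<in> D" "u < z" using D_no_min[OF \<Omega>_D[OF z]] by blast
      have agree: "y (Some x) = (s \<up> j) (Some x)" if "u < x" "x < d" for x
      proof -
        have "x \<in> D" using D_up[OF u(1)] that(1) by simp
        then have "re y x = re (s \<up> j) x" using d0(2) that(2) by (simp add: d_def)
        then show ?thesis by (simp add: Gtilde_Some[OF H_carrier] y H_int_pow[OF s])
      qed
      have "jump (\<iota> s \<up> m \<cdot> y) z = jump (\<iota> s \<up> m \<cdot> s \<up> j) z" for m :: nat
      proof (rule jump_cong[OF H_carrier[OF H_mult[OF H_pow[OF t] H_int_pow[OF s]]] u(2) True])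
        fix x assume x: "u < x" "x < d"
        show "(\<iota> s \<up> m \<cdot> y) (Some x) = (\<iota> s \<up> m \<cdot> s \<up> j) (Some x)"
          unfolding Gtilde_simps comp_apply agree[OF x] ..
      qed
      then have False using not_ev jump_shift_power[OF s down z, of j] by simp
      then show ?thesis ..
    next
      case False
      have e1: "B < re (\<iota> s \<up> m) z" if "N \<le> m" for m
      proof -
        have "B < re (\<iota> s \<up> m) d" using N1 that by (simp add: N_def)
        also have "\<dots> \<le> re (\<iota> s \<up> m) z" using False re_le[OF H_pow[OF t]] by simp
        finally show ?thesis .
      qed
      have e2: "B < re (\<iota> s \<up> m) (re y z)" if "N \<le> m" for m
      proof -
        have "B < re (\<iota> s \<up> m) (re y d)" using N2 that by (simp add: N_def)
        also have "\<dots> \<le> re (\<iota> s \<up> m) (re y z)" using False re_le[OF H_pow[OF t]] re_le[OF y] by simp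
        finally show ?thesis .
      qed
      have c1: "jump (\<iota> s \<up> m) z = jump R z" if "N \<le> m" for m
        using jump_pow_stable[OF s B(2) H_id z, of N m] e1 that unfolding mult_id R_def by (simp add: re_id)
      have c2: "jump (\<iota> s \<up> m \<cdot> y) z = jump (R \<cdot> y) z" if "N \<le> m" for m
        using jump_pow_stable[OF s B(2) y z, of N m] e2 that unfolding R_def by simp
      have "jump (R \<cdot> y) z \<noteq> jump R z"
      proof
        assume eq: "jump (R \<cdot> y) z = jump R z"
        have "jump (\<iota> s \<up> m \<cdot> y) z = jump (\<iota> s \<up> m) z" if "N \<le> m" for m
          unfolding c1[OF that] c2[OF that] by (rule eq)
        then have "eventually (\<lambda>m. jump (\<iota> s \<up> (m :: nat) \<cdot> y) z = jump (\<iota> s \<up> m) z) sequentially"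
          unfolding eventually_sequentially by (intro exI allI impI)
        with not_ev show False by contradiction
      qed
      then show ?thesis by auto
    qed
  qed
  moreover have "finite ({z. jump (R \<cdot> y) z \<noteq> id} \<union> {z. jump R z \<noteq> id})"
    using finite_jumps[OF H_carrier[OF R]] finite_jumps[OF H_carrier[OF H_mult[OF R y]]] by simp
  ultimately show ?thesis by (rule finite_subset)
qed

section \<open>Binary levels in an orbit\<close>

definition binary_levels ::
    "real \<Rightarrow> (nat \<Rightarrow> real set) \<Rightarrow> (nat \<Rightarrow> real option \<Rightarrow> real option) \<Rightarrow> (nat \<Rightarrow> real option \<Rightarrow> real option) \<Rightarrow> bool" where
  "binary_levels a L p q \<longleftrightarrow> L 0 = {a} \<and> (\<forall>n. L (Suc n) = re (p n) ` L n \<union> re (q n) ` L n) \<and> (\<forall>n. card (L n) = 2 ^ n)"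

lemma inj_re: "h \<in> H \<Longrightarrow> inj (re h)"
  using bij_re[OF H_carrier] by (rule bij_is_inj)

text \<open>The two images of an invariant set are disjoint, so the \<open>2 ^ n\<close> words of length \<open>n\<close> send
  \<open>a\<close> to distinct points.\<close>

lemma binary_levels_ping_pong:
  assumes g: "g1 \<in> H" "g2 \<in> H" and a: "a \<in> J"
    and J: "re g1 ` J \<subseteq> J" "re g2 ` J \<subseteq> J" "re g1 ` J \<inter> re g2 ` J = {}"
  shows "\<exists>L. binary_levels a L (\<lambda>_. g1) (\<lambda>_. g2)"
proof -
  define L where "L n = ((\<lambda>A. re g1 ` A \<union> re g2 ` A) ^^ n) {a}" for n
  have L: "L 0 = {a}" "\<And>n. L (Suc n) = re g1 ` L n \<union> re g2 ` L n" by (simp_all add: L_def)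
  have sub: "L n \<subseteq> J" for n
  proof (induction n)
    case (Suc n)
    have "re g1 ` L n \<subseteq> re g1 ` J" "re g2 ` L n \<subseteq> re g2 ` J" using Suc by (rule image_mono)+
    then show ?case using J(1,2) unfolding L(2) by blast
  qed (simp add: L a)
  have "finite (L n) \<and> card (L n) = 2 ^ n" for n
  proof (induction n)
    case (Suc n)
    have "re g1 ` L n \<inter> re g2 ` L n \<subseteq> re g1 ` J \<inter> re g2 ` J" using sub[of n] by blast
    then have "re g1 ` L n \<inter> re g2 ` L n = {}" using J(3) by blast
    moreover have "card (re g1 ` L n) = 2 ^ n" "card (re g2 ` L n) = 2 ^ n"
      using Suc inj_re[OF g(1)] inj_re[OF g(2)] by (simp_all add: card_image inj_on_subset)
    ultimately have "card (re g1 ` L n \<union> re g2 ` L n) = 2 * 2 ^ n"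
      using Suc by (subst card_Un_disjoint) simp_all
    then show ?case using Suc unfolding L(2) by simp
  qed (simp add: L)
  then show ?thesis unfolding binary_levels_def using L by blast
qed

text \<open>The level \<open>n\<close> consists of the points \<open>s^i a\<close> with \<open>i < 2 ^ n\<close>; the map \<open>s^(2 ^ n)\<close> doubles
  the range of exponents.\<close>

lemma binary_levels_powers:
  assumes s: "s \<in> H" and a: "a \<in> \<Omega>" and down: "\<forall>y\<in>\<Omega>. re s y < y"
  shows "\<exists>L. binary_levels a L (\<lambda>_. id) (\<lambda>n. s \<up> ((2 :: nat) ^ n))"
proof -
  define L where "L n = (\<lambda>i. (re s ^^ i) a) ` {..<(2 :: nat) ^ n}" for n
  have dec: "(re s ^^ Suc i) a < (re s ^^ i) a" for i
  proof -
    have "re (s \<up> i) a \<in> \<Omega>" by (rule \<Omega>_invariant[OF H_pow[OF s] a])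
    then show ?thesis using down re_pow[OF s] by simp
  qed
  have mono: "strict_mono (\<lambda>i. - (re s ^^ i) a)"
    unfolding strict_mono_Suc_iff using dec by simp
  have inj: "inj (\<lambda>i. (re s ^^ i) a)"
  proof (rule injI)
    fix i j assume "(re s ^^ i) a = (re s ^^ j) a"
    then have "- (re s ^^ i) a = - (re s ^^ j) a" by (rule arg_cong)
    then show "i = j" using strict_mono_eq[OF mono] by blast
  qed
  have "card (L n) = 2 ^ n" for n
    unfolding L_def using inj by (simp add: card_image inj_on_subset)
  moreover have "L 0 = {a}" by (simp add: L_def lessThan_Suc)
  moreover have "L (Suc n) = re id ` L n \<union> re (s \<up> ((2 :: nat) ^ n)) ` L n" for n
  proof -
    let ?f = "\<lambda>i. (re s ^^ i) a"
    have 1: "re id ` L n = L n" by (simp add: re_id image_def)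
    have 2: "re (s \<up> ((2 :: nat) ^ n)) ` L n = ?f ` ((+) (2 ^ n) ` {..<2 ^ n})"
      unfolding L_def image_image re_pow[OF s] by (simp add: funpow_add)
    have 3: "{..<2 ^ Suc n} = {..<2 ^ n} \<union> (+) (2 ^ n) ` {..<(2 :: nat) ^ n}"
    proof
      show "{..<2 ^ Suc n} \<subseteq> {..<2 ^ n} \<union> (+) (2 ^ n) ` {..<(2 :: nat) ^ n}"
      proof
        fix i :: nat assume i: "i \<in> {..<2 ^ Suc n}"
        show "i \<in> {..<2 ^ n} \<union> (+) (2 ^ n) ` {..<(2 :: nat) ^ n}"
        proof (cases "i < 2 ^ n")
          case False
          then have "i = 2 ^ n + (i - 2 ^ n)" "i - 2 ^ n < 2 ^ n" using i by auto
          then show ?thesis by (intro UnI2 image_eqI[of i "(+) (2 ^ n)" "i - 2 ^ n"]) simp_all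
        qed simp
      qed
    qed auto
    show ?thesis unfolding 1 2 unfolding L_def 3 image_Un ..
  qed
  ultimately show ?thesis unfolding binary_levels_def by blast
qed

lemma conjugate_agrees:
  assumes s: "s \<in> H" and h: "h \<in> H"
  shows "germ F (h \<cdot> s \<cdot> \<iota> h) = germ F s"
proof -
  note hi = H_inv[OF h] and hs = H_mult[OF h s]
  have "germ F (h \<cdot> s \<cdot> \<iota> h) = germ F (\<iota> h \<cdot> (h \<cdot> s))" by (rule germs_commute[OF hs hi])
  also have "\<iota> h \<cdot> (h \<cdot> s) = s"
    using Gt.m_assoc[OF H_carrier[OF hi] H_carrier[OF h] H_carrier[OF s], symmetric]
      Gt.l_inv[OF H_carrier[OF h]] Gt.l_one[OF H_carrier[OF s]] by simp
  finally show ?thesis .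
qed

text \<open>Choose \<open>h\<close> with \<open>c < h c\<close>. The conjugate \<open>s' = h s h^(-1)\<close> has the same germ at the end as
  \<open>s\<close>, and \<open>s' c < c\<close>. So \<open>\<psi> = s^(-1) s'\<close> fixes all points \<open>u\<close> near the end, and
  \<open>\<psi> c = e < c\<close>. A power \<open>t = s^(-m)\<close> fixes \<open>c\<close> and moves \<open>u\<close> beyond \<open>e\<close> and \<open>a\<close>. On the
  interval \<open>J\<close> from \<open>u\<close> to \<open>t e\<close> the map \<open>\<psi>\<close> has its values between \<open>u\<close> and \<open>e\<close>, and \<open>t \<psi>\<close>
  has its values between \<open>t u > e\<close> and \<open>t e\<close>.\<close>

lemma ping_pong:
  assumes s: "s \<in> H" and c: "c \<in> \<Omega>" "re s c = c" and down: "\<And>y. y \<in> D \<Longrightarrow> y < c \<Longrightarrow> re s y < y"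
    and a: "a \<in> D" "a < c"
  shows "\<exists>g1\<in>H. \<exists>g2\<in>H. \<exists>J. a \<in> J \<and> re g1 ` J \<subseteq> J \<and> re g2 ` J \<subseteq> J \<and> re g1 ` J \<inter> re g2 ` J = {}"
proof -
  have "\<exists>h\<in>H. c < re h c"
  proof -
    obtain h where h: "h \<in> H" "re h c \<noteq> c" using \<Omega>_moved[OF c(1)] by blast
    show ?thesis
    proof (cases "c < re h c")
      case False
      then have "re h c < c" using h(2) by simp
      then have "re (\<iota> h) (re h c) < re (\<iota> h) c" using re_less[OF H_inv[OF h(1)]] by simp
      then show ?thesis using re_inv1[OF h(1)] H_inv[OF h(1)] by (intro bexI[of _ "\<iota> h"]) simp_all
    qed (use h in blast)
  qed
  then obtain h where h: "h \<in> H" "c < re h c" by blast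
  note hi = H_inv[OF h(1)] and si = H_inv[OF s]
  define s' where "s' = h \<cdot> s \<cdot> \<iota> h"
  have s': "s' \<in> H" unfolding s'_def by (rule H_mult[OF H_mult[OF h(1) s] hi])
  have re_s': "re s' y = re h (re s (re (\<iota> h) y))" for y
    unfolding s'_def re_mult[OF hi] re_mult[OF s] ..
  have s'c: "re s' c < c"
  proof -
    have "re (\<iota> h) c < re (\<iota> h) (re h c)" using h(2) re_less[OF hi] by simp
    then have "re (\<iota> h) c < c" using re_inv1[OF h(1)] by simp
    then have "re s (re (\<iota> h) c) < re (\<iota> h) c" by (rule down[OF D_invariant[OF hi \<Omega>_D[OF c(1)]]])
    then have "re s' c < re h (re (\<iota> h) c)" unfolding re_s' using re_less[OF h(1)] by simp
    then show ?thesis using re_inv2[OF h(1)] by simp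
  qed
  obtain d where d: "d \<in> D" "\<forall>y\<in>D. y < d \<longrightarrow> re s' y = re s y"
    using re_eq_of_germ[OF s' s conjugate_agrees[OF s h(1), folded s'_def]] by (elim bexE)
  define \<psi> where "\<psi> = \<iota> s \<cdot> s'"
  have \<psi>: "\<psi> \<in> H" unfolding \<psi>_def by (rule H_mult[OF si s'])
  have re_\<psi>: "re \<psi> y = re (\<iota> s) (re s' y)" for y unfolding \<psi>_def by (rule re_mult[OF s'])
  define e where "e = re \<psi> c"
  have inv_c: "re (\<iota> s) c = c" using re_inv1[OF s, of c] c(2) by simp
  have "re (\<iota> s) (re s' c) < re (\<iota> s) c" using s'c re_less[OF si] by simp
  then have ec: "e < c" unfolding e_def re_\<psi> inv_c .
  have eD: "e \<in> D" unfolding e_def by (rule D_invariant[OF \<psi> \<Omega>_D[OF c(1)]])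
  have "min d (min a e) \<in> D" using d(1) a(1) eD by (simp add: min_def)
  then obtain u where u: "u \<in> D" "u < min d (min a e)" using D_no_min by blast
  have \<psi>u: "re \<psi> u = u" unfolding re_\<psi> using d(2) u re_inv1[OF s] by simp
  have up: "y < re (\<iota> s) y" if "y \<in> {y \<in> D. y < c}" for y
  proof -
    have y: "y \<in> D" "y < c" using that by simp_all
    have "re (\<iota> s) (re s y) < re (\<iota> s) y" using down[OF y] re_less[OF si] by simp
    then show ?thesis using re_inv1[OF s] by simp
  qed
  have int: "is_interval {y \<in> D. y < c}"
    by (rule is_intervalI) (use D_up in auto)
  have "u \<in> {y \<in> D. y < c}" "max e a \<in> {y \<in> D. y < c}" using u ec a eD by (auto simp: max_def)
  from iterate_exceeds[OF continuous_on_re[OF H_carrier[OF si]] int up this]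
  obtain m where m: "max e a < (re (\<iota> s) ^^ m) u" by blast
  define t where "t = \<iota> s \<up> m"
  have t: "t \<in> H" unfolding t_def by (rule H_pow[OF si])
  have tu: "e < re t u" "a < re t u" using m unfolding t_def re_pow[OF si] by simp_all
  have tc: "re t c = c"
  proof -
    have "(re (\<iota> s) ^^ m) c = c" by (induction m) (simp_all add: inv_c)
    then show ?thesis unfolding t_def re_pow[OF si] .
  qed
  define v where "v = re t e"
  have vc: "v < c" using ec re_less[OF t, of e c] tc by (simp add: v_def)
  have tu_v: "re t u < v" using u re_less[OF t] by (simp add: v_def)
  define g2 where "g2 = t \<cdot> \<psi>"
  have g2: "g2 \<in> H" unfolding g2_def by (rule H_mult[OF t \<psi>])
  define J where "J = {u..v}"
  have \<psi>J: "u \<le> re \<psi> y \<and> re \<psi> y < e" if "y \<in> J" for y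
  proof -
    have "re \<psi> u \<le> re \<psi> y" using that re_le[OF \<psi>] by (simp add: J_def)
    moreover have "re \<psi> y < re \<psi> c" using that vc re_less[OF \<psi>] by (simp add: J_def)
    ultimately show ?thesis unfolding \<psi>u e_def by simp
  qed
  have g2J: "re t u \<le> re g2 y \<and> re g2 y < v" if "y \<in> J" for y
    using \<psi>J[OF that] re_le[OF t] re_less[OF t] unfolding g2_def re_mult[OF \<psi>] v_def by simp
  have "a \<in> J" using u tu tu_v by (simp add: J_def)
  moreover have "re \<psi> ` J \<subseteq> J"
  proof
    fix x assume "x \<in> re \<psi> ` J"
    then obtain y where "y \<in> J" "x = re \<psi> y" by blast
    then show "x \<in> J" using \<psi>J[of y] tu tu_v unfolding J_def by simp
  qed
  moreover have "re g2 ` J \<subseteq> J"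
  proof
    fix x assume "x \<in> re g2 ` J"
    then obtain y where "y \<in> J" "x = re g2 y" by blast
    then show "x \<in> J" using g2J[of y] tu u unfolding J_def by simp
  qed
  moreover have "re \<psi> ` J \<inter> re g2 ` J = {}"
  proof (rule equals0I)
    fix x assume "x \<in> re \<psi> ` J \<inter> re g2 ` J"
    then obtain y y' where "y \<in> J" "y' \<in> J" "x = re \<psi> y" "x = re g2 y'" by blast
    then show False using \<psi>J[of y] g2J[of y'] tu by simp
  qed
  ultimately show ?thesis using \<psi> g2 by blast
qed

text \<open>The fixed points in \<open>D\<close> form a closed set, because they stay away from the end.\<close>

lemma first_fixed_point:
  assumes s: "s \<in> H" and d: "d \<in> D" "\<And>y. y \<in> D \<Longrightarrow> y < d \<Longrightarrow> re s y < y"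
    and c': "c' \<in> \<Omega>" "re s c' = c'"
  shows "\<exists>c\<in>\<Omega>. re s c = c \<and> (\<forall>y\<in>D. y < c \<longrightarrow> re s y < y)"
proof -
  define A where "A = {y \<in> D. re s y = y}"
  have A: "c' \<in> A" using c' \<Omega>_D by (simp add: A_def)
  have lb: "d \<le> y" if "y \<in> A" for y
  proof (rule ccontr)
    assume "\<not> d \<le> y"
    then show False using d(2)[of y] that by (simp add: A_def)
  qed
  have bdd: "bdd_below A" using lb by (rule bdd_belowI)
  define c where "c = Inf A"
  have dc: "d \<le> c" unfolding c_def using A lb by (intro cInf_greatest) auto
  then have cD: "c \<in> D" by (rule D_up[OF d(1)])
  have cc': "c \<le> c'" unfolding c_def using A bdd by (rule cInf_lower)
  have c: "c \<in> \<Omega>" by (rule \<Omega>_down[OF c'(1) cD cc'])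
  have cont: "continuous_on UNIV (re s)" by (rule continuous_on_re[OF H_carrier[OF s]])
  have "A = {y. re s y = y} \<inter> {d..}" using lb D_up[OF d(1)] by (auto simp: A_def)
  moreover have "closed {y. re s y = y}" using cont by (intro closed_Collect_eq) (auto intro: continuous_on_id)
  ultimately have "closed A" by (simp add: closed_Int)
  then have "c \<in> A" unfolding c_def using A bdd by (intro closed_contains_Inf) auto
  then have fix_c: "re s c = c" by (simp add: A_def)
  have nofix: "re s y \<noteq> y" if "y \<in> {y \<in> D. y < c}" for y
  proof
    assume "re s y = y"
    then have "y \<in> A" using that by (simp add: A_def)
    then have "c \<le> y" unfolding c_def using bdd by (rule cInf_lower)
    then show False using that by simp
  qed
  have int: "is_interval {y \<in> D. y < c}"
    by (rule is_intervalI) (use D_up in auto)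
  obtain y0 where y0: "y0 \<in> D" "y0 < d" using D_no_min[OF d(1)] by blast
  have "re s y < y" if "y \<in> D" "y < c" for y
    using no_fixed_point_below[OF cont int nofix, of y0 y] y0 d(2)[OF y0] dc that by simp
  then show ?thesis using c fix_c by blast
qed

text \<open>Two cases: a generator \<open>s\<close> of the germs that contracts near the end either has a fixed
  point in the component or contracts all of it. In the first case the walk needs the two
  elements of a ping-pong only, and the jumps themselves can be used (\<open>r = id\<close>); the point
  \<open>a\<close> is first moved to the left of the fixed point. In the second case \<open>r = s\<close>, and \<open>r\<close>
  contributes no bad points.\<close>

lemma dynamics_core:
  assumes nonab: "g \<in> H" "h \<in> H" "x \<in> \<Omega>" "re (g \<cdot> h) x \<noteq> re (h \<cdot> g) x"
  shows "\<exists>a\<in>\<Omega>. \<exists>k\<in>H. \<exists>r\<in>H. \<exists>W L p q. re k a = a \<and> germ (at_left a) k = id \<and> germ (at_right a) k \<noteq> id \<and>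
    stable_jump r \<and> (\<forall>y\<in>H. finite (bad r y)) \<and> (\<forall>j::int. bad r (r \<up> j) = {}) \<and>
    finite W \<and> W \<subseteq> H \<and> binary_levels a L p q \<and>
    (\<forall>n. p n \<in> insert (r \<up> ((2::nat) ^ n)) W) \<and> (\<forall>n. q n \<in> insert (r \<up> ((2::nat) ^ n)) W)"
proof -
  obtain k a where ka: "k \<in> H" "a \<in> \<Omega>" "re k a = a" "germ (at_left a) k = id" "germ (at_right a) k \<noteq> id"
    using exists_left_jump[OF nonab] by blast
  have ne: "\<Omega> \<noteq> {}" using ka(2) by blast
  obtain s d where s: "s \<in> H" "\<forall>h\<in>H. \<exists>j::int. germ F h = germ F (s \<up> j)"
    and d: "d \<in> D" "\<And>y. y \<in> D \<Longrightarrow> y < d \<Longrightarrow> re s y < y"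
    using contracting_generator[OF ne] by blast
  show ?thesis
  proof (cases "\<exists>c\<in>\<Omega>. re s c = c")
    case True
    then obtain c where c: "c \<in> \<Omega>" "re s c = c" "\<forall>y\<in>D. y < c \<longrightarrow> re s y < y"
      using first_fixed_point[OF s(1) d] by blast
    \<comment> \<open>Conjugation moves the jump to a point \<open>a'\<close> below the first fixed point \<open>c\<close>.\<close>
    obtain f where f: "f \<in> H" "re f a < c" using orbit_descends[OF ka(2) \<Omega>_D[OF c(1)]] by blast
    define a' where "a' = re f a"
    define k' where "k' = f \<cdot> k \<cdot> \<iota> f"
    have k': "k' \<in> H" unfolding k'_def by (rule H_mult[OF H_mult[OF f(1) ka(1)] H_inv[OF f(1)]])
    have a': "a' \<in> \<Omega>" unfolding a'_def by (rule \<Omega>_invariant[OF f(1) ka(2)])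
    have jump': "re k' a' = a'" "germ (at_left a') k' = id" "germ (at_right a') k' \<noteq> id"
      unfolding k'_def a'_def using conjugate_left_jump[OF ka(1,3,4,5) f(1)] by blast+
    obtain g1 g2 J where g: "g1 \<in> H" "g2 \<in> H" and J: "a' \<in> J" "re g1 ` J \<subseteq> J" "re g2 ` J \<subseteq> J" "re g1 ` J \<inter> re g2 ` J = {}"
      using ping_pong[OF s(1) c(1,2) _ \<Omega>_D[OF a'], unfolded a'_def, OF _ f(2)] c(3) unfolding a'_def by blast
    obtain L where L: "binary_levels a' L (\<lambda>_. g1) (\<lambda>_. g2)" using binary_levels_ping_pong[OF g J] by (rule exE)
    show ?thesis
    proof (rule bexI[OF _ a'], rule bexI[OF _ k'], rule bexI[OF _ H_id], intro exI conjI)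
      show "\<forall>y\<in>H. finite (bad id y)" by (rule ballI) (rule finite_bad_id)
      show "\<forall>j::int. bad id (id \<up> j) = {}" by (rule allI) (rule bad_id_pow)
      show "stable_jump id" by (rule stable_jump_id)
      show "binary_levels a' L (\<lambda>_. g1) (\<lambda>_. g2)" by (rule L)
      show "finite {g1, g2}" by simp
      show "{g1, g2} \<subseteq> H" using g by simp
    qed (use jump' in simp_all)
  next
    case False
    have int: "is_interval \<Omega>" by (rule \<Omega>_interval)
    have cont: "continuous_on UNIV (re s)" by (rule continuous_on_re[OF H_carrier[OF s(1)]])
    have "min d a \<in> D" using d(1) \<Omega>_D[OF ka(2)] by (simp add: min_def)
    then obtain y0 where y0: "y0 \<in> D" "y0 < min d a" using D_no_min by blast
    have y0\<Omega>: "y0 \<in> \<Omega>" using \<Omega>_down[OF ka(2) y0(1)] y0(2) by simp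
    have y0_less: "re s y0 < y0" using d(2)[OF y0(1)] y0(2) by simp
    have nofix: "re s y \<noteq> y" if y: "y \<in> \<Omega>" for y
    proof
      assume "re s y = y"
      then have "\<exists>c\<in>\<Omega>. re s c = c" using y by (rule bexI)
      with False show False by contradiction
    qed
    have down: "\<forall>y\<in>\<Omega>. re s y < y"
      by (rule ballI) (rule no_fixed_point_below[OF cont int nofix y0\<Omega> y0_less])
    obtain L where L: "binary_levels a L (\<lambda>_. id) (\<lambda>n. s \<up> ((2 :: nat) ^ n))"
      using binary_levels_powers[OF s(1) ka(2) down] by (rule exE)
    show ?thesis
    proof (rule bexI[OF _ ka(2)], rule bexI[OF _ ka(1)], rule bexI[OF _ s(1)], intro exI conjI)
      show "\<forall>y\<in>H. finite (bad s y)" by (rule ballI) (rule finite_bad_contraction[OF s(1) down s(2) ka(2)])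
      show "\<forall>j::int. bad s (s \<up> j) = {}" by (rule allI) (rule bad_contraction_power[OF s(1) down])
      show "stable_jump s" by (rule stable_jump_contraction[OF s(1) down])
      show "binary_levels a L (\<lambda>_. id) (\<lambda>n. s \<up> ((2 :: nat) ^ n))" by (rule L)
      show "finite {id :: real option \<Rightarrow> real option}" by simp
      show "{id} \<subseteq> H" using H_id by simp
    qed (use ka in simp_all)
  qed
qed

end

section \<open>Words\<close>

context group
begin

text \<open>The words over \<open>S\<close> and its inverses, in the form in which \<open>word_length\<close> counts them.\<close>

definition word :: "'a set \<Rightarrow> 'a list \<Rightarrow> 'a \<Rightarrow> bool" where
  "word S ws g \<longleftrightarrow> set ws \<subseteq> S \<union> (\<lambda>s. inv s) ` S \<and> foldr (\<lambda>x y. x \<otimes> y) ws \<one> = g"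

lemma word_length_le: "word S ws g \<Longrightarrow> word_length G S g \<le> length ws"
  unfolding word_length_def word_def by (rule Least_le) blast

lemma foldr_closed: "set ws \<subseteq> carrier G \<Longrightarrow> foldr (\<lambda>x y. x \<otimes> y) ws \<one> \<in> carrier G"
  by (induction ws) simp_all

lemma letters_closed: "S \<subseteq> carrier G \<Longrightarrow> S \<union> (\<lambda>s. inv s) ` S \<subseteq> carrier G"
  by auto

lemma foldr_append_mult:
  "set us \<subseteq> carrier G \<Longrightarrow> set vs \<subseteq> carrier G \<Longrightarrow>
    foldr (\<lambda>x y. x \<otimes> y) (us @ vs) \<one> = foldr (\<lambda>x y. x \<otimes> y) us \<one> \<otimes> foldr (\<lambda>x y. x \<otimes> y) vs \<one>"
proof (induction us)
  case Nil
  then show ?case by (simp add: foldr_closed)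
next
  case (Cons u us)
  then show ?case using foldr_closed[of us] foldr_closed[of vs] by (simp add: m_assoc)
qed

lemma word_append:
  assumes S: "S \<subseteq> carrier G" and u: "word S us g" and v: "word S vs h"
  shows "word S (us @ vs) (g \<otimes> h)"
proof -
  have "set us \<subseteq> carrier G" "set vs \<subseteq> carrier G" using u v letters_closed[OF S] unfolding word_def by blast+
  from foldr_append_mult[OF this] show ?thesis using u v unfolding word_def by (simp del: foldr_append)
qed

lemma word_inverse:
  assumes S: "S \<subseteq> carrier G" and w: "word S ws g"
  shows "\<exists>vs. length vs = length ws \<and> word S vs (inv g)"
  using w
proof (induction ws arbitrary: g)
  case Nil
  then show ?case by (intro exI[of _ "[]"]) (auto simp: word_def)
next
  case (Cons u us)
  define h where "h = foldr (\<lambda>x y. x \<otimes> y) us \<one>"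
  have u: "u \<in> S \<union> (\<lambda>s. inv s) ` S" and us: "word S us h" and g: "g = u \<otimes> h"
    using Cons.prems by (simp_all add: word_def h_def)
  have uc: "u \<in> carrier G" using u letters_closed[OF S] by blast
  have "set us \<subseteq> carrier G" using us letters_closed[OF S] unfolding word_def by blast
  then have hc: "h \<in> carrier G" unfolding h_def by (rule foldr_closed)
  obtain vs where vs: "length vs = length us" "word S vs (inv h)" using Cons.IH[OF us] by blast
  have "inv u \<in> S \<union> (\<lambda>s. inv s) ` S" using u S by auto
  then have "word S [inv u] (inv u)" using uc by (simp add: word_def)
  from word_append[OF S vs(2) this] have "word S (vs @ [inv u]) (inv g)"
    unfolding g using uc hc by (simp add: inv_mult_group)
  then show ?case using vs(1) by (intro exI[of _ "vs @ [inv u]"]) simp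
qed

lemma word_generate:
  assumes S: "S \<subseteq> carrier G" and g: "g \<in> generate G S"
  shows "\<exists>ws. word S ws g"
  using g
proof (induction rule: generate.induct)
  case one
  show ?case by (rule exI[of _ "[]"]) (simp add: word_def)
next
  case (incl h)
  then show ?case using S by (intro exI[of _ "[h]"]) (auto simp: word_def)
next
  case (inv h)
  then have "h \<in> carrier G" using S by blast
  then show ?case using inv by (intro exI[of _ "[inv h]"]) (simp add: word_def)
next
  case (eng g h)
  then show ?case using word_append[OF S] by blast
qed

lemma countable_generate:
  assumes S: "S \<subseteq> carrier G" and fin: "finite S"
  shows "countable (generate G S)"
proof -
  have "generate G S \<subseteq> (\<lambda>ws. foldr (\<lambda>x y. x \<otimes> y) ws \<one>) ` lists (S \<union> (\<lambda>s. inv s) ` S)"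
  proof
    fix g assume "g \<in> generate G S"
    then obtain ws where "word S ws g" using word_generate[OF S] by blast
    then show "g \<in> (\<lambda>ws. foldr (\<lambda>x y. x \<otimes> y) ws \<one>) ` lists (S \<union> (\<lambda>s. inv s) ` S)"
      unfolding word_def by (intro image_eqI[of _ _ ws]) auto
  qed
  moreover have "countable (lists (S \<union> (\<lambda>s. inv s) ` S))"
    using fin by (intro countable_lists countable_finite) simp
  ultimately show ?thesis using countable_image countable_subset by blast
qed

lemma word_length_pow:
  assumes S: "S \<subseteq> carrier G" and w: "word S ws g" and gc: "g \<in> carrier G"
  shows "word_length G S (g [^] (n :: nat)) \<le> n * length ws" "word_length G S (inv (g [^] n)) \<le> n * length ws"
proof -
  have "\<exists>vs. length vs = n * length ws \<and> word S vs (g [^] n)" for n :: nat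
  proof (induction n)
    case 0
    show ?case by (rule exI[of _ "[]"]) (simp add: word_def)
  next
    case (Suc n)
    then obtain vs where "length vs = n * length ws" "word S vs (g [^] n)" by blast
    then show ?case using word_append[OF S _ w, of vs "g [^] n"] by (intro exI[of _ "vs @ ws"]) simp
  qed
  then obtain vs where vs: "length vs = n * length ws" "word S vs (g [^] n)" by blast
  then show "word_length G S (g [^] n) \<le> n * length ws" using word_length_le[OF vs(2)] by simp
  obtain us where us: "length us = length vs" "word S us (inv (g [^] n))" using word_inverse[OF S vs(2)] by blast
  then show "word_length G S (inv (g [^] n)) \<le> n * length ws" using word_length_le[OF us(2)] vs(1) by simp
qed

end

section \<open>A step distribution with dyadic powers\<close>

text \<open>The elements of the list \<open>l\<close> and the powers \<open>r ^ (2 ^ n)\<close>, enumerated in this order, are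
  steps with geometric weights. The ratio \<open>2 powr (- \<sigma>)\<close> makes the weight of \<open>r ^ (2 ^ n)\<close>
  proportional to the power \<open>- \<sigma>\<close> of the exponent \<open>2 ^ n\<close>.\<close>

locale dyadic_steps = group G for G (structure) +
  fixes l :: "'a list" and r :: 'a and \<sigma> :: real
  assumes l_carrier: "set l \<subseteq> carrier G" and r_carrier: "r \<in> carrier G"
    and \<sigma>: "0 < \<sigma>" "\<sigma> < 1" and countable_G: "countable (carrier G)"
begin

definition step :: "nat \<Rightarrow> 'a" where
  "step i = (if i < length l then l ! i else r [^] ((2 :: nat) ^ (i - length l)))"

definition signed_step :: "nat \<times> bool \<Rightarrow> 'a" where
  "signed_step = (\<lambda>(i, b). if b then step i else inv (step i))"

definition ratio :: real where "ratio = 2 powr (- \<sigma>)"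

text \<open>The independent fair sign makes the distribution of the steps symmetric.\<close>

definition index_pmf :: "(nat \<times> bool) pmf" where
  "index_pmf = pair_pmf (geometric_pmf (1 - ratio)) (bernoulli_pmf (1 / 2))"

definition step_measure :: "'a measure" where
  "step_measure = distr (measure_pmf index_pmf) (count_space (carrier G)) signed_step"

lemma ratio: "0 < ratio" "ratio < 1" "1 < 2 * ratio"
proof -
  show "0 < ratio" by (simp add: ratio_def)
  show "ratio < 1" using \<sigma> by (simp add: ratio_def powr_less_one)
  have "2 powr (- 1) < ratio" unfolding ratio_def using \<sigma> by (intro powr_less_mono) simp_all
  then show "1 < 2 * ratio" by (simp add: powr_minus)
qed

lemma step_carrier: "step i \<in> carrier G"
  using l_carrier r_carrier nth_mem[of i l] by (auto simp: step_def)

lemma signed_step_carrier: "signed_step \<omega> \<in> carrier G"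
  using step_carrier by (cases \<omega>) (simp add: signed_step_def)

lemma measurable_signed_step: "signed_step \<in> measurable (measure_pmf index_pmf) (count_space (carrier G))"
  by (simp add: signed_step_carrier)

lemma prob_space_step_measure: "prob_space step_measure"
  unfolding step_measure_def
  by (rule prob_space.prob_space_distr[OF measure_pmf.prob_space_axioms measurable_signed_step])

lemma sets_step_measure: "sets step_measure = Pow (carrier G)"
  by (simp add: step_measure_def)

lemma nn_integral_step_measure: "(\<integral>\<^sup>+g. f g \<partial>step_measure) = (\<integral>\<^sup>+\<omega>. f (signed_step \<omega>) \<partial>measure_pmf index_pmf)"
  unfolding step_measure_def by (rule nn_integral_distr[OF measurable_signed_step]) simp

lemma measure_step_measure: "g \<in> carrier G \<Longrightarrow> measure step_measure {g} = measure (measure_pmf index_pmf) (signed_step -` {g})"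
  unfolding step_measure_def by (subst measure_distr[OF measurable_signed_step]) simp_all

lemma pmf_index: "pmf index_pmf (i, b) = ratio ^ i * (1 - ratio) / 2"
  using ratio by (simp add: index_pmf_def pmf_pair bernoulli_pmf.rep_eq)

lemma step_measure_ge:
  "ratio ^ i * (1 - ratio) / 2 \<le> measure step_measure {step i}"
proof -
  have "ratio ^ i * (1 - ratio) / 2 = measure (measure_pmf index_pmf) {(i, True)}"
    by (simp add: measure_pmf_single pmf_index)
  also have "\<dots> \<le> measure (measure_pmf index_pmf) (signed_step -` {step i})"
    by (intro measure_pmf.finite_measure_mono) (simp_all add: signed_step_def)
  finally show ?thesis by (simp add: measure_step_measure step_carrier)
qed

lemma symmetric_step_measure: "symmetric_measure G step_measure"
  unfolding symmetric_measure_def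
proof
  fix g assume g: "g \<in> carrier G"
  define flip where "flip = (\<lambda>(i :: nat, b). (i, \<not> b))"
  have inj: "inj flip" by (auto simp: flip_def intro!: injI)
  have "pmf (map_pmf flip index_pmf) (flip \<omega>) = pmf index_pmf (flip \<omega>)" for \<omega>
    unfolding pmf_map_inj'[OF inj] by (cases \<omega>) (simp add: flip_def pmf_index)
  moreover have "\<omega> = flip (flip \<omega>)" for \<omega> by (cases \<omega>) (simp add: flip_def)
  ultimately have "pmf (map_pmf flip index_pmf) \<omega> = pmf index_pmf \<omega>" for \<omega> by metis
  then have eq: "map_pmf flip index_pmf = index_pmf" by (rule pmf_eqI)
  have "signed_step -` {inv g} = flip -` (signed_step -` {g})"
  proof (rule Set.set_eqI)
    fix \<omega> :: "nat \<times> bool"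
    obtain i b where \<omega>: "\<omega> = (i, b)" by (cases \<omega>) auto
    have 1: "step i = inv g \<longleftrightarrow> inv (step i) = g" using g step_carrier[of i] by auto
    have 2: "inv (step i) = inv g \<longleftrightarrow> step i = g" using g step_carrier[of i] by (metis inv_inv)
    show "\<omega> \<in> signed_step -` {inv g} \<longleftrightarrow> \<omega> \<in> flip -` (signed_step -` {g})"
      unfolding \<omega> by (cases b) (simp_all add: signed_step_def flip_def 1 2)
  qed
  then have "measure step_measure {inv g} = measure (measure_pmf index_pmf) (flip -` (signed_step -` {g}))"
    using g by (simp add: measure_step_measure)
  also have "\<dots> = measure (measure_pmf (map_pmf flip index_pmf)) (signed_step -` {g})" by simp
  also have "\<dots> = measure step_measure {g}" unfolding eq using g by (simp add: measure_step_measure)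
  finally show "measure step_measure {g} = measure step_measure {inv g}" ..
qed

lemma list_measure_ge:
  assumes "x \<in> set l"
  shows "ratio ^ (length l + n) * (1 - ratio) / 2 \<le> measure step_measure {x}"
proof -
  obtain i where i: "i < length l" "x = l ! i" using assms by (auto simp: in_set_conv_nth)
  have "ratio ^ (length l + n) \<le> ratio ^ i" using i(1) ratio by (intro power_decreasing) simp_all
  then have "ratio ^ (length l + n) * (1 - ratio) / 2 \<le> ratio ^ i * (1 - ratio) / 2"
    using ratio by (intro divide_right_mono mult_right_mono) simp_all
  also have "\<dots> \<le> measure step_measure {x}" using step_measure_ge[of i] i by (simp add: step_def)
  finally show ?thesis .
qed

lemma power_measure_ge:
  "ratio ^ (length l + n) * (1 - ratio) / 2 \<le> measure step_measure {r [^] ((2 :: nat) ^ n)}"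
  using step_measure_ge[of "length l + n"] by (simp add: step_def)

lemma step_word_length_bound:
  assumes S: "S \<subseteq> carrier G" and gen: "generate G S = carrier G"
  shows "\<exists>M>0. \<forall>\<omega>. real (word_length G S (signed_step \<omega>)) \<le> M * 2 ^ fst \<omega>"
proof -
  obtain wr where wr: "word S wr r" using word_generate[OF S] r_carrier gen by blast
  define M where "M = 1 + real (length wr) + (\<Sum>\<omega>\<in>{..<length l} \<times> UNIV. real (word_length G S (signed_step \<omega>)))"
  have S0: "0 \<le> (\<Sum>\<omega>\<in>{..<length l} \<times> UNIV. real (word_length G S (signed_step \<omega>)))" by (intro sum_nonneg) simp
  have M: "M > 0" "real (length wr) \<le> M" using S0 by (simp_all add: M_def)
  have "real (word_length G S (signed_step (i, b))) \<le> M * 2 ^ i" for i b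
  proof (cases "i < length l")
    case True
    have "real (word_length G S (signed_step (i, b))) \<le> (\<Sum>\<omega>\<in>{..<length l} \<times> UNIV. real (word_length G S (signed_step \<omega>)))"
      using True by (intro member_le_sum) auto
    also have "\<dots> \<le> M" by (simp add: M_def)
    also have "M \<le> M * 2 ^ i" using M(1) by (simp add: mult_le_cancel_left1)
    finally show ?thesis .
  next
    case False
    define j where "j = i - length l"
    have st: "step i = r [^] ((2 :: nat) ^ j)" using False by (simp add: step_def j_def)
    have "word_length G S (signed_step (i, b)) \<le> 2 ^ j * length wr"
      using word_length_pow[OF S wr r_carrier, of "2 ^ j"] by (simp add: signed_step_def st)
    then have "real (word_length G S (signed_step (i, b))) \<le> real (2 ^ j * length wr)"
      by (simp only: of_nat_le_iff)
    also have "\<dots> = 2 ^ j * real (length wr)" by simp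
    also have "\<dots> \<le> 2 ^ i * M"
    proof (rule mult_mono[OF _ M(2)])
      show "(2 :: real) ^ j \<le> 2 ^ i" by (rule power_increasing) (simp_all add: j_def)
    qed simp_all
    finally show ?thesis by (simp add: mult.commute)
  qed
  then show ?thesis using M(1) by (intro exI[of _ M]) auto
qed

lemma nn_integral_geometric_index:
  assumes c: "0 \<le> c" "c * ratio < 1"
  shows "(\<integral>\<^sup>+\<omega>. ennreal (c ^ fst \<omega>) \<partial>measure_pmf index_pmf) < \<infinity>"
proof -
  have "(\<integral>\<^sup>+\<omega>. ennreal (c ^ fst \<omega>) \<partial>measure_pmf index_pmf)
      = (\<integral>\<^sup>+i. \<integral>\<^sup>+b. ennreal (c ^ i) \<partial>bernoulli_pmf (1 / 2) \<partial>geometric_pmf (1 - ratio))"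
    unfolding index_pmf_def by (simp add: nn_integral_pair_pmf')
  also have "\<dots> = (\<integral>\<^sup>+i. ennreal (c ^ i) \<partial>geometric_pmf (1 - ratio))"
    by (simp add: measure_pmf.emeasure_space_1)
  also have "\<dots> = (\<integral>\<^sup>+i. ennreal (pmf (geometric_pmf (1 - ratio)) i) * ennreal (c ^ i) \<partial>count_space UNIV)"
    by (rule nn_integral_measure_pmf)
  also have "\<dots> = (\<integral>\<^sup>+i. ennreal ((1 - ratio) * (c * ratio) ^ i) \<partial>count_space UNIV)"
    using ratio c by (intro nn_integral_cong) (simp add: ennreal_mult[symmetric] power_mult_distrib mult_ac)
  also have "\<dots> = (\<Sum>i. ennreal ((1 - ratio) * (c * ratio) ^ i))" by (rule nn_integral_count_space_nat)
  also have "\<dots> = ennreal (\<Sum>i. (1 - ratio) * (c * ratio) ^ i)"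
    using ratio c by (intro suminf_ennreal2 summable_mult summable_geometric) simp_all
  finally show ?thesis by simp
qed

text \<open>The word length of the step with index \<open>i\<close> is \<open>O(2 ^ i)\<close> and its weight is
  \<open>O(2 powr (- i \<sigma>))\<close>.\<close>

lemma finite_moment:
  assumes S: "S \<subseteq> carrier G" and gen: "generate G S = carrier G" and \<alpha>: "\<alpha> < \<sigma>"
  shows "(\<integral>\<^sup>+g. ennreal (real (word_length G S g) powr \<alpha>) \<partial>step_measure) < \<infinity>"
proof -
  \<comment> \<open>For \<open>\<alpha> < 0\<close> the integrand is bounded by the one for \<open>\<beta> = 0\<close>.\<close>
  define \<beta> where "\<beta> = max 0 \<alpha>"
  have \<beta>: "0 \<le> \<beta>" "\<beta> < \<sigma>" "\<alpha> \<le> \<beta>" using \<alpha> \<sigma> by (simp_all add: \<beta>_def)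
  obtain M where M: "M > 0" "\<And>\<omega>. real (word_length G S (signed_step \<omega>)) \<le> M * 2 ^ fst \<omega>"
    using step_word_length_bound[OF S gen] by blast
  have le: "real (word_length G S (signed_step \<omega>)) powr \<alpha> \<le> M powr \<beta> * (2 powr \<beta>) ^ fst \<omega>" for \<omega>
  proof (cases "word_length G S (signed_step \<omega>) = 0")
    case False
    then have "real (word_length G S (signed_step \<omega>)) powr \<alpha> \<le> real (word_length G S (signed_step \<omega>)) powr \<beta>"
      using \<beta>(3) by (intro powr_mono) simp_all
    also have "\<dots> \<le> (M * 2 ^ fst \<omega>) powr \<beta>" using M(2) \<beta>(1) by (intro powr_mono2) simp_all
    also have "\<dots> = M powr \<beta> * (2 powr \<beta>) ^ fst \<omega>"
      using M(1) by (simp add: powr_mult powr_realpow[symmetric] powr_powr mult.commute)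
    finally show ?thesis .
  qed simp
  have "2 powr \<beta> * ratio = 2 powr (\<beta> - \<sigma>)" by (simp add: ratio_def powr_add[symmetric])
  also have "\<dots> < 1" using \<beta> by (simp add: powr_less_one)
  finally have c: "2 powr \<beta> * ratio < 1" .
  have "(\<integral>\<^sup>+g. ennreal (real (word_length G S g) powr \<alpha>) \<partial>step_measure)
      \<le> (\<integral>\<^sup>+\<omega>. ennreal (M powr \<beta>) * ennreal ((2 powr \<beta>) ^ fst \<omega>) \<partial>measure_pmf index_pmf)"
    unfolding nn_integral_step_measure using le by (intro nn_integral_mono) (simp add: ennreal_mult[symmetric] ennreal_leI)
  also have "\<dots> = ennreal (M powr \<beta>) * (\<integral>\<^sup>+\<omega>. ennreal ((2 powr \<beta>) ^ fst \<omega>) \<partial>measure_pmf index_pmf)"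
    by (rule nn_integral_cmult) simp
  also have "\<dots> < \<infinity>" using nn_integral_geometric_index[OF _ c] by (simp add: ennreal_mult_less_top)
  finally show ?thesis .
qed

text \<open>A geometric series, of ratio \<open>2 powr ((\<sigma> - 1) / 2) < 1\<close>.\<close>

lemma summable_energy_weights:
  "summable (\<lambda>n. sqrt (1 / (2 ^ n * (ratio ^ (length l + n) * (1 - ratio) / 2))))"
proof -
  define c where "c = ratio ^ length l * (1 - ratio) / 2"
  have c: "c > 0" using ratio by (simp add: c_def)
  have "sqrt (1 / (2 ^ n * (ratio ^ (length l + n) * (1 - ratio) / 2))) = sqrt (1 / c) * sqrt (1 / (2 * ratio)) ^ n" for n
  proof -
    have "1 / (2 ^ n * (ratio ^ (length l + n) * (1 - ratio) / 2)) = 1 / c * (1 / (2 * ratio)) ^ n"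
      unfolding c_def by (simp add: power_add power_mult_distrib power_one_over field_simps)
    then show ?thesis by (simp only: real_sqrt_mult real_sqrt_power)
  qed
  moreover have "summable (\<lambda>n. sqrt (1 / c) * sqrt (1 / (2 * ratio)) ^ n)"
  proof (intro summable_mult summable_geometric)
    have "sqrt (1 / (2 * ratio)) < sqrt 1" using ratio by (intro real_sqrt_less_mono) simp
    then show "norm (sqrt (1 / (2 * ratio))) < 1" using ratio by simp
  qed
  ultimately show ?thesis by simp
qed

text \<open>Only the finitely many steps from the list have bad points.\<close>

lemma bad_integral_finite:
  assumes fin: "\<And>g. g \<in> carrier G \<Longrightarrow> finite (Bad g)" and powers: "\<And>j::int. Bad (r [^] j) = {}"
  shows "(\<integral>\<^sup>+g. \<integral>\<^sup>+x. indicator (Bad g) x \<partial>count_space X \<partial>step_measure) < \<infinity>"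
proof -
  define \<phi> :: "'a \<Rightarrow> ennreal" where "\<phi> g = (\<integral>\<^sup>+x. indicator (Bad g) x \<partial>count_space X)" for g
  have \<phi>_fin: "\<phi> g < \<infinity>" if "g \<in> carrier G" for g
  proof -
    have "\<phi> g = (\<integral>\<^sup>+x. indicator (Bad g \<inter> X) x \<partial>count_space X)"
      unfolding \<phi>_def by (intro nn_integral_cong) (simp split: split_indicator)
    also have "\<dots> = emeasure (count_space X) (Bad g \<inter> X)" by simp
    also have "\<dots> < \<infinity>" using fin[OF that] by (subst emeasure_count_space_finite) (simp_all add: of_nat_less_top)
    finally show ?thesis .
  qed
  define M where "M = (\<Sum>\<omega>\<in>{..<length l} \<times> UNIV. \<phi> (signed_step \<omega>))"
  have M: "M < \<infinity>" unfolding M_def using \<phi>_fin[OF signed_step_carrier] by (simp add: less_top[symmetric])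
  have "\<phi> (signed_step \<omega>) \<le> M" for \<omega>
  proof (cases "\<omega> \<in> {..<length l} \<times> UNIV")
    case True
    then show ?thesis unfolding M_def by (intro member_le_sum) auto
  next
    case False
    obtain i b where \<omega>: "\<omega> = (i, b)" by (cases \<omega>) auto
    have i: "\<not> i < length l" using False \<omega> by simp
    have "\<exists>j::int. signed_step \<omega> = r [^] j"
    proof (cases b)
      case True
      then have "signed_step \<omega> = r [^] (int (2 ^ (i - length l)))"
        unfolding \<omega> int_pow_int using i by (simp add: signed_step_def step_def)
      then show ?thesis by (rule exI)
    next
      case False
      then have "signed_step \<omega> = r [^] (- int (2 ^ (i - length l)))"
        unfolding \<omega> int_pow_neg[OF r_carrier] int_pow_int using i by (simp add: signed_step_def step_def)
      then show ?thesis by (rule exI)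
    qed
    then have "Bad (signed_step \<omega>) = {}" using powers by auto
    then show ?thesis by (simp add: \<phi>_def)
  qed
  then have "(\<integral>\<^sup>+g. \<phi> g \<partial>step_measure) \<le> (\<integral>\<^sup>+\<omega>. M \<partial>measure_pmf index_pmf)"
    unfolding nn_integral_step_measure by (intro nn_integral_mono)
  also have "\<dots> = M" by (simp add: measure_pmf.emeasure_space_1)
  finally show ?thesis using M unfolding \<phi>_def by (rule le_less_trans)
qed

end

section \<open>Existence of an end and of the measure\<close>

text \<open>The end is the last common fixed point of \<open>H\<close> to the left of \<open>x\<close>, if there is one.\<close>

lemma germ_dynamics_end:
  assumes fS: "finite S" and SG: "S \<subseteq> carrier Gtilde" and H: "H = generate Gtilde S"
    and moved: "h0 \<in> H" "re h0 x \<noteq> x"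
  shows "\<exists>D F. germ_dynamics S H D F \<and> x \<in> germ_dynamics.\<Omega> H D"
proof -
  have sub: "subgroup H Gtilde" unfolding H using SG by (rule group.generate_is_subgroup[OF group_Gtilde])
  have HG: "h \<in> carrier Gtilde" if "h \<in> H" for h by (rule subgroup.mem_carrier[OF sub that])
  define A where "A = {y. y \<le> x \<and> (\<forall>h\<in>H. re h y = y)}"
  show ?thesis
  proof (cases "A = {}")
    case True
    have gd: "germ_dynamics S H UNIV at_bot"
      unfolding germ_dynamics_def germ_dynamics_axioms_def using group_Gtilde fS SG H by simp
    have "x \<in> germ_dynamics.\<Omega> H UNIV"
      unfolding germ_dynamics.\<Omega>_def[OF gd] using True unfolding A_def by blast
    with gd show ?thesis by blast
  next
    case False
    define p where "p = Sup A"
    have bdd: "bdd_above A" by (rule bdd_aboveI[of _ x]) (simp add: A_def)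
    have closed: "closed A"
    proof -
      have "closed {y. re h y = y}" if "h \<in> H" for h
        using continuous_on_re[OF HG[OF that]] by (intro closed_Collect_eq) (auto intro: continuous_on_id)
      then have "closed (\<Inter>h\<in>H. {y. re h y = y})" by (intro closed_INT) blast
      moreover have "A = {..x} \<inter> (\<Inter>h\<in>H. {y. re h y = y})" by (auto simp: A_def)
      ultimately show ?thesis by (simp add: closed_Int)
    qed
    have pA: "p \<in> A" unfolding p_def by (rule closed_contains_Sup[OF False bdd closed])
    have "p \<noteq> x" using pA moved by (auto simp: A_def)
    then have px: "p < x" using pA by (simp add: A_def)
    have pfix: "\<forall>h\<in>H. re h p = p" using pA by (simp add: A_def)
    have gd: "germ_dynamics S H {p<..} (at_right p)"
      unfolding germ_dynamics_def germ_dynamics_axioms_def using group_Gtilde fS SG H pfix by blast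
    have "\<exists>h\<in>H. re h z \<noteq> z" if "p < z" "z \<le> x" for z
    proof (rule ccontr)
      assume "\<not> ?thesis"
      then have "z \<in> A" using that(2) by (simp add: A_def)
      then have "z \<le> p" unfolding p_def using bdd by (rule cSup_upper)
      then show False using that(1) by simp
    qed
    then have "x \<in> germ_dynamics.\<Omega> H {p<..}"
      unfolding germ_dynamics.\<Omega>_def[OF gd] using px by simp
    with gd show ?thesis by blast
  qed
qed

text \<open>Elements of the group are determined by their action on the real line.\<close>

lemma noncommuting_point:
  assumes sub: "subgroup H Gtilde" and nonab: "\<not> comm_group (Gtilde\<lparr>carrier := H\<rparr>)"
  shows "\<exists>g\<in>H. \<exists>h\<in>H. \<exists>x. re (g \<otimes>\<^bsub>Gtilde\<^esub> h) x \<noteq> re (h \<otimes>\<^bsub>Gtilde\<^esub> g) x"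
proof (rule ccontr)
  assume no: "\<not> ?thesis"
  interpret K: group "Gtilde\<lparr>carrier := H\<rparr>" using sub group_Gtilde by (rule subgroup.subgroup_is_group)
  have "g \<otimes>\<^bsub>Gtilde\<^esub> h = h \<otimes>\<^bsub>Gtilde\<^esub> g" if gh: "g \<in> H" "h \<in> H" for g h
  proof
    fix z
    have c: "g \<otimes>\<^bsub>Gtilde\<^esub> h \<in> carrier Gtilde" "h \<otimes>\<^bsub>Gtilde\<^esub> g \<in> carrier Gtilde"
      using subgroup.mem_carrier[OF sub subgroup.m_closed[OF sub gh]] subgroup.mem_carrier[OF sub subgroup.m_closed[OF sub gh(2,1)]] .
    show "(g \<otimes>\<^bsub>Gtilde\<^esub> h) z = (h \<otimes>\<^bsub>Gtilde\<^esub> g) z"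
    proof (cases z)
      case None
      then show ?thesis using GtildeD(2)[OF c(1)] GtildeD(2)[OF c(2)] by simp
    next
      case (Some x)
      have "re (g \<otimes>\<^bsub>Gtilde\<^esub> h) x = re (h \<otimes>\<^bsub>Gtilde\<^esub> g) x" using no gh by blast
      then show ?thesis unfolding Some Gtilde_Some[OF c(1)] Gtilde_Some[OF c(2)] by simp
    qed
  qed
  then have "comm_group (Gtilde\<lparr>carrier := H\<rparr>)" by (intro K.group_comm_groupI) simp
  with nonab show False by contradiction
qed

theorem lemma9p1:
  fixes S H :: "(real option \<Rightarrow> real option) set" and \<epsilon> :: real
  assumes "finite S" and "S \<subseteq> carrier Gtilde"
    and "H = generate Gtilde S"
    and "\<not> comm_group (Gtilde\<lparr>carrier := H\<rparr>)"
    and "\<epsilon> > 0"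
  shows "\<exists>\<mu>. prob_measure_on (Gtilde\<lparr>carrier := H\<rparr>) \<mu> \<and>
             symmetric_measure (Gtilde\<lparr>carrier := H\<rparr>) \<mu> \<and>
             nondegenerate_measure (Gtilde\<lparr>carrier := H\<rparr>) \<mu> \<and>
             nontrivial_poisson_boundary (Gtilde\<lparr>carrier := H\<rparr>) \<mu> \<and>
             (\<integral>\<^sup>+ g. ennreal (real (word_length (Gtilde\<lparr>carrier := H\<rparr>) S g) powr (1 - \<epsilon>)) \<partial>\<mu>) < \<infinity>"
proof -
  define K where "K = Gtilde\<lparr>carrier := H\<rparr>"
  have sub: "subgroup H Gtilde" unfolding assms(3) using assms(2) by (rule group.generate_is_subgroup[OF group_Gtilde])
  have SH: "S \<subseteq> H" unfolding assms(3) by (rule subsetI) (rule generate.incl)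
  have K_group: "group K" unfolding K_def using sub group_Gtilde by (rule subgroup.subgroup_is_group)
  interpret K: group K by (rule K_group)
  have K_simps: "carrier K = H" "\<And>f g. f \<otimes>\<^bsub>K\<^esub> g = f \<otimes>\<^bsub>Gtilde\<^esub> g" "\<one>\<^bsub>K\<^esub> = id"
    by (simp_all add: K_def Gtilde_simps(2))
  have gen_K: "generate K S = carrier K"
    unfolding K_simps(1) unfolding K_def
    using group.generate_consistent[OF group_Gtilde SH sub] assms(3) by simp
  have SK: "S \<subseteq> carrier K" using SH by (simp only: K_simps(1))
  have countable_K: "countable (carrier K)" using K.countable_generate[OF SK assms(1)] gen_K by simp
  obtain g h x where gh: "g \<in> H" "h \<in> H" "re (g \<otimes>\<^bsub>Gtilde\<^esub> h) x \<noteq> re (h \<otimes>\<^bsub>Gtilde\<^esub> g) x"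
    using noncommuting_point[OF sub assms(4)] by blast
  have "re (g \<otimes>\<^bsub>Gtilde\<^esub> h) x \<noteq> x \<or> re (h \<otimes>\<^bsub>Gtilde\<^esub> g) x \<noteq> x" using gh(3) by auto
  then obtain h0 where h0: "h0 \<in> H" "re h0 x \<noteq> x"
    using subgroup.m_closed[OF sub gh(1,2)] subgroup.m_closed[OF sub gh(2,1)] by blast
  obtain D F where gd: "germ_dynamics S H D F" and x: "x \<in> germ_dynamics.\<Omega> H D"
    using germ_dynamics_end[OF assms(1,2,3) h0] by blast
  interpret gd: germ_dynamics S H D F by (rule gd)
  obtain a k r W L p q where a: "a \<in> gd.\<Omega>" and k: "k \<in> H" "re k a = a" "germ (at_left a) k = id" "germ (at_right a) k \<noteq> id"
    and r: "r \<in> H" "gd.stable_jump r" and bad: "\<forall>y\<in>H. finite (gd.bad r y)" "\<forall>j::int. gd.bad r (r [^]\<^bsub>Gtilde\<^esub> j) = {}"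
    and W: "finite W" "W \<subseteq> H" and L: "gd.binary_levels a L p q"
    and pq: "\<forall>n. p n \<in> insert (r [^]\<^bsub>Gtilde\<^esub> ((2::nat) ^ n)) W" "\<forall>n. q n \<in> insert (r [^]\<^bsub>Gtilde\<^esub> ((2::nat) ^ n)) W"
    using gd.dynamics_core[OF gh(1,2) x gh(3)] by (elim bexE exE conjE)
  have nat_pow_K: "y [^]\<^bsub>K\<^esub> (n :: nat) = y [^]\<^bsub>Gtilde\<^esub> n" for y n
    by (induction n) (simp_all add: K_def)
  have int_pow_K: "y [^]\<^bsub>K\<^esub> (n :: int) = y [^]\<^bsub>Gtilde\<^esub> n" if "y \<in> H" for y n
    by (rule group.int_pow_consistent[OF group_Gtilde sub that, folded K_def, symmetric])
  \<comment> \<open>The list contains the generators, for non-degeneracy, and \<open>k\<close>, to be a possible first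
      step.\<close>
  have "finite (W \<union> S \<union> {k})" by (intro finite_UnI W(1) assms(1) finite.intros)
  from finite_list[OF this] obtain l where l: "set l = W \<union> S \<union> {k}" by (rule exE)
  \<comment> \<open>The midpoint between \<open>max 0 (1 - \<epsilon>)\<close> and \<open>1\<close>.\<close>
  define \<sigma> where "\<sigma> = (1 + max 0 (1 - \<epsilon>)) / 2"
  have \<sigma>: "0 < \<sigma>" "\<sigma> < 1" "1 - \<epsilon> < \<sigma>"
    using assms(5) by (simp_all add: \<sigma>_def max_def)
  interpret steps: dyadic_steps K l r \<sigma>
  proof
    show "set l \<subseteq> carrier K" unfolding l K_simps(1) using W(2) SH k(1) by blast
    show "r \<in> carrier K" unfolding K_simps(1) by (rule r(1))
  qed (use \<sigma> countable_K in simp_all)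
  define \<mu> where "\<mu> = steps.step_measure"
  have supp_l: "measure \<mu> {y} > 0" if "y \<in> set l" for y
  proof -
    have "0 < steps.ratio ^ (length l + 0) * (1 - steps.ratio) / 2" using steps.ratio by simp
    then show ?thesis using steps.list_measure_ge[OF that, of 0] unfolding \<mu>_def by linarith
  qed
  define X where "X = (\<lambda>h. re h a) ` H"
  interpret walk: group_action_walk K \<mu> X re a
  proof (intro group_action_walk.intro group_random_walk.intro group_random_walk_axioms.intro group_action_walk_axioms.intro)
    show "group K" by (rule K_group)
    show "prob_space \<mu>" unfolding \<mu>_def by (rule steps.prob_space_step_measure)
    show "countable (carrier K)" by (rule countable_K)
    show "sets \<mu> = Pow (carrier K)" unfolding \<mu>_def by (rule steps.sets_step_measure)
    show "symmetric_measure K \<mu>" unfolding \<mu>_def by (rule steps.symmetric_step_measure)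
    show "countable X" unfolding X_def using countable_K by (simp add: K_simps)
    show "a \<in> X" unfolding X_def by (rule image_eqI[of _ _ id]) (simp_all add: re_id gd.H_id)
    show "re f y \<in> X" if fy: "f \<in> carrier K" "y \<in> X" for f y
    proof -
      have f: "f \<in> H" using fy(1) by (simp only: K_simps(1))
      obtain e where e: "e \<in> H" "y = re e a" using fy(2) unfolding X_def by blast
      have "re f y = re (f \<otimes>\<^bsub>Gtilde\<^esub> e) a" unfolding e(2) gd.re_mult[OF e(1)] ..
      then show ?thesis unfolding X_def using gd.H_mult[OF f e(1)] by (rule image_eqI)
    qed
    show "re \<one>\<^bsub>K\<^esub> y = y" if "y \<in> X" for y unfolding K_simps(3) by (rule re_id)
    show "re (f \<otimes>\<^bsub>K\<^esub> e) y = re f (re e y)" if "f \<in> carrier K" "e \<in> carrier K" "y \<in> X" for f e y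
      unfolding K_simps(2) using that(2) by (intro gd.re_mult) (simp only: K_simps(1))
  qed
  have L': "L 0 = {a}" "\<And>n. L (Suc n) = re (p n) ` L n \<union> re (q n) ` L n" "\<And>n. card (L n) = 2 ^ n"
    using L unfolding gd.binary_levels_def by blast+
  have weight: "steps.ratio ^ (length l + n) * (1 - steps.ratio) / 2 \<le> measure \<mu> {y}"
    if "y \<in> insert (r [^]\<^bsub>Gtilde\<^esub> ((2::nat) ^ n)) W" for y n
    using that
  proof
    assume "y = r [^]\<^bsub>Gtilde\<^esub> ((2::nat) ^ n)"
    then show ?thesis using steps.power_measure_ge[of n] unfolding \<mu>_def nat_pow_K by simp
  next
    assume "y \<in> W"
    then show ?thesis unfolding \<mu>_def using l by (intro steps.list_measure_ge) simp
  qed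
  have in_K: "y \<in> carrier K" if "y \<in> insert (r [^]\<^bsub>Gtilde\<^esub> ((2::nat) ^ n)) W" for y n
    using that gd.H_pow[OF r(1), of "2 ^ n"] W(2) unfolding K_simps(1) by blast
  obtain C where C: "C < \<infinity>" "\<forall>N. walk.green N a \<le> C"
  proof -
    have "\<exists>C<\<infinity>. \<forall>N. walk.green N a \<le> C"
    proof (rule walk.green_bounded[OF L'(1,2,3)])
      show "p n \<in> carrier K" "q n \<in> carrier K" for n using in_K pq by blast+
      show "steps.ratio ^ (length l + n) * (1 - steps.ratio) / 2 \<le> measure \<mu> {p n}" for n
        using pq(1) by (intro weight) (rule spec)
      show "steps.ratio ^ (length l + n) * (1 - steps.ratio) / 2 \<le> measure \<mu> {q n}" for n
        using pq(2) by (intro weight) (rule spec)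
      show "0 < steps.ratio ^ (length l + n) * (1 - steps.ratio) / 2" for n using steps.ratio by simp
      show "summable (\<lambda>n. sqrt (1 / (2 ^ n * (steps.ratio ^ (length l + n) * (1 - steps.ratio) / 2))))"
        by (rule steps.summable_energy_weights)
    qed
    then show thesis using that by blast
  qed
  have bad_int: "(\<integral>\<^sup>+y. \<integral>\<^sup>+z. indicator (gd.bad r y) z \<partial>count_space X \<partial>\<mu>) < \<infinity>"
    unfolding \<mu>_def
  proof (rule steps.bad_integral_finite)
    show "finite (gd.bad r y)" if "y \<in> carrier K" for y using bad(1) that by (simp add: K_simps)
    show "gd.bad r (r [^]\<^bsub>K\<^esub> j) = {}" for j :: int using bad(2) by (simp add: int_pow_K[OF r(1)])
  qed
  have nontriv: "nontrivial_poisson_boundary K \<mu>"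
  proof (rule walk.nontrivial_poisson_boundary[where \<Phi>="gd.final_jump r a" and k=k and \<psi>="\<lambda>v. v \<circ> germ (at_right a) k"])
    show "walk.green N a \<le> C" for N using C(2) by (rule spec)
    show "C < \<infinity>" by (rule C(1))
    show "(\<integral>\<^sup>+y. \<integral>\<^sup>+z. indicator (gd.bad r y) z \<partial>count_space X \<partial>\<mu>) < \<infinity>" by (rule bad_int)
    show "gd.final_jump r a (y \<otimes>\<^bsub>K\<^esub> e) = gd.final_jump r a e"
      if "y \<in> carrier K" "e \<in> carrier K" "re e a \<notin> gd.bad r y" for y e
      unfolding K_simps(2) by (rule gd.final_jump_not_bad[OF r a that(1)[unfolded K_simps(1)] that(2)[unfolded K_simps(1)] that(3)])
    show "k \<in> carrier K" unfolding K_simps(1) by (rule k(1))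
    show "0 < measure \<mu> {k}" by (rule supp_l) (simp add: l)
    show "gd.final_jump r a (e \<otimes>\<^bsub>K\<^esub> k) = gd.final_jump r a e \<circ> germ (at_right a) k" if "e \<in> carrier K" for e
      unfolding K_simps(2) by (rule gd.final_jump_right[OF r a k(1,2,3) that[unfolded K_simps(1)]])
    show "gd.final_jump r a e \<circ> germ (at_right a) k \<noteq> gd.final_jump r a e" if "e \<in> carrier K" for e
      by (rule gd.final_jump_moved[OF r a that[unfolded K_simps(1)] k(4)])
  qed
  have nondeg: "nondegenerate_measure K \<mu>"
    unfolding nondegenerate_measure_def
  proof
    have "S \<subseteq> {y \<in> carrier K. measure \<mu> {y} \<noteq> 0}"
    proof
      fix y assume y: "y \<in> S"
      then have "y \<in> set l" by (simp add: l)
      from supp_l[OF this] show "y \<in> {y \<in> carrier K. measure \<mu> {y} \<noteq> 0}" using y SK by auto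
    qed
    then show "carrier K \<subseteq> generate K {y \<in> carrier K. measure \<mu> {y} \<noteq> 0}"
      using K.mono_generate gen_K by blast
    show "generate K {y \<in> carrier K. measure \<mu> {y} \<noteq> 0} \<subseteq> carrier K"
      by (rule K.generate_incl) blast
  qed
  have moment: "(\<integral>\<^sup>+ y. ennreal (real (word_length K S y) powr (1 - \<epsilon>)) \<partial>\<mu>) < \<infinity>"
    unfolding \<mu>_def by (rule steps.finite_moment[OF SK gen_K \<sigma>(3)])
  have "prob_measure_on K \<mu>"
    unfolding prob_measure_on_def \<mu>_def using steps.prob_space_step_measure steps.sets_step_measure by (rule conjI)
  moreover have "symmetric_measure K \<mu>" unfolding \<mu>_def by (rule steps.symmetric_step_measure)
  ultimately show ?thesis using nontriv nondeg moment unfolding K_def by (intro exI[of _ \<mu>] conjI)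
qed

end
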